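(* Let $d\geq 1$ and $\frac4d<p_1<p_0$, and let $s_0=\frac d2-\frac{2}{p_0}$. There exists a nonincreasing function $\mathsf{e}:[0,m_c)\to(0,\infty]$, with $\mathsf{e}(m)=\infty$ for $0<m<\tilde m_c$ and $\mathsf{e}(m)\in(0,\infty)$ for $\tilde m_c\leq m<m_c$, such that, letting $$\mathcal{R}=\left\{\varphi\in H^{s_0}(\mathbb{R}^d)\cap H^1(\mathbb{R}^d):\ 0<\int_{\mathbb{R}^d}|\varphi|^2\,dx<m_c,\ E(\varphi)<\mathsf{e}\Big(\int_{\mathbb{R}^d}|\varphi|^2\,dx\Big)\right\},$$ one has $\Phi(u)>0$ for every $u\in\mathcal{R}$. Moreover, if $d\in\{1,2,3,4\}$ or $p_0\leq\frac{4}{d-2}$, the function $\mathsf{e}$ is strictly decreasing on $[\tilde m_c,m_c)$.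
   Context: Functions are complex-valued on $\mathbb{R}^d$. The energy and virial functionals are $$E(u)=\int_{\mathbb{R}^d}|\nabla u|^2\,dx-\frac{2}{p_1+2}\int_{\mathbb{R}^d}|u|^{p_1+2}\,dx+\frac{2}{p_0+2}\int_{\mathbb{R}^d}|u|^{p_0+2}\,dx,$$ $$\Phi(u)=\int_{\mathbb{R}^d}|\nabla u|^2\,dx-\frac{dp_1}{2(p_1+2)}\int_{\mathbb{R}^d}|u|^{p_1+2}\,dx+\frac{dp_0}{2(p_0+2)}\int_{\mathbb{R}^d}|u|^{p_0+2}\,dx.$$ For $m\ge 0$ let $I(m)=\inf\{E(\varphi):\varphi\in H^1(\mathbb{R}^d)\cap L^{p_0+2}(\mathbb{R}^d),\ \int|\varphi|^2=m\}$. It is known that there is a critical mass $m_c\in(0,\infty)$ such that $I(m)=0$ for $m\le m_c$ and $I(m)<0$ for $m>m_c$; this defines $m_c$. Furthermore $$\tilde m_c=\left(\frac{p_0}{p_1}\right)^{\frac{p_1d-4}{2(p_0-p_1)}}\left(\frac{4}{dp_1}\right)^{\frac d2}m_c,$$ which satisfies $0<\tilde m_c<m_c$. *)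

theory Defs
  imports "HOL-Analysis.Analysis"
begin

text \<open>
  Elements of function spaces on \<open>\<real>\<^sup>d\<close>, with \<open>d = CARD('n)\<close>, are given by Borel representatives
  of their almost-everywhere classes; all notions below are invariant under changes on null sets.
\<close>

definition Lp :: "real \<Rightarrow> (real^'n \<Rightarrow> 'b::euclidean_space) set" where
  "Lp q = {u \<in> borel_measurable lborel. integrable lborel (\<lambda>x. norm (u x) powr q)}"

primrec C_k :: "nat \<Rightarrow> (real^'n \<Rightarrow> real) \<Rightarrow> bool" where
  "C_k 0 f \<longleftrightarrow> continuous_on UNIV f"
| "C_k (Suc k) f \<longleftrightarrow> f differentiable_on UNIV \<and>
     (\<forall>i. C_k k (\<lambda>x. frechet_derivative f (at x) (axis i 1)))"

definition test_functions :: "(real^'n \<Rightarrow> real) set" where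
  "test_functions = {\<phi>. (\<forall>k. C_k k \<phi>) \<and> compact (closure {x. \<phi> x \<noteq> 0})}"

definition has_weak_gradient :: "(real^'n \<Rightarrow> complex) \<Rightarrow> (real^'n \<Rightarrow> complex^'n) \<Rightarrow> bool" where
  "has_weak_gradient u G \<longleftrightarrow>
     (\<forall>\<phi>\<in>test_functions. \<forall>i.
        (\<integral>x. frechet_derivative \<phi> (at x) (axis i 1) *\<^sub>R u x \<partial>lborel)
          = - (\<integral>x. \<phi> x *\<^sub>R (G x $ i) \<partial>lborel))"

definition H1 :: "(real^'n \<Rightarrow> complex) set" where
  "H1 = {u \<in> Lp 2. \<exists>G\<in>Lp 2. has_weak_gradient u G}"

text \<open>Determined up to null sets for \<open>u \<in> H1\<close>, and arbitrary otherwise.\<close>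

definition weak_gradient :: "(real^'n \<Rightarrow> complex) \<Rightarrow> real^'n \<Rightarrow> complex^'n" where
  "weak_gradient u = (SOME G. G \<in> Lp 2 \<and> has_weak_gradient u G)"

definition fourier_integral :: "(real^'n \<Rightarrow> complex) \<Rightarrow> real^'n \<Rightarrow> complex" where
  "fourier_integral f \<xi> =
     (\<integral>x. cis (- (\<xi> \<bullet> x)) * f x \<partial>lborel) / complex_of_real ((2 * pi) powr (real CARD('n) / 2))"

text \<open>
  The Fourier--Plancherel transform of \<open>u \<in> Lp 2\<close> is the limit in \<open>L\<^sup>2\<close>, as \<open>R \<rightarrow> \<infinity>\<close>, of the
  Fourier integrals of the truncations of \<open>u\<close> to balls of radius \<open>R\<close>. It is
  a relation because the limit is determined only up to null sets.
\<close>

definition has_plancherel_transform :: "(real^'n \<Rightarrow> complex) \<Rightarrow> (real^'n \<Rightarrow> complex) \<Rightarrow> bool" where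
  "has_plancherel_transform u g \<longleftrightarrow> u \<in> Lp 2 \<and> g \<in> Lp 2 \<and>
     ((\<lambda>R. \<integral>\<^sup>+\<xi>. ennreal ((cmod (fourier_integral (\<lambda>x. indicator (cball 0 R) x *\<^sub>R u x) \<xi> - g \<xi>))\<^sup>2) \<partial>lborel)
        \<longlongrightarrow> 0) at_top"

definition Hs :: "real \<Rightarrow> (real^'n \<Rightarrow> complex) set" where
  "Hs s = {u \<in> Lp 2. \<exists>g. has_plancherel_transform u g \<and>
             integrable lborel (\<lambda>\<xi>. (1 + (norm \<xi>)\<^sup>2) powr s * (cmod (g \<xi>))\<^sup>2)}"

definition mass :: "(real^'n \<Rightarrow> complex) \<Rightarrow> real" where
  "mass u = (\<integral>x. (cmod (u x))\<^sup>2 \<partial>lborel)"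

definition energy :: "real \<Rightarrow> real \<Rightarrow> (real^'n \<Rightarrow> complex) \<Rightarrow> real" where
  "energy p0 p1 u =
     (\<integral>x. (norm (weak_gradient u x))\<^sup>2 \<partial>lborel)
     - 2 / (p1 + 2) * (\<integral>x. cmod (u x) powr (p1 + 2) \<partial>lborel)
     + 2 / (p0 + 2) * (\<integral>x. cmod (u x) powr (p0 + 2) \<partial>lborel)"

definition virial :: "real \<Rightarrow> real \<Rightarrow> (real^'n \<Rightarrow> complex) \<Rightarrow> real" where
  "virial p0 p1 u =
     (\<integral>x. (norm (weak_gradient u x))\<^sup>2 \<partial>lborel)
     - real CARD('n) * p1 / (2 * (p1 + 2)) * (\<integral>x. cmod (u x) powr (p1 + 2) \<partial>lborel)
     + real CARD('n) * p0 / (2 * (p0 + 2)) * (\<integral>x. cmod (u x) powr (p0 + 2) \<partial>lborel)"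

text \<open>The type argument fixes the space \<open>\<real>\<^sup>d\<close>, which the remaining arguments do not determine.\<close>

definition min_energy :: "'n::finite itself \<Rightarrow> real \<Rightarrow> real \<Rightarrow> real \<Rightarrow> ereal" where
  "min_energy (_ :: 'n itself) p0 p1 m =
     (INF \<phi> \<in> {\<phi> :: real^'n \<Rightarrow> complex. \<phi> \<in> H1 \<inter> Lp (p0 + 2) \<and> mass \<phi> = m}.
        ereal (energy p0 p1 \<phi>))"

text \<open>At most one \<open>mc\<close> satisfies this predicate, so it characterizes the critical mass.\<close>

definition is_critical_mass :: "'n::finite itself \<Rightarrow> real \<Rightarrow> real \<Rightarrow> real \<Rightarrow> bool" where
  "is_critical_mass T p0 p1 mc \<longleftrightarrow> 0 < mc \<and>
     (\<forall>m. 0 \<le> m \<and> m \<le> mc \<longrightarrow> min_energy T p0 p1 m = 0) \<and>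
     (\<forall>m. mc < m \<longrightarrow> min_energy T p0 p1 m < 0)"

definition critical_mass_tilde :: "nat \<Rightarrow> real \<Rightarrow> real \<Rightarrow> real \<Rightarrow> real" where
  "critical_mass_tilde d p0 p1 mc =
     (p0 / p1) powr ((p1 * real d - 4) / (2 * (p0 - p1))) * (4 / (real d * p1)) powr (real d / 2) * mc"

definition region :: "real \<Rightarrow> real \<Rightarrow> real \<Rightarrow> (real \<Rightarrow> ereal) \<Rightarrow> (real^'n \<Rightarrow> complex) set" where
  "region p0 p1 mc e =
     {\<phi> \<in> Hs (real CARD('n) / 2 - 2 / p0) \<inter> H1.
        0 < mass \<phi> \<and> mass \<phi> < mc \<and> ereal (energy p0 p1 \<phi>) < e (mass \<phi>)}"

end

theory Submission
  imports Defs "HOL-Probability.Characteristic_Functions" "HOL-Computational_Algebra.Polynomial"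
begin

text \<open>
  Since \<open>e\<close> may be chosen smaller than the optimal function, put \<open>e m = \<infinity>\<close> below \<open>mct\<close> and
  \<open>e m = \<delta> (1 - (m / mc) powr (2 / d))\<close> above, which is strictly decreasing in every dimension.
  Nonnegativity of the energy at mass \<open>mc\<close>, applied to all rescalings of \<open>u\<close>, bounds the \<open>p1\<close>-term by the
  other two; one scaling gives \<open>\<Phi>(u) > 0\<close> below \<open>mct\<close>, another \<open>E(u) \<ge> (1 - (m / mc) powr (2 / d)) \<parallel>\<nabla>u\<parallel>\<^sup>2\<close>.
  If \<open>\<Phi>(u) \<le> 0\<close>, a Gagliardo--Nirenberg inequality with an exponent slightly above \<open>2 + 4 / d\<close> bounds
  \<open>\<parallel>\<nabla>u\<parallel>\<^sup>2\<close> by a power of itself larger than one, hence from below by some \<open>\<delta> > 0\<close>.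
\<close>

section \<open>Gaussian integrals\<close>

text \<open>A divergent Bochner integral has the value 0, so energy and virial say something about
  \<open>u\<close> only if \<open>u\<close> lies in \<open>Lp (p0 + 2)\<close>. The power p0 may be
  too large for H1 to embed there, and then the order s0 = d/2 - 2/p0 has to provide it. This
  requires a Sobolev inequality of fractional order, stated for the Plancherel transform. No
  inversion formula is used: all Fourier estimates are dual ones and come from one identity with a
  Gaussian weight. The same inequality shows that weak gradients are unique; since
  \<open>weak_gradient\<close> is an arbitrary choice, the energy of rescaled functions could not be
  computed otherwise.

  A large p1 may also rule out Gagliardo--Nirenberg at p1 + 2. Hence p1 + 2 is interpolated between
  a smaller exponent q and p0 + 2, with weights for which the p0-terms of the virial cancel. The
  remaining power of the squared gradient norm is d (q - 2) / 4, which exceeds 1 exactly when q > 2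
  + 4/d.

  The value of \<open>mct\<close> comes from the scaling c with c^(p0 - p1) = p0/p1: it gives the
  two power terms the same ratio as in the virial, and \<open>mct\<close> is the mass at which the
  gradient coefficient reaches 1.\<close>

lemma
  fixes f :: "'a::euclidean_space \<Rightarrow> real \<Rightarrow> 'b::{real_normed_field,banach,second_countable_topology}"
  assumes int: "\<And>b. b \<in> Basis \<Longrightarrow> integrable lborel (f b)"
  shows integrable_lborel_prod_Basis: "integrable lborel (\<lambda>x::'a. \<Prod>b\<in>Basis. f b (x \<bullet> b))"
    and integral_lborel_prod_Basis:
      "(\<integral>x. (\<Prod>b\<in>Basis. f b ((x::'a) \<bullet> b)) \<partial>lborel) = (\<Prod>b\<in>Basis. \<integral>x. f b x \<partial>lborel)"
proof -
  interpret product_sigma_finite "\<lambda>_::'a. lborel :: real measure" ..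
  have m [measurable]: "f b \<in> borel_measurable borel" if "b \<in> Basis" for b
    using int[OF that] by simp
  let ?T = "\<lambda>g. \<Sum>b\<in>Basis. g b *\<^sub>R b :: 'a"
  have T [measurable]: "?T \<in> (\<Pi>\<^sub>M b\<in>Basis. lborel) \<rightarrow>\<^sub>M borel"
    by measurable
  have F [measurable]: "(\<lambda>x::'a. \<Prod>b\<in>Basis. f b (x \<bullet> b)) \<in> borel_measurable borel"
    by measurable
  have e: "(\<Prod>b\<in>Basis. f b (?T g \<bullet> b)) = (\<Prod>b\<in>Basis. f b (g b))" for g :: "'a \<Rightarrow> real"
    by (intro prod.cong) (auto simp: inner_sum_left inner_Basis if_distrib cong: if_cong)
  show "integrable lborel (\<lambda>x::'a. \<Prod>b\<in>Basis. f b (x \<bullet> b))"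
    by (subst lborel_eq, subst integrable_distr_eq[OF T F], subst e)
      (intro product_integrable_prod int, auto)
  show "(\<integral>x. (\<Prod>b\<in>Basis. f b ((x::'a) \<bullet> b)) \<partial>lborel) = (\<Prod>b\<in>Basis. \<integral>x. f b x \<partial>lborel)"
    by (subst lborel_eq, subst integral_distr[OF T F], subst e)
      (intro product_integral_prod int, auto)
qed

text \<open>The standard normal density. It serves both as a convergence factor on the frequency
  side and, rescaled, as an approximate identity in space.\<close>

definition gauss :: "'a::euclidean_space \<Rightarrow> real" where
  "gauss x = exp (- (norm x)\<^sup>2 / 2) / (2 * pi) powr (real DIM('a) / 2)"

lemma gauss_eq_prod: "gauss (x :: 'a::euclidean_space) = (\<Prod>b\<in>Basis. std_normal_density (x \<bullet> b))"
proof -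
  have "(\<Prod>b\<in>Basis. std_normal_density (x \<bullet> b))
      = (1 / sqrt (2 * pi)) ^ DIM('a) * exp (\<Sum>b\<in>Basis. - (x \<bullet> b)\<^sup>2 / 2)"
    by (simp add: std_normal_density_def exp_sum prod_dividef power_divide)
  also have "(\<Sum>b\<in>Basis. - (x \<bullet> b)\<^sup>2 / 2) = - (norm x)\<^sup>2 / 2"
    unfolding norm_eq_sqrt_inner euclidean_inner[of x x]
    by (simp add: sum_negf sum_divide_distrib sum_nonneg power2_eq_square)
  also have "(1 / sqrt (2 * pi)) ^ DIM('a) = 1 / (2 * pi) powr (real DIM('a) / 2)"
    by (simp add: power_divide powr_half_sqrt[symmetric] powr_realpow[symmetric] powr_powr)
  finally show ?thesis by (simp add: gauss_def)
qed

lemma gauss_nonneg [simp]: "0 \<le> gauss x"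
  by (simp add: gauss_def)

lemma borel_measurable_gauss [measurable]: "gauss \<in> borel_measurable borel"
  unfolding gauss_def by measurable

lemma integrable_gauss: "integrable lborel (gauss :: 'a::euclidean_space \<Rightarrow> real)"
  unfolding gauss_eq_prod[abs_def] by (rule integrable_lborel_prod_Basis) auto

lemma integral_gauss: "(\<integral>x. gauss (x::'a::euclidean_space) \<partial>lborel) = 1"
  unfolding gauss_eq_prod[abs_def] by (subst integral_lborel_prod_Basis) auto

lemma cis_sum: "finite A \<Longrightarrow> cis (\<Sum>b\<in>A. f b) = (\<Prod>b\<in>A. cis (f b))"
  by (induction A rule: finite_induct) (auto simp: cis_mult[symmetric])

text \<open>Character and density both factor over the coordinates, so this is a product of
  one-dimensional characteristic functions of the standard normal distribution.\<close>

lemma gauss_fourier: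
  fixes t :: "'a::euclidean_space"
  shows "(\<integral>x. cis (t \<bullet> x) * gauss x \<partial>lborel) = exp (- (norm t)\<^sup>2 / 2)"
proof -
  let ?f = "\<lambda>b x. cis ((t \<bullet> b) * x) * std_normal_density x"
  have m [measurable]: "cis \<in> borel_measurable borel"
    by (intro borel_measurable_continuous_onI continuous_intros)
  have int: "integrable lborel (?f b)" for b
    by (rule Bochner_Integration.integrable_bound[of lborel std_normal_density]) (auto simp: norm_mult)
  have eq: "cis (t \<bullet> x) * gauss x = (\<Prod>b\<in>Basis. ?f b (x \<bullet> b))" for x
  proof -
    have "cis (t \<bullet> x) = (\<Prod>b\<in>Basis. cis ((t \<bullet> b) * (x \<bullet> b)))"
      by (subst cis_sum[symmetric], simp, subst euclidean_inner, simp)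
    then show ?thesis
      by (simp add: gauss_eq_prod prod.distrib)
  qed
  have one: "(\<integral>x. ?f b x \<partial>lborel) = complex_of_real (exp (- (t \<bullet> b)\<^sup>2 / 2))" for b
  proof -
    have "char std_normal_distribution (t \<bullet> b) = (\<integral>x. std_normal_density x *\<^sub>R cis ((t \<bullet> b) * x) \<partial>lborel)"
      unfolding char_def by (subst integral_density) (auto simp: cis_conv_exp)
    also have "\<dots> = (\<integral>x. ?f b x \<partial>lborel)"
      by (intro Bochner_Integration.integral_cong) (auto simp: scaleR_conv_of_real)
    finally show ?thesis
      by (simp add: char_std_normal_distribution)
  qed
  have "(\<integral>x. cis (t \<bullet> x) * gauss x \<partial>lborel) = (\<Prod>b\<in>Basis. complex_of_real (exp (- (t \<bullet> b)\<^sup>2 / 2)))"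
    unfolding eq by (subst integral_lborel_prod_Basis[OF int]) (simp add: one)
  also have "\<dots> = exp (\<Sum>b\<in>Basis. - (t \<bullet> b)\<^sup>2 / 2)"
    by (simp add: exp_sum)
  also have "(\<Sum>b\<in>Basis. - (t \<bullet> b)\<^sup>2 / 2) = - (norm t)\<^sup>2 / 2"
    unfolding norm_eq_sqrt_inner euclidean_inner[of t t]
    by (simp add: sum_negf sum_divide_distrib sum_nonneg power2_eq_square)
  finally show ?thesis .
qed

section \<open>Affine substitution in Lebesgue integrals\<close>

lemma distr_affine_lborel:
  fixes t :: "'a::euclidean_space"
  assumes "c \<noteq> 0"
  shows "distr lborel borel (\<lambda>x. t + c *\<^sub>R x) = density lborel (\<lambda>_. ennreal (1 / \<bar>c\<bar> ^ DIM('a)))"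
proof -
  have "density lborel (\<lambda>_. ennreal (1 / \<bar>c\<bar> ^ DIM('a)))
      = density (density (distr lborel borel (\<lambda>x. t + c *\<^sub>R x)) (\<lambda>_. \<bar>c\<bar> ^ DIM('a)))
          (\<lambda>_. ennreal (1 / \<bar>c\<bar> ^ DIM('a)))"
    by (subst (1) lborel_affine[OF assms, of t]) simp
  also have "\<dots> = distr lborel borel (\<lambda>x. t + c *\<^sub>R x)"
    using assms by (simp add: density_density_eq ennreal_mult'[symmetric] ennreal_power density_1)
  finally show ?thesis ..
qed

lemma nn_integral_lborel_affine:
  fixes t :: "'a::euclidean_space"
  assumes [measurable]: "f \<in> borel_measurable borel" and "c \<noteq> 0"
  shows "(\<integral>\<^sup>+x. f (t + c *\<^sub>R x) \<partial>lborel) = ennreal (1 / \<bar>c\<bar> ^ DIM('a)) * (\<integral>\<^sup>+x. f x \<partial>lborel)"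
proof -
  have "(\<integral>\<^sup>+x. f (t + c *\<^sub>R x) \<partial>lborel) = (\<integral>\<^sup>+x. f x \<partial>distr lborel borel (\<lambda>x. t + c *\<^sub>R x))"
    by (subst nn_integral_distr) auto
  then show ?thesis
    by (simp add: distr_affine_lborel[OF assms(2)] nn_integral_density nn_integral_cmult)
qed

lemma integrable_lborel_affine:
  fixes t :: "'a::euclidean_space" and f :: "'a \<Rightarrow> 'b::{banach,second_countable_topology}"
  assumes f: "integrable lborel f" and "c \<noteq> 0"
  shows "integrable lborel (\<lambda>x. f (t + c *\<^sub>R x))"
proof -
  have [measurable]: "f \<in> borel_measurable borel" using f by simp
  show ?thesis
    using f nn_integral_lborel_affine[OF _ assms(2), of "\<lambda>x. ennreal (norm (f x))" t]
    unfolding integrable_iff_bounded by (auto simp: ennreal_mult_less_top)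
qed

lemma integral_lborel_affine:
  fixes t :: "'a::euclidean_space" and f :: "'a \<Rightarrow> 'b::{banach,second_countable_topology}"
  assumes [measurable]: "f \<in> borel_measurable borel" and "c \<noteq> 0"
  shows "(\<integral>x. f (t + c *\<^sub>R x) \<partial>lborel) = (1 / \<bar>c\<bar> ^ DIM('a)) *\<^sub>R (\<integral>x. f x \<partial>lborel)"
proof -
  have "(\<integral>x. f (t + c *\<^sub>R x) \<partial>lborel) = (\<integral>x. f x \<partial>distr lborel borel (\<lambda>x. t + c *\<^sub>R x))"
    by (subst integral_distr) auto
  then show ?thesis
    by (simp add: distr_affine_lborel[OF assms(2)] integral_density)
qed

section \<open>The Plancherel inequality and the Parseval identity\<close>

lemma borel_measurable_cis [measurable]: "cis \<in> borel_measurable borel"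
  by (intro borel_measurable_continuous_onI continuous_intros)

lemma borel_measurable_cnj [measurable]: "cnj \<in> borel_measurable borel"
  by (intro borel_measurable_continuous_onI continuous_intros)

lemma (in pair_sigma_finite)
  fixes f :: "'a \<Rightarrow> 'c::{real_normed_field,banach,second_countable_topology}"
  assumes f: "integrable M1 f" and g: "integrable M2 g"
  shows integrable_pair_mult: "integrable (M1 \<Otimes>\<^sub>M M2) (\<lambda>(x, y). f x * g y)"
    and integral_pair_mult:
      "(\<integral>p. (case p of (x, y) \<Rightarrow> f x * g y) \<partial>(M1 \<Otimes>\<^sub>M M2)) = (\<integral>x. f x \<partial>M1) * (\<integral>y. g y \<partial>M2)"
proof -
  have [measurable]: "f \<in> borel_measurable M1" "g \<in> borel_measurable M2"
    using f g by auto
  show int: "integrable (M1 \<Otimes>\<^sub>M M2) (\<lambda>(x, y). f x * g y)"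
    by (rule Fubini_integrable) (use f g in \<open>auto simp: norm_mult\<close>)
  show "(\<integral>p. (case p of (x, y) \<Rightarrow> f x * g y) \<partial>(M1 \<Otimes>\<^sub>M M2)) = (\<integral>x. f x \<partial>M1) * (\<integral>y. g y \<partial>M2)"
    by (subst integral_fst[OF int, symmetric]) simp
qed

text \<open>The right side is a constant times the Gaussian kernel of integral 1 and width \<sigma>:
  a weight that flattens out on the frequency side as \<sigma> tends to 0 becomes an approximate
  identity in space.\<close>

lemma fourier_integral_eq_gauss:
  fixes w :: "'a::euclidean_space" and \<sigma> :: real
  assumes "\<sigma> > 0"
  shows "(\<integral>\<xi>. cis (- (\<xi> \<bullet> w)) * gauss (\<sigma> *\<^sub>R \<xi>) \<partial>lborel)
      = (2 * pi) powr (real DIM('a) / 2) / \<sigma> ^ DIM('a) * gauss ((1 / \<sigma>) *\<^sub>R w)"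
proof -
  let ?k = "\<lambda>\<eta>. cis ((- (1 / \<sigma>) *\<^sub>R w) \<bullet> \<eta>) * gauss \<eta>"
  have "(\<integral>\<xi>. cis (- (\<xi> \<bullet> w)) * gauss (\<sigma> *\<^sub>R \<xi>) \<partial>lborel) = (\<integral>\<xi>. ?k (0 + \<sigma> *\<^sub>R \<xi>) \<partial>lborel)"
    using assms by (intro Bochner_Integration.integral_cong) (auto simp: inner_commute)
  also have "\<dots> = (1 / \<bar>\<sigma>\<bar> ^ DIM('a)) *\<^sub>R (\<integral>\<eta>. ?k \<eta> \<partial>lborel)"
    using assms by (intro integral_lborel_affine) auto
  finally show ?thesis
    using assms unfolding gauss_fourier
    by (simp add: gauss_def scaleR_conv_of_real)
qed

lemma borel_measurable_fourier_integral [measurable]: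
  assumes [measurable]: "f \<in> borel_measurable borel"
  shows "fourier_integral f \<in> borel_measurable borel"
proof -
  have "(\<lambda>\<xi>. \<integral>x. cis (- (\<xi> \<bullet> x)) * f x \<partial>lborel) \<in> borel_measurable borel"
    by (rule lborel.borel_measurable_lebesgue_integral) measurable
  then show ?thesis
    unfolding fourier_integral_def[abs_def] by measurable
qed

lemma integrable_cis_mult:
  fixes f :: "real^'n \<Rightarrow> complex"
  assumes "integrable lborel f"
  shows "integrable lborel (\<lambda>x. cis (\<xi> \<bullet> x) * f x)" "integrable lborel (\<lambda>x. cis (- (\<xi> \<bullet> x)) * f x)"
  by (rule Bochner_Integration.integrable_bound[OF assms], use assms in \<open>auto simp: norm_mult\<close>)+

lemma fourier_integral_diff:
  fixes f g :: "real^'n \<Rightarrow> complex"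
  assumes "integrable lborel f" "integrable lborel g"
  shows "fourier_integral (\<lambda>x. f x - g x) \<xi> = fourier_integral f \<xi> - fourier_integral g \<xi>"
  using assms[THEN integrable_cis_mult(2), of \<xi>]
  by (simp add: fourier_integral_def right_diff_distrib diff_divide_distrib)

lemma norm_fourier_integral_le:
  fixes f :: "real^'n \<Rightarrow> complex"
  shows "cmod (fourier_integral f \<xi>) \<le> (\<integral>x. cmod (f x) \<partial>lborel) / (2 * pi) powr (real CARD('n) / 2)"
proof -
  have "cmod (\<integral>x. cis (- (\<xi> \<bullet> x)) * f x \<partial>lborel) \<le> (\<integral>x. cmod (cis (- (\<xi> \<bullet> x)) * f x) \<partial>lborel)"
    by (rule integral_norm_bound)
  also have "\<dots> = (\<integral>x. cmod (f x) \<partial>lborel)"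
    by (simp add: norm_mult)
  finally show ?thesis
    unfolding fourier_integral_def by (auto simp: norm_divide intro!: divide_right_mono)
qed

lemma
  fixes f h :: "real^'n \<Rightarrow> complex"
  assumes f: "integrable lborel f" and h: "integrable lborel h" and \<sigma>: "\<sigma> > 0"
  shows integrable_regularized_pair:
      "integrable (lborel \<Otimes>\<^sub>M lborel) (\<lambda>(x, z). f x * cnj (h (x - \<sigma> *\<^sub>R z)) * of_real (gauss z))"
    and fourier_integral_regularized_parseval:
      "(\<integral>\<xi>. fourier_integral f \<xi> * cnj (fourier_integral h \<xi>) * of_real (exp (- (norm (\<sigma> *\<^sub>R \<xi>))\<^sup>2 / 2)) \<partial>lborel)
        = (\<integral>p. (case p of (x, z) \<Rightarrow> f x * cnj (h (x - \<sigma> *\<^sub>R z)) * of_real (gauss z)) \<partial>(lborel \<Otimes>\<^sub>M lborel))"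
proof -
  have [measurable]: "f \<in> borel_measurable borel" "h \<in> borel_measurable borel"
    using f h by auto
  define c0 :: real where "c0 = (2 * pi) powr (real CARD('n) / 2)"
  have c0: "c0 > 0" by (simp add: c0_def)
  let ?P = "lborel \<Otimes>\<^sub>M lborel :: ((real^'n) \<times> (real^'n)) measure"
  let ?K = "\<lambda>w::real^'n. gauss ((1 / \<sigma>) *\<^sub>R w) / \<sigma> ^ CARD('n)"
  let ?k = "\<lambda>x y. f x * cnj (h y) * of_real (?K (x - y))"
  let ?r = "\<lambda>x z. f x * cnj (h (x - \<sigma> *\<^sub>R z)) * of_real (gauss z)"
  let ?W = "\<lambda>\<xi>::real^'n. exp (- (norm (\<sigma> *\<^sub>R \<xi>))\<^sup>2 / 2)"
  let ?c = "\<lambda>\<xi> x y. f x * cnj (h y) * cis (- (\<xi> \<bullet> (x - y)))"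
  have hc: "integrable lborel (\<lambda>y. cnj (h y))"
    using h by simp
  have fh: "integrable ?P (\<lambda>(x, y). f x * cnj (h y))"
    by (rule lborel_pair.integrable_pair_mult[OF f hc])
  have gs: "integrable lborel (\<lambda>\<xi>::real^'n. complex_of_real (?W \<xi>))"
  proof -
    have "integrable lborel (\<lambda>\<xi>::real^'n. complex_of_real (c0 * gauss (0 + \<sigma> *\<^sub>R \<xi>)))"
      using \<sigma> by (intro integrable_of_real integrable_mult_right integrable_lborel_affine integrable_gauss) auto
    then show ?thesis by (simp add: gauss_def c0_def)
  qed
  have prod: "fourier_integral f \<xi> * cnj (fourier_integral h \<xi>)
      = (\<integral>p. (case_prod (?c \<xi>) p) \<partial>?P) / c0\<^sup>2" for \<xi>
  proof -
    have 1: "integrable lborel (\<lambda>x. cis (- (\<xi> \<bullet> x)) * f x)"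
      by (rule integrable_cis_mult(2)[OF f])
    have 2: "integrable lborel (\<lambda>x. cis (\<xi> \<bullet> x) * cnj (h x))"
      by (rule integrable_cis_mult(1)[OF hc])
    have "cnj (\<integral>x. cis (- (\<xi> \<bullet> x)) * h x \<partial>lborel) = (\<integral>x. cis (\<xi> \<bullet> x) * cnj (h x) \<partial>lborel)"
      by (subst Bochner_Integration.integral_cnj[symmetric]) (simp add: cis_cnj)
    then have "fourier_integral f \<xi> * cnj (fourier_integral h \<xi>)
      = ((\<integral>x. cis (- (\<xi> \<bullet> x)) * f x \<partial>lborel) * (\<integral>y. cis (\<xi> \<bullet> y) * cnj (h y) \<partial>lborel)) / c0\<^sup>2"
      by (simp add: fourier_integral_def c0_def power2_eq_square)
    also have "(\<integral>x. cis (- (\<xi> \<bullet> x)) * f x \<partial>lborel) * (\<integral>y. cis (\<xi> \<bullet> y) * cnj (h y) \<partial>lborel)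
        = (\<integral>p. (case p of (x, y) \<Rightarrow> (cis (- (\<xi> \<bullet> x)) * f x) * (cis (\<xi> \<bullet> y) * cnj (h y))) \<partial>?P)"
      by (rule lborel_pair.integral_pair_mult[OF 1 2, symmetric])
    also have "(\<lambda>p. (case p of (x, y) \<Rightarrow> (cis (- (\<xi> \<bullet> x)) * f x) * (cis (\<xi> \<bullet> y) * cnj (h y))))
        = (\<lambda>p. (case_prod (?c \<xi>) p))"
    proof (rule ext, clarify)
      fix x y
      have "cis (- (\<xi> \<bullet> (x - y))) = cis (- (\<xi> \<bullet> x)) * cis (\<xi> \<bullet> y)"
        by (simp add: cis_mult inner_diff_right)
      then show "(cis (- (\<xi> \<bullet> x)) * f x) * (cis (\<xi> \<bullet> y) * cnj (h y)) = ?c \<xi> x y"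
        by simp
    qed
    finally show ?thesis .
  qed
  let ?J = "\<lambda>p \<xi>. (case p of (x, y) \<Rightarrow> f x * cnj (h y)) * of_real (?W \<xi>)
     * cis (- (\<xi> \<bullet> (fst p - snd p)))"
  have J: "integrable (lborel \<Otimes>\<^sub>M lborel) (case_prod ?J)"
  proof (rule Bochner_Integration.integrable_bound)
    show "integrable (lborel \<Otimes>\<^sub>M lborel) (\<lambda>(p, \<xi>::real^'n). (case p of (x, y) \<Rightarrow> f x * cnj (h y))
        * complex_of_real (?W \<xi>))"
      by (rule lborel_pair.integrable_pair_mult[OF _ gs]) (use fh in \<open>simp add: lborel_prod\<close>)
    show "case_prod ?J \<in> borel_measurable (lborel \<Otimes>\<^sub>M lborel)"
      unfolding lborel_prod[symmetric] by measurable
  qed (auto simp: norm_mult split_beta)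
  have "(\<integral>\<xi>. fourier_integral f \<xi> * cnj (fourier_integral h \<xi>) * of_real (?W \<xi>) \<partial>lborel)
     = (\<integral>\<xi>. (\<integral>p. ?J p \<xi> \<partial>lborel) / c0\<^sup>2 \<partial>lborel)"
  proof (intro Bochner_Integration.integral_cong refl)
    fix \<xi>
    show "fourier_integral f \<xi> * cnj (fourier_integral h \<xi>) * of_real (?W \<xi>)
       = (\<integral>p. ?J p \<xi> \<partial>lborel) / c0\<^sup>2"
    proof -
      have "(\<integral>p. ?J p \<xi> \<partial>lborel) = (\<integral>p. of_real (?W \<xi>)
          * (case_prod (?c \<xi>) p) \<partial>lborel)"
        by (intro Bochner_Integration.integral_cong) (auto simp: split_beta mult_ac)
      also have "\<dots> = of_real (?W \<xi>)
          * (\<integral>p. (case_prod (?c \<xi>) p) \<partial>lborel)"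
        by (rule integral_mult_right_zero)
      finally show ?thesis
        unfolding prod by (simp add: lborel_prod)
    qed
  qed
  also have "\<dots> = (\<integral>\<xi>. (\<integral>p. ?J p \<xi> \<partial>lborel) \<partial>lborel) / c0\<^sup>2"
    by simp
  also have "(\<integral>\<xi>. (\<integral>p. ?J p \<xi> \<partial>lborel) \<partial>lborel) = (\<integral>p. (\<integral>\<xi>. ?J p \<xi> \<partial>lborel) \<partial>lborel)"
    by (rule lborel_pair.Fubini_integral[OF J])
  \<comment> \<open>The inner integral is the transform of the weight, that is, the kernel
    \<open>?K\<close> at x - y. The factor \<open>c0\<close> squared cancels the normalization of
    the two Fourier integrals.\<close>
  also have "(\<lambda>p. \<integral>\<xi>. ?J p \<xi> \<partial>lborel)
     = (\<lambda>p. (case_prod ?k p) * c0\<^sup>2)"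
  proof (rule ext)
    fix p :: "(real^'n) \<times> (real^'n)"
    obtain x y where p: "p = (x, y)" by (cases p)
    have "(\<integral>\<xi>. ?J (x, y) \<xi> \<partial>lborel)
        = (\<integral>\<xi>. (f x * cnj (h y) * c0) * (cis (- (\<xi> \<bullet> (x - y))) * gauss (\<sigma> *\<^sub>R \<xi>)) \<partial>lborel)"
      using c0 by (intro Bochner_Integration.integral_cong) (auto simp: gauss_def c0_def)
    also have "\<dots> = (f x * cnj (h y) * c0) * (\<integral>\<xi>. (cis (- (\<xi> \<bullet> (x - y))) * gauss (\<sigma> *\<^sub>R \<xi>)) \<partial>lborel)"
      by (rule integral_mult_right_zero)
    also have "\<dots> = (?k x y) * c0\<^sup>2"
      unfolding fourier_integral_eq_gauss[OF \<sigma>] by (simp add: c0_def power2_eq_square)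
    finally show "(\<integral>\<xi>. ?J p \<xi> \<partial>lborel)
        = (case_prod ?k p) * c0\<^sup>2"
      unfolding p by simp
  qed
  finally have *: "(\<integral>\<xi>. fourier_integral f \<xi> * cnj (fourier_integral h \<xi>) * of_real (?W \<xi>) \<partial>lborel)
     = (\<integral>p. (case_prod ?k p) \<partial>?P)"
    using c0 by (simp add: lborel_prod)
  have K: "integrable ?P (case_prod ?k)"
  proof (rule Bochner_Integration.integrable_bound)
    show "integrable ?P (\<lambda>p. (1 / c0 / \<sigma> ^ CARD('n)) * norm (case p of (x, y) \<Rightarrow> f x * cnj (h y)))"
      by (intro integrable_mult_right integrable_norm fh)
    have "norm (?k x y) \<le> (1 / c0 / \<sigma> ^ CARD('n)) * norm (f x * cnj (h y))" for x y
    proof -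
      have "?K (x - y) \<le> (1 / c0 / \<sigma> ^ CARD('n))"
        using c0 \<sigma> by (auto simp: gauss_def c0_def intro!: divide_right_mono)
      then have "norm (f x * cnj (h y)) * ?K (x - y) \<le> norm (f x * cnj (h y)) * (1 / c0 / \<sigma> ^ CARD('n))"
        by (intro mult_left_mono) auto
      moreover have "norm (complex_of_real (?K (x - y))) = ?K (x - y)"
        using \<sigma> by (simp only: norm_of_real) simp
      ultimately show ?thesis
        by (simp only: norm_mult[of "f x * cnj (h y)"] mult.commute)
    qed
    then show "AE p in ?P. norm (case_prod ?k p)
       \<le> norm ((1 / c0 / \<sigma> ^ CARD('n)) * norm (case p of (x, y) \<Rightarrow> f x * cnj (h y)))"
      using c0 \<sigma> by (auto simp: split_beta abs_mult)
  qed measurable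
  have Kz: "?K (x - (x + (-\<sigma>) *\<^sub>R z)) = gauss z * (1 / \<sigma> ^ CARD('n))" for x z
    using \<sigma> by simp
  have sub: "(\<integral>y. ?k x y \<partial>lborel)
      = (\<integral>z. ?r x z \<partial>lborel)" for x
  proof -
    have "(\<integral>z. ?k x (x + (-\<sigma>) *\<^sub>R z) \<partial>lborel)
        = (1 / \<bar>-\<sigma>\<bar> ^ DIM(real^'n)) *\<^sub>R (\<integral>y. ?k x y \<partial>lborel)"
      using \<sigma> by (intro integral_lborel_affine[where f="\<lambda>y. ?k x y"]) auto
    moreover have "(\<integral>z. ?k x (x + (-\<sigma>) *\<^sub>R z) \<partial>lborel)
        = (\<integral>z. (1 / \<sigma> ^ CARD('n)) *\<^sub>R (?r x z) \<partial>lborel)"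
      unfolding Kz by (intro Bochner_Integration.integral_cong) (auto simp: scaleR_conv_of_real)
    ultimately show ?thesis
      using \<sigma> by simp
  qed
  \<comment> \<open>The substitution is repeated for norms: on the pair space \<open>?r\<close>
    inherits integrability from \<open>?k\<close> because their iterated nonnegative integrals
    agree.\<close>
  have nsub: "(\<integral>\<^sup>+y. ennreal (norm (?k x y)) \<partial>lborel)
      = (\<integral>\<^sup>+z. ennreal (norm (?r x z)) \<partial>lborel)" for x
  proof -
    let ?s = "ennreal (1 / \<sigma> ^ CARD('n))"
    have "?s * (\<integral>\<^sup>+z. ennreal (norm (?r x z)) \<partial>lborel) = (\<integral>\<^sup>+z. ?s * ennreal (norm (?r x z)) \<partial>lborel)"
      by (rule nn_integral_cmult[symmetric]) measurable
    also have "\<dots> = (\<integral>\<^sup>+z. ennreal (norm (?k x (x + (-\<sigma>) *\<^sub>R z))) \<partial>lborel)"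
      unfolding Kz using \<sigma> by (intro nn_integral_cong) (simp add: norm_mult norm_divide norm_power ennreal_mult'[symmetric])
    also have "\<dots> = ennreal (1 / \<bar>-\<sigma>\<bar> ^ DIM(real^'n)) * (\<integral>\<^sup>+y. ennreal (norm (?k x y)) \<partial>lborel)"
      using \<sigma> by (intro nn_integral_lborel_affine[where f="\<lambda>y. ennreal (norm (?k x y))"]) auto
    finally show ?thesis
      using \<sigma> by (auto simp: ennreal_mult_cancel_left)
  qed
  show int: "integrable (lborel \<Otimes>\<^sub>M lborel) (case_prod ?r)"
    unfolding integrable_iff_bounded
  proof
    show "(case_prod ?r) \<in> borel_measurable (lborel \<Otimes>\<^sub>M lborel)"
      by measurable
    have "(\<integral>\<^sup>+p. ennreal (norm (case_prod ?r p)) \<partial>(lborel \<Otimes>\<^sub>M lborel))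
      = (\<integral>\<^sup>+p. ennreal (norm (case_prod ?k p)) \<partial>?P)"
    proof -
      have 1: "(\<lambda>p. ennreal (norm (case_prod ?r p)))
          \<in> borel_measurable (lborel \<Otimes>\<^sub>M lborel)"
        by measurable
      have 2: "(\<lambda>p. ennreal (norm (case_prod ?k p))) \<in> borel_measurable ?P"
        by measurable
      show ?thesis
        unfolding lborel.nn_integral_fst[OF 1, symmetric] lborel.nn_integral_fst[OF 2, symmetric] prod.case nsub ..
    qed
    also have "\<dots> < \<infinity>"
      using K unfolding integrable_iff_bounded by simp
    finally show "(\<integral>\<^sup>+p. ennreal (norm (case_prod ?r p)) \<partial>(lborel \<Otimes>\<^sub>M lborel)) < \<infinity>" .
  qed
  show "(\<integral>\<xi>. fourier_integral f \<xi> * cnj (fourier_integral h \<xi>) * of_real (?W \<xi>) \<partial>lborel)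
        = (\<integral>p. (case_prod ?r p) \<partial>(lborel \<Otimes>\<^sub>M lborel))"
    unfolding * lborel_pair.integral_fst[OF int, symmetric] lborel_pair.integral_fst[OF K, symmetric] sub ..
qed

text \<open>Fatou's lemma, arranged for upper bounds that themselves converge.\<close>

lemma nn_integral_le_of_tendsto:
  fixes u :: "nat \<Rightarrow> 'a \<Rightarrow> ennreal"
  assumes [measurable]: "\<And>k. u k \<in> borel_measurable M"
    and lim: "AE x in M. (\<lambda>k. u k x) \<longlonglongrightarrow> f x"
    and le: "\<And>k. (\<integral>\<^sup>+x. u k x \<partial>M) \<le> C k" and C: "C \<longlonglongrightarrow> L"
  shows "(\<integral>\<^sup>+x. f x \<partial>M) \<le> L"
proof -
  have "(\<integral>\<^sup>+x. f x \<partial>M) = (\<integral>\<^sup>+x. liminf (\<lambda>k. u k x) \<partial>M)"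
    by (rule nn_integral_cong_AE) (use lim in \<open>auto simp: lim_imp_Liminf\<close>)
  also have "\<dots> \<le> liminf (\<lambda>k. \<integral>\<^sup>+x. u k x \<partial>M)"
    by (rule nn_integral_liminf) measurable
  also have "\<dots> \<le> liminf C"
    by (rule Liminf_mono) (simp add: le)
  also have "liminf C = L"
    using C by (simp add: lim_imp_Liminf)
  finally show ?thesis .
qed

abbreviation square_integrable :: "(real^'n \<Rightarrow> complex) \<Rightarrow> bool" where
  "square_integrable f \<equiv> integrable lborel (\<lambda>x. (cmod (f x))\<^sup>2)"

abbreviation L2_square :: "(real^'n \<Rightarrow> complex) \<Rightarrow> real" where
  "L2_square f \<equiv> \<integral>x. (cmod (f x))\<^sup>2 \<partial>lborel"

abbreviation nn_L2_square :: "(real^'n \<Rightarrow> complex) \<Rightarrow> ennreal" where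
  "nn_L2_square f \<equiv> \<integral>\<^sup>+x. ennreal ((cmod (f x))\<^sup>2) \<partial>lborel"

text \<open>In the regularized identity with both functions equal to f, the product of f(x) and f(x
  - \<sigma> z) is at most half the sum of the squares. By translation invariance and the unit
  integral of \<open>gauss\<close>, each half contributes half of the right side, for every
  \<sigma>. Fatou then removes the weight. The right side may be infinite, as f is only integrable;
  hence nonnegative integrals.\<close>

lemma nn_integral_plancherel_le:
  fixes f :: "real^'n \<Rightarrow> complex"
  assumes f: "integrable lborel f"
  shows "nn_L2_square (fourier_integral f) \<le> nn_L2_square f"
proof -
  have [measurable]: "f \<in> borel_measurable borel" using f by simp
  define c0 :: real where "c0 = (2 * pi) powr (real CARD('n) / 2)"
  have c0: "c0 > 0" by (simp add: c0_def)
  let ?W = "\<lambda>\<sigma> \<xi>::real^'n. exp (- (norm (\<sigma> *\<^sub>R \<xi>))\<^sup>2 / 2)"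
  let ?N = "\<integral>\<^sup>+x. ennreal ((cmod (f x))\<^sup>2) \<partial>lborel"
  let ?F = "\<lambda>\<sigma> \<xi>. (cmod (fourier_integral f \<xi>))\<^sup>2 * ?W \<sigma> \<xi>"
  have reg: "(\<integral>\<^sup>+\<xi>. ennreal (?F \<sigma> \<xi>) \<partial>lborel) \<le> ?N"
    if \<sigma>: "\<sigma> > 0" for \<sigma>
  proof -
    define B where "B = (\<integral>x. cmod (f x) \<partial>lborel) / c0"
    \<comment> \<open>The transform is bounded by \<open>B\<close>, so the Gaussian weight alone
      makes this integrable.\<close>
    have int: "integrable lborel (\<lambda>\<xi>. ?F \<sigma> \<xi>)"
    proof (rule Bochner_Integration.integrable_bound)
      show "integrable lborel (\<lambda>\<xi>::real^'n. B\<^sup>2 * c0 * gauss (0 + \<sigma> *\<^sub>R \<xi>))"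
        using \<sigma> by (intro integrable_mult_right integrable_lborel_affine integrable_gauss) auto
      show "AE \<xi> in lborel. norm (?F \<sigma> \<xi>) \<le> norm (B\<^sup>2 * c0 * gauss (0 + \<sigma> *\<^sub>R \<xi>))"
      proof (rule AE_I2)
        fix \<xi> :: "real^'n"
        have "(cmod (fourier_integral f \<xi>))\<^sup>2 \<le> B\<^sup>2"
          unfolding B_def c0_def by (intro power_mono norm_fourier_integral_le) auto
        then have "?F \<sigma> \<xi> \<le> B\<^sup>2 * ?W \<sigma> \<xi>"
          by (intro mult_right_mono) auto
        also have "\<dots> = B\<^sup>2 * c0 * gauss (0 + \<sigma> *\<^sub>R \<xi>)"
          using c0 by (simp add: gauss_def c0_def)
        finally show "norm (?F \<sigma> \<xi>) \<le> norm (B\<^sup>2 * c0 * gauss (0 + \<sigma> *\<^sub>R \<xi>))"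
          by simp
      qed
    qed measurable
    let ?g = "\<lambda>x z. f x * cnj (f (x - \<sigma> *\<^sub>R z)) * of_real (gauss z)"
    let ?t = "\<lambda>z x. ennreal (gauss z) * ennreal ((cmod (f (x - \<sigma> *\<^sub>R z)))\<^sup>2)"
    have nonneg: "0 \<le> (\<integral>\<xi>. ?F \<sigma> \<xi> \<partial>lborel)"
      by (rule integral_nonneg_AE) simp
    have "complex_of_real (\<integral>\<xi>. ?F \<sigma> \<xi> \<partial>lborel)
        = (\<integral>\<xi>. fourier_integral f \<xi> * cnj (fourier_integral f \<xi>) * of_real (?W \<sigma> \<xi>) \<partial>lborel)"
      by (simp only: integral_complex_of_real[symmetric] of_real_mult complex_norm_square)
    also have "\<dots> = (integral\<^sup>L (lborel \<Otimes>\<^sub>M lborel) (case_prod ?g))"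
      by (rule fourier_integral_regularized_parseval[OF f f \<sigma>])
    finally have eq: "complex_of_real (\<integral>\<xi>. ?F \<sigma> \<xi> \<partial>lborel) = \<dots>" .
    have "(\<integral>\<xi>. ?F \<sigma> \<xi> \<partial>lborel)
        = cmod (integral\<^sup>L (lborel \<Otimes>\<^sub>M lborel) (case_prod ?g))"
      unfolding eq[symmetric] using nonneg by simp
    then have "(\<integral>\<^sup>+\<xi>. ennreal (?F \<sigma> \<xi>) \<partial>lborel)
        = ennreal (cmod (integral\<^sup>L (lborel \<Otimes>\<^sub>M lborel) (case_prod ?g)))"
      by (subst nn_integral_eq_integral[OF int]) auto
    also have "\<dots> \<le> (\<integral>\<^sup>+p. ennreal (cmod (case_prod ?g p)) \<partial>(lborel \<Otimes>\<^sub>M lborel))"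
      by (rule integral_norm_bound_ennreal[OF integrable_regularized_pair[OF f f \<sigma>]])
    also have "\<dots> = (\<integral>\<^sup>+x. \<integral>\<^sup>+z. ennreal (cmod (?g x z)) \<partial>lborel \<partial>lborel)"
      by (subst lborel.nn_integral_fst[symmetric]) auto
    also have "\<dots> \<le> (\<integral>\<^sup>+x. \<integral>\<^sup>+z. ennreal (1/2) * (ennreal ((cmod (f x))\<^sup>2) * ennreal (gauss z))
        + ennreal (1/2) * (?t z x) \<partial>lborel \<partial>lborel)"
    proof (intro nn_integral_mono)
      fix x z
      let ?a = "cmod (f x)" and ?b = "cmod (f (x - \<sigma> *\<^sub>R z))"
      have "?a * ?b \<le> 1/2 * ?a\<^sup>2 + 1/2 * ?b\<^sup>2"
        using sum_squares_bound[of ?a ?b] by simp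
      then have *: "?a * ?b * gauss z \<le> (1/2 * ?a\<^sup>2 + 1/2 * ?b\<^sup>2) * gauss z"
        by (intro mult_right_mono) auto
      show "ennreal (cmod (?g x z)) \<le> ennreal (1/2) * (ennreal (?a\<^sup>2) * ennreal (gauss z))
        + ennreal (1/2) * (ennreal (gauss z) * ennreal (?b\<^sup>2))"
      proof -
        have h: "0 \<le> (1/2::real)" by simp
        have "ennreal (1/2) * (ennreal (?a\<^sup>2) * ennreal (gauss z)) + ennreal (1/2) * (ennreal (gauss z) * ennreal (?b\<^sup>2))
            = ennreal ((1/2 * ?a\<^sup>2 + 1/2 * ?b\<^sup>2) * gauss z)"
          by (simp only: ennreal_mult'[symmetric] ennreal_plus[symmetric] gauss_nonneg zero_le_power2 mult_nonneg_nonneg h)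
            (simp add: algebra_simps)
        moreover have "cmod (?g x z) = ?a * ?b * gauss z"
          by (simp add: norm_mult)
        ultimately show ?thesis
          using * by (simp only: ennreal_leI)
      qed
    qed
    also have "\<dots> = ennreal (1/2) * (\<integral>\<^sup>+x. \<integral>\<^sup>+z. ennreal ((cmod (f x))\<^sup>2) * ennreal (gauss (z::real^'n)) \<partial>lborel \<partial>lborel)
        + ennreal (1/2) * (\<integral>\<^sup>+x. \<integral>\<^sup>+z. ?t z x \<partial>lborel \<partial>lborel)"
      by (simp add: nn_integral_add nn_integral_cmult)
    also have "(\<integral>\<^sup>+x. \<integral>\<^sup>+z. ?t z x \<partial>lborel \<partial>lborel)
        = (\<integral>\<^sup>+z. \<integral>\<^sup>+x. ?t z x \<partial>lborel \<partial>lborel)"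
      by (rule lborel_pair.Fubini'[symmetric]) measurable
    also have "\<dots> = (\<integral>\<^sup>+z. ennreal (gauss (z::real^'n)) * ?N \<partial>lborel)"
    proof (rule nn_integral_cong)
      fix z :: "real^'n"
      have "(\<integral>\<^sup>+x. ennreal ((cmod (f (- \<sigma> *\<^sub>R z + 1 *\<^sub>R x)))\<^sup>2) \<partial>lborel)
          = ennreal (1 / \<bar>1\<bar> ^ DIM(real^'n)) * ?N"
        by (rule nn_integral_lborel_affine[where f="\<lambda>x. ennreal ((cmod (f x))\<^sup>2)"]) auto
      then show "(\<integral>\<^sup>+x. ?t z x \<partial>lborel)
          = ennreal (gauss z) * ?N"
        by (simp add: nn_integral_cmult)
    qed
    also have "\<dots> = ?N"
      by (simp add: nn_integral_multc nn_integral_eq_integral[OF integrable_gauss] integral_gauss)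
    also have "(\<integral>\<^sup>+x. \<integral>\<^sup>+z. ennreal ((cmod (f x))\<^sup>2) * ennreal (gauss (z::real^'n)) \<partial>lborel \<partial>lborel)
        = ?N"
      by (simp add: nn_integral_cmult nn_integral_eq_integral[OF integrable_gauss] integral_gauss)
    also have "ennreal (1/2) * ?N + ennreal (1/2) * ?N
        = ?N"
    proof -
      have "ennreal (1/2) + ennreal (1/2) = 1"
        by (subst ennreal_plus[symmetric]) auto
      then show ?thesis
        by (simp only: distrib_right[symmetric] mult_1)
    qed
    finally show ?thesis .
  qed
  show ?thesis
  proof (rule nn_integral_le_of_tendsto[OF _ _ _ tendsto_const])
    show "(\<integral>\<^sup>+\<xi>. ennreal (?F (1 / real (Suc k)) \<xi>) \<partial>lborel)
        \<le> ?N" for k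
      by (rule reg) simp
    have "(\<lambda>k. ennreal (?F (1 / real (Suc k)) \<xi>))
        \<longlonglongrightarrow> ennreal (?F 0 \<xi>)" for \<xi>
      by (intro tendsto_ennrealI tendsto_intros LIMSEQ_Suc lim_1_over_n) auto
    then show "AE \<xi> in lborel. (\<lambda>k. ennreal (?F (1 / real (Suc k)) \<xi>))
        \<longlonglongrightarrow> ennreal ((cmod (fourier_integral f \<xi>))\<^sup>2)"
      by simp
  qed measurable
qed

lemma
  fixes f :: "real^'n \<Rightarrow> complex"
  assumes f: "integrable lborel f" and f2: "square_integrable f"
  shows integrable_fourier_integral_square: "square_integrable (fourier_integral f)"
    and plancherel_le: "(L2_square (fourier_integral f)) \<le> (L2_square f)"
proof -
  have [measurable]: "f \<in> borel_measurable borel" using f by simp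
  have le: "nn_L2_square (fourier_integral f) \<le> ennreal (L2_square f)"
    using nn_integral_plancherel_le[OF f] by (simp add: nn_integral_eq_integral[OF f2])
  show i: "square_integrable (fourier_integral f)"
    using le by (intro integrableI_bounded) (auto simp: le_less_trans)
  show "(L2_square (fourier_integral f)) \<le> (L2_square f)"
    using le by (simp add: nn_integral_eq_integral[OF i])
qed

lemma integrable_mult_of_squares:
  fixes f g :: "'a \<Rightarrow> complex"
  assumes [measurable]: "f \<in> borel_measurable M" "g \<in> borel_measurable M"
    and "integrable M (\<lambda>x. (cmod (f x))\<^sup>2)" "integrable M (\<lambda>x. (cmod (g x))\<^sup>2)"
  shows "integrable M (\<lambda>x. f x * cnj (g x))"
proof (rule Bochner_Integration.integrable_bound)
  show "integrable M (\<lambda>x. (cmod (f x))\<^sup>2 + (cmod (g x))\<^sup>2)"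
    using assms by simp
  have "cmod (f x) * cmod (g x) \<le> (cmod (f x))\<^sup>2 + (cmod (g x))\<^sup>2" for x
  proof -
    have "0 \<le> cmod (f x) * cmod (g x)" by simp
    then show ?thesis
      using sum_squares_bound[of "cmod (f x)" "cmod (g x)"] unfolding mult.assoc by linarith
  qed
  then show "AE x in M. norm (f x * cnj (g x)) \<le> norm ((cmod (f x))\<^sup>2 + (cmod (g x))\<^sup>2)"
    by (auto simp: norm_mult)
qed measurable

lemma
  fixes \<phi> :: "real^'n \<Rightarrow> complex"
  assumes [measurable]: "\<phi> \<in> borel_measurable borel"
    and M: "\<And>x. cmod (\<phi> x) \<le> M" and supp: "\<And>x. x \<notin> cball 0 R \<Longrightarrow> \<phi> x = 0"
  shows integrable_bounded_support: "integrable lborel \<phi>"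
    and integrable_square_bounded_support: "square_integrable \<phi>"
proof -
  have fin: "emeasure lborel (cball (0::real^'n) R) < \<infinity>"
    by (rule emeasure_lborel_cball_finite)
  have M0: "0 \<le> M" using M[of 0] by (meson norm_ge_zero order_trans)
  have 1: "integrable lborel (\<lambda>x. M * indicat_real (cball (0::real^'n) R) x)"
    by (intro integrable_mult_right integrable_real_indicator) (use fin in auto)
  have 2: "integrable lborel (\<lambda>x. M\<^sup>2 * indicat_real (cball (0::real^'n) R) x)"
    by (intro integrable_mult_right integrable_real_indicator) (use fin in auto)
  show "integrable lborel \<phi>"
    by (rule Bochner_Integration.integrable_bound[OF 1])
      (use M M0 supp in \<open>auto simp: indicator_def\<close>)
  show "square_integrable \<phi>"
    by (rule Bochner_Integration.integrable_bound[OF 2])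
      (use M M0 supp in \<open>auto simp: indicator_def power_mono\<close>)
qed

text \<open>Let \<sigma> tend to 0 in the regularized identity. On the frequency side the product of
  two square-integrable transforms is a majorant. On the space side continuity gives convergence of
  \<phi>(x - \<sigma> z) to \<phi>(x), and the bound \<open>M\<close> gives a majorant.\<close>

lemma parseval_continuous:
  fixes f \<phi> :: "real^'n \<Rightarrow> complex"
  assumes f: "integrable lborel f" and f2: "square_integrable f"
    and cont: "continuous_on UNIV \<phi>" and M: "\<And>x. cmod (\<phi> x) \<le> M"
    and supp: "\<And>x. x \<notin> cball 0 R \<Longrightarrow> \<phi> x = 0"
  shows "(\<integral>\<xi>. fourier_integral f \<xi> * cnj (fourier_integral \<phi> \<xi>) \<partial>lborel) = (\<integral>x. f x * cnj (\<phi> x) \<partial>lborel)"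
proof (rule LIMSEQ_unique)
  have [measurable]: "f \<in> borel_measurable borel" using f by simp
  have [measurable]: "\<phi> \<in> borel_measurable borel"
    using cont by (rule borel_measurable_continuous_onI)
  note \<phi>1 = integrable_bounded_support[OF _ M supp] and \<phi>2 = integrable_square_bounded_support[OF _ M supp]
  let ?\<sigma> = "\<lambda>k. 1 / real (Suc k)"
  let ?W = "\<lambda>\<sigma> \<xi>::real^'n. exp (- (norm (\<sigma> *\<^sub>R \<xi>))\<^sup>2 / 2)"
  let ?F = "\<lambda>\<xi>. fourier_integral f \<xi> * cnj (fourier_integral \<phi> \<xi>)"
  let ?I = "\<lambda>k. \<integral>\<xi>. ?F \<xi> * of_real (?W (?\<sigma> k) \<xi>) \<partial>lborel"
  have FF: "integrable lborel (\<lambda>\<xi>. ?F \<xi>)"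
    by (rule integrable_mult_of_squares)
      (auto intro!: integrable_fourier_integral_square f f2 \<phi>1 \<phi>2)
  show "?I \<longlonglongrightarrow> (\<integral>\<xi>. ?F \<xi> \<partial>lborel)"
  proof (rule integral_dominated_convergence[OF _ _ integrable_norm[OF FF]])
    have "(\<lambda>k. ?F \<xi> * of_real (?W (?\<sigma> k) \<xi>))
        \<longlonglongrightarrow> ?F \<xi> * of_real (?W 0 \<xi>)" for \<xi>
      by (intro tendsto_intros LIMSEQ_Suc lim_1_over_n) auto
    then show "AE \<xi> in lborel. (\<lambda>k. ?F \<xi> * of_real (?W (?\<sigma> k) \<xi>))
        \<longlonglongrightarrow> ?F \<xi>"
      by simp
  qed (auto simp: norm_mult mult_left_le)
  let ?P = "lborel \<Otimes>\<^sub>M lborel :: ((real^'n) \<times> (real^'n)) measure"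
  have I: "?I k = (\<integral>p. (case p of (x, z) \<Rightarrow> f x * cnj (\<phi> (x - ?\<sigma> k *\<^sub>R z)) * of_real (gauss z)) \<partial>?P)" for k
    by (rule fourier_integral_regularized_parseval[OF f \<phi>1]) auto
  have dom: "integrable ?P (\<lambda>(x, z). (M * cmod (f x)) * gauss z)"
    by (intro lborel_pair.integrable_pair_mult integrable_mult_right integrable_norm f integrable_gauss)
  have lim: "(\<integral>p. (case p of (x, z) \<Rightarrow> (f x * cnj (\<phi> x)) * of_real (gauss z)) \<partial>?P) = (\<integral>x. f x * cnj (\<phi> x) \<partial>lborel)"
  proof -
    have "(\<integral>p. (case p of (x, z) \<Rightarrow> (f x * cnj (\<phi> x)) * of_real (gauss z)) \<partial>?P)
        = (\<integral>x. f x * cnj (\<phi> x) \<partial>lborel) * (\<integral>z. complex_of_real (gauss (z::real^'n)) \<partial>lborel)"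
      by (intro lborel_pair.integral_pair_mult integrable_mult_of_squares integrable_of_real integrable_gauss f2 \<phi>2) auto
    then show ?thesis by (simp add: integral_gauss)
  qed
  show "?I \<longlonglongrightarrow> (\<integral>x. f x * cnj (\<phi> x) \<partial>lborel)"
    unfolding I lim[symmetric]
  proof (rule integral_dominated_convergence[OF _ _ dom])
    have "(\<lambda>k. f x * cnj (\<phi> (x - ?\<sigma> k *\<^sub>R z)) * of_real (gauss z)) \<longlonglongrightarrow> f x * cnj (\<phi> x) * of_real (gauss z)" for x z
    proof -
      have "(\<lambda>k. x - ?\<sigma> k *\<^sub>R z) \<longlonglongrightarrow> x - 0 *\<^sub>R z"
        by (intro tendsto_intros LIMSEQ_Suc lim_1_over_n)
      moreover have "isCont \<phi> x"
        using cont by (simp add: continuous_on_eq_continuous_at)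
      ultimately have "(\<lambda>k. \<phi> (x - ?\<sigma> k *\<^sub>R z)) \<longlonglongrightarrow> \<phi> x"
        using isCont_tendsto_compose[of x \<phi> "\<lambda>k. x - ?\<sigma> k *\<^sub>R z"] by simp
      then show ?thesis by (intro tendsto_intros)
    qed
    then show "AE p in ?P. (\<lambda>k. case p of (x, z) \<Rightarrow> f x * cnj (\<phi> (x - ?\<sigma> k *\<^sub>R z)) * of_real (gauss z))
        \<longlonglongrightarrow> (case p of (x, z) \<Rightarrow> (f x * cnj (\<phi> x)) * of_real (gauss z))"
      by (auto simp: split_beta)
    have "cmod (f x) * cmod (\<phi> y) * gauss z \<le> M * cmod (f x) * gauss z" for x y z
      using mult_left_mono[OF M[of y], of "cmod (f x)"] by (intro mult_right_mono) (auto simp: mult.commute)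
    then show "AE p in ?P. norm (case p of (x, z) \<Rightarrow> f x * cnj (\<phi> (x - ?\<sigma> k *\<^sub>R z)) * of_real (gauss z))
        \<le> (case p of (x, z) \<Rightarrow> (M * cmod (f x)) * gauss z)" for k
      by (auto simp: split_beta norm_mult)
  qed measurable
qed

lemma Cauchy_Schwarz_integral:
  fixes f g :: "'a \<Rightarrow> complex"
  assumes [measurable]: "f \<in> borel_measurable M" "g \<in> borel_measurable M"
    and f: "integrable M (\<lambda>x. (cmod (f x))\<^sup>2)" and g: "integrable M (\<lambda>x. (cmod (g x))\<^sup>2)"
  shows "cmod (\<integral>x. f x * cnj (g x) \<partial>M) \<le> sqrt (\<integral>x. (cmod (f x))\<^sup>2 \<partial>M) * sqrt (\<integral>x. (cmod (g x))\<^sup>2 \<partial>M)"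
proof -
  have fg: "integrable M (\<lambda>x. f x * cnj (g x))"
    by (rule integrable_mult_of_squares) (use f g in auto)
  have "ennreal ((cmod (\<integral>x. f x * cnj (g x) \<partial>M))\<^sup>2) = (ennreal (cmod (\<integral>x. f x * cnj (g x) \<partial>M)))\<^sup>2"
    by (simp add: ennreal_power)
  also have "\<dots> \<le> (\<integral>\<^sup>+x. ennreal (cmod (f x * cnj (g x))) \<partial>M)\<^sup>2"
    by (intro power_mono integral_norm_bound_ennreal fg) auto
  also have "\<dots> = (\<integral>\<^sup>+x. ennreal (cmod (f x)) * ennreal (cmod (g x)) \<partial>M)\<^sup>2"
    by (simp add: norm_mult ennreal_mult')
  also have "\<dots> \<le> (\<integral>\<^sup>+x. (ennreal (cmod (f x)))\<^sup>2 \<partial>M) * (\<integral>\<^sup>+x. (ennreal (cmod (g x)))\<^sup>2 \<partial>M)"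
    by (rule Cauchy_Schwarz_nn_integral) measurable
  also have "\<dots> = ennreal ((\<integral>x. (cmod (f x))\<^sup>2 \<partial>M) * (\<integral>x. (cmod (g x))\<^sup>2 \<partial>M))"
    by (simp add: ennreal_power nn_integral_eq_integral[OF f] nn_integral_eq_integral[OF g] ennreal_mult')
  finally have "(cmod (\<integral>x. f x * cnj (g x) \<partial>M))\<^sup>2 \<le> (\<integral>x. (cmod (f x))\<^sup>2 \<partial>M) * (\<integral>x. (cmod (g x))\<^sup>2 \<partial>M)"
    by (simp add: ennreal_le_iff)
  then have "cmod (\<integral>x. f x * cnj (g x) \<partial>M) \<le> sqrt ((\<integral>x. (cmod (f x))\<^sup>2 \<partial>M) * (\<integral>x. (cmod (g x))\<^sup>2 \<partial>M))"
    by (rule real_le_rsqrt)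
  then show ?thesis
    by (simp only: real_sqrt_mult)
qed

lemma Lp_2_iff:
  "(u :: real^'n \<Rightarrow> 'b::euclidean_space) \<in> Lp 2 \<longleftrightarrow> u \<in> borel_measurable borel \<and> integrable lborel (\<lambda>x. (norm (u x))\<^sup>2)"
  by (simp add: Lp_def)

lemma Lp_2_diff:
  fixes f g :: "real^'n \<Rightarrow> complex"
  assumes "f \<in> Lp 2" "g \<in> Lp 2"
  shows "(\<lambda>x. f x - g x) \<in> Lp 2"
proof -
  have [measurable]: "f \<in> borel_measurable borel" "g \<in> borel_measurable borel"
    using assms by (auto simp: Lp_2_iff)
  have "integrable lborel (\<lambda>x. (cmod (f x - g x))\<^sup>2)"
  proof (rule Bochner_Integration.integrable_bound)
    show "integrable lborel (\<lambda>x. 2 * (cmod (f x))\<^sup>2 + 2 * (cmod (g x))\<^sup>2)"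
      using assms by (simp add: Lp_2_iff)
    have "(cmod (a - b))\<^sup>2 \<le> 2 * (cmod a)\<^sup>2 + 2 * (cmod b)\<^sup>2" for a b
    proof -
      have "(cmod (a - b))\<^sup>2 \<le> (cmod a + cmod b)\<^sup>2"
        by (intro power_mono norm_triangle_ineq4) auto
      then show ?thesis
        using sum_squares_bound[of "cmod a" "cmod b"] by (simp add: power2_sum)
    qed
    then show "AE x in lborel. norm ((cmod (f x - g x))\<^sup>2) \<le> norm (2 * (cmod (f x))\<^sup>2 + 2 * (cmod (g x))\<^sup>2)"
      by auto
  qed measurable
  then show ?thesis by (simp add: Lp_2_iff)
qed

lemma integrable_truncation:
  fixes u :: "real^'n \<Rightarrow> complex"
  assumes u: "u \<in> Lp 2"
  shows "integrable lborel (\<lambda>x. indicator (cball 0 R) x *\<^sub>R u x)"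
    and "integrable lborel (\<lambda>x. (cmod (indicator (cball 0 R) x *\<^sub>R u x))\<^sup>2)"
proof -
  have [measurable]: "u \<in> borel_measurable borel" and u2: "square_integrable u"
    using u by (auto simp: Lp_2_iff)
  have i: "integrable lborel (\<lambda>x. indicat_real (cball (0::real^'n) R) x)"
    by (intro integrable_real_indicator) (use emeasure_lborel_cball_finite[of "0::real^'n" R] in auto)
  have le: "r \<le> 1 + r\<^sup>2" for r :: real
  proof -
    have "0 \<le> (r - 1/2)\<^sup>2" by simp
    also have "\<dots> = r\<^sup>2 - r + 1/4" by (simp add: power2_eq_square algebra_simps)
    finally show ?thesis by linarith
  qed
  show "integrable lborel (\<lambda>x. indicator (cball 0 R) x *\<^sub>R u x)"
    by (rule Bochner_Integration.integrable_bound[OF Bochner_Integration.integrable_add[OF i u2]])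
      (auto simp: indicator_def le)
  show "integrable lborel (\<lambda>x. (cmod (indicator (cball 0 R) x *\<^sub>R u x))\<^sup>2)"
    by (rule Bochner_Integration.integrable_bound[OF u2]) (auto simp: indicator_def)
qed

text \<open>The transform is known only as an L^2 limit of transforms of truncations. Truncation at
  a radius beyond the support of \<phi> does not change the pairing with \<phi>, so the error is
  controlled by the L^2 distance, which tends to 0.\<close>

lemma plancherel_transform_parseval:
  fixes u g \<phi> :: "real^'n \<Rightarrow> complex"
  assumes ug: "has_plancherel_transform u g"
    and cont: "continuous_on UNIV \<phi>" and M: "\<And>x. cmod (\<phi> x) \<le> M"
    and supp: "\<And>x. x \<notin> cball 0 R \<Longrightarrow> \<phi> x = 0"
  shows "(\<integral>\<xi>. g \<xi> * cnj (fourier_integral \<phi> \<xi>) \<partial>lborel) = (\<integral>x. u x * cnj (\<phi> x) \<partial>lborel)"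
proof -
  have u: "u \<in> Lp 2" and g: "g \<in> Lp 2"
    and lim: "((\<lambda>R. \<integral>\<^sup>+\<xi>. ennreal ((cmod (fourier_integral (\<lambda>x. indicator (cball 0 R) x *\<^sub>R u x) \<xi> - g \<xi>))\<^sup>2) \<partial>lborel)
        \<longlongrightarrow> 0) at_top"
    using ug by (auto simp: has_plancherel_transform_def)
  have [measurable]: "u \<in> borel_measurable borel" "g \<in> borel_measurable borel"
    and g2: "square_integrable g"
    using u g by (auto simp: Lp_2_iff)
  have [measurable]: "\<phi> \<in> borel_measurable borel"
    using cont by (rule borel_measurable_continuous_onI)
  have \<phi>1: "integrable lborel \<phi>" and \<phi>2: "square_integrable \<phi>"
    by (rule integrable_bounded_support[OF _ M supp], measurable)
      (rule integrable_square_bounded_support[OF _ M supp], measurable)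
  define F where "F = fourier_integral \<phi>"
  have F2: "square_integrable F"
    unfolding F_def by (rule integrable_fourier_integral_square[OF \<phi>1 \<phi>2])
  have [measurable]: "F \<in> borel_measurable borel"
    unfolding F_def by measurable
  define f where "f S x = indicator (cball 0 S) x *\<^sub>R u x" for S x
  have [measurable]: "f S \<in> borel_measurable borel" for S
    unfolding f_def by (intro borel_measurable_scaleR borel_measurable_indicator) auto
  \<comment> \<open>Constant in \<open>S\<close>; the argument only lets it be compared with the
    bound \<open>n2 S\<close> for each truncation radius.\<close>
  define D where "D S = cmod ((\<integral>\<xi>. g \<xi> * cnj (F \<xi>) \<partial>lborel) - (\<integral>x. u x * cnj (\<phi> x) \<partial>lborel))" for S :: real
  define n2 where "n2 S = (\<integral>\<^sup>+\<xi>. ennreal ((cmod (fourier_integral (f S) \<xi> - g \<xi>))\<^sup>2) \<partial>lborel)" for S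
  define B where "B = (L2_square F)"
  let ?D = "\<lambda>S \<xi>. fourier_integral (f S) \<xi> - g \<xi>"
  have bound: "ennreal ((D S)\<^sup>2) \<le> n2 S * ennreal B" if S: "S \<ge> R" for S
  proof -
    have f1: "integrable lborel (f S)" and f2: "integrable lborel (\<lambda>x. (cmod (f S x))\<^sup>2)"
      unfolding f_def using integrable_truncation[OF u] by auto
    have Ff2: "square_integrable (fourier_integral (f S))"
      by (rule integrable_fourier_integral_square[OF f1 f2])
    have "fourier_integral (f S) \<in> Lp 2"
      using Ff2 by (simp add: Lp_2_iff)
    from Lp_2_diff[OF this g] have d2: "integrable lborel (\<lambda>\<xi>. (cmod (?D S \<xi>))\<^sup>2)"
      by (simp add: Lp_2_iff)
    have "(\<integral>\<xi>. fourier_integral (f S) \<xi> * cnj (F \<xi>) \<partial>lborel) = (\<integral>x. f S x * cnj (\<phi> x) \<partial>lborel)"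
      unfolding F_def by (rule parseval_continuous[OF f1 f2 cont M supp])
    also have "\<dots> = (\<integral>x. u x * cnj (\<phi> x) \<partial>lborel)"
    proof (intro Bochner_Integration.integral_cong refl)
      fix x
      show "f S x * cnj (\<phi> x) = u x * cnj (\<phi> x)"
        using supp[of x] S by (cases "x \<in> cball 0 R") (auto simp: f_def)
    qed
    finally have "D S = cmod (\<integral>\<xi>. (g \<xi> * cnj (F \<xi>) - fourier_integral (f S) \<xi> * cnj (F \<xi>)) \<partial>lborel)"
      unfolding D_def
      by (subst Bochner_Integration.integral_diff) (auto intro!: integrable_mult_of_squares g2 F2 Ff2)
    also have "\<dots> = cmod (\<integral>\<xi>. ?D S \<xi> * cnj (F \<xi>) \<partial>lborel)"
      by (subst norm_minus_cancel[symmetric], subst Bochner_Integration.integral_minus[symmetric])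
        (simp add: algebra_simps)
    finally have "D S \<le> sqrt (\<integral>\<xi>. (cmod (?D S \<xi>))\<^sup>2 \<partial>lborel) * sqrt B"
      using Cauchy_Schwarz_integral[OF _ _ d2 F2] by (simp add: B_def)
    then have "(D S)\<^sup>2 \<le> (sqrt (\<integral>\<xi>. (cmod (?D S \<xi>))\<^sup>2 \<partial>lborel) * sqrt B)\<^sup>2"
      by (intro power_mono) (auto simp: D_def)
    also have "\<dots> = (\<integral>\<xi>. (cmod (?D S \<xi>))\<^sup>2 \<partial>lborel) * B"
      by (simp add: power_mult_distrib B_def)
    finally show ?thesis
      unfolding n2_def by (subst nn_integral_eq_integral[OF d2]) (auto simp: ennreal_mult'[symmetric] B_def)
  qed
  have "((\<lambda>S. n2 S * ennreal B) \<longlongrightarrow> 0 * ennreal B) at_top"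
    unfolding n2_def f_def by (intro tendsto_mult_ennreal lim tendsto_const) auto
  then have "ennreal ((D 0)\<^sup>2) \<le> 0"
    by (intro tendsto_lowerbound[where f="\<lambda>S. n2 S * ennreal B"])
      (use bound in \<open>auto simp: D_def intro: eventually_at_top_linorderI\<close>)
  then show ?thesis
    by (simp add: D_def F_def)
qed

lemma
  fixes c :: "'a::euclidean_space"
  shows ball_in_sets_borel [measurable]: "ball c r \<in> sets borel"
    and cball_in_sets_borel [measurable]: "cball c r \<in> sets borel"
  by auto

section \<open>The Sobolev inequality\<close>

lemma dyadic_bracket:
  fixes r :: real
  assumes "0 < r" "r < 1"
  shows "\<exists>k. (1/2) ^ Suc k \<le> r \<and> r < (1/2) ^ k"
proof -
  define k where "k = (LEAST k. (1/2) ^ Suc k \<le> r)"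
  obtain n where "(1/2) ^ n < r"
    using real_arch_pow_inv[OF assms(1), of "1/2"] by auto
  moreover have "(1/2::real) ^ Suc n \<le> (1/2) ^ n" by simp
  ultimately have "(1/2) ^ Suc n \<le> r" by linarith
  then have k: "(1/2) ^ Suc k \<le> r"
    unfolding k_def by (rule LeastI)
  moreover have "r < (1/2) ^ k"
  proof (cases k)
    case (Suc j)
    then have "\<not> (1/2) ^ Suc j \<le> r"
      unfolding k_def by (intro not_less_Least) auto
    then show ?thesis using Suc by simp
  qed (use assms in simp)
  ultimately show ?thesis by blast
qed

text \<open>On the shell between the radii 2^(-k-1) and 2^(-k) the integrand is at most 2^(a (k+1)).
  Replacing the shell by the whole ball of radius 2^(-k) still leaves a geometric series, with ratio
  q = 2^(a - d) < 1.\<close>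

lemma nn_integral_unit_ball_norm_powr_finite:
  fixes a :: real
  assumes a: "0 < a" "a < real DIM('a::euclidean_space)"
  shows "(\<integral>\<^sup>+\<xi>\<in>ball (0::'a) 1. ennreal (norm \<xi> powr (- a)) \<partial>lborel) < \<infinity>"
proof -
  define q where "q = 2 powr a * (1/2) ^ DIM('a)"
  have q: "0 \<le> q" "q < 1"
  proof -
    have "q = 2 powr (a - real DIM('a))"
      by (simp add: q_def powr_diff powr_realpow power_divide)
    also have "\<dots> < 2 powr 0"
      using a by (intro powr_less_mono) auto
    finally show "q < 1" by simp
  qed (simp add: q_def)
  define V where "V = unit_ball_vol (real DIM('a))"
  have V: "V \<ge> 0" by (simp add: V_def)
  let ?f = "\<lambda>k \<xi>. ennreal (2 powr (a * real (Suc k))) * indicator (ball (0::'a) ((1/2) ^ k)) \<xi>"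
  have "(\<integral>\<^sup>+\<xi>\<in>ball (0::'a) 1. ennreal (norm \<xi> powr (- a)) \<partial>lborel)
      \<le> (\<integral>\<^sup>+\<xi>. (\<Sum>k. ?f k \<xi>) \<partial>lborel)"
  proof (rule nn_integral_mono)
    fix \<xi> :: 'a
    show "ennreal (norm \<xi> powr (- a)) * indicator (ball 0 1) \<xi>
        \<le> (\<Sum>k. ?f k \<xi>)"
    proof (cases "0 < norm \<xi> \<and> norm \<xi> < 1")
      case True
      then obtain k where k: "(1/2) ^ Suc k \<le> norm \<xi>" "norm \<xi> < (1/2) ^ k"
        using dyadic_bracket[of "norm \<xi>"] by auto
      have "norm \<xi> powr (- a) \<le> ((1/2) ^ Suc k) powr (- a)"
        using a k by (intro powr_mono2') auto
      also have "\<dots> = 2 powr (a * real (Suc k))"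
      proof -
        have "(1/2::real) ^ Suc k = 2 powr (- real (Suc k))"
          by (simp only: powr_minus powr_realpow) (simp add: power_one_over inverse_eq_divide)
        then show ?thesis
          by (simp only: powr_powr minus_mult_minus) (simp only: mult.commute)
      qed
      finally have "ennreal (norm \<xi> powr (- a)) * indicator (ball 0 1) \<xi>
          \<le> ?f k \<xi>"
        using k by (auto simp: indicator_def ennreal_leI)
      also have "\<dots> \<le> (\<Sum>k. ?f k \<xi>)"
      proof -
        have "sum f {k} \<le> suminf f" for f :: "nat \<Rightarrow> ennreal"
          by (rule sum_le_suminf) auto
        then show ?thesis by (simp only: sum.insert_remove finite.emptyI Diff_empty sum.empty Diff_insert0 empty_iff not_False_eq_True empty_Diff add_0_right)
      qed
      finally show ?thesis .
    next
      case False
      \<comment> \<open>At the origin \<open>0 powr (- a)\<close> has the value 0, so the singular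
        point contributes nothing.\<close>
      then consider "\<xi> = 0" | "\<xi> \<notin> ball 0 1"
        by fastforce
      then have "ennreal (norm \<xi> powr (- a)) * indicator (ball 0 1) \<xi> = 0"
        by cases auto
      then show ?thesis by (simp only: zero_le)
    qed
  qed
  also have "\<dots> = (\<Sum>k. \<integral>\<^sup>+\<xi>. ?f k \<xi> \<partial>lborel)"
    by (rule nn_integral_suminf) measurable
  also have "\<dots> = (\<Sum>k. ennreal (2 powr a * V * q ^ k))"
  proof (rule suminf_cong)
    fix k
    have "(\<integral>\<^sup>+\<xi>. ?f k \<xi> \<partial>lborel)
        = ennreal (2 powr (a * real (Suc k))) * ennreal (V * ((1/2) ^ k) ^ DIM('a))"
      by (simp add: nn_integral_cmult emeasure_ball V_def)
    also have "\<dots> = ennreal (2 powr (a * real (Suc k)) * (V * ((1/2) ^ k) ^ DIM('a)))"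
      using V by (simp add: ennreal_mult'[symmetric])
    also have "2 powr (a * real (Suc k)) * (V * ((1/2) ^ k) ^ DIM('a)) = 2 powr a * V * q ^ k"
    proof -
      have "2 powr (a * real (Suc k)) = 2 powr a * (2 powr a) ^ k"
        by (simp add: powr_power powr_add[symmetric] algebra_simps)
      moreover have "((1/2::real) ^ k) ^ DIM('a) = ((1/2) ^ DIM('a)) ^ k"
        by (simp add: power_mult[symmetric] mult.commute)
      ultimately show ?thesis
        by (simp add: q_def power_mult_distrib)
    qed
    finally show "(\<integral>\<^sup>+\<xi>. ?f k \<xi> \<partial>lborel)
        = ennreal (2 powr a * V * q ^ k)" .
  qed
  also have "\<dots> = ennreal (\<Sum>k. 2 powr a * V * q ^ k)"
    by (rule suminf_ennreal2) (use q V in \<open>auto intro!: summable_mult summable_geometric\<close>)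
  also have "\<dots> < \<infinity>" by simp
  finally show ?thesis .
qed

text \<open>Homogeneity: dilation by N reduces the ball of radius N to the unit ball.\<close>

lemma nn_integral_ball_norm_powr_le:
  fixes a :: real
  assumes a: "0 < a" "a < real DIM('a::euclidean_space)"
  shows "\<exists>\<kappa>>0. \<forall>N>0. (\<integral>\<^sup>+\<xi>\<in>ball (0::'a) N. ennreal (norm \<xi> powr (- a)) \<partial>lborel) \<le> ennreal (\<kappa> * N powr (real DIM('a) - a))"
proof -
  let ?f = "\<lambda>N \<xi>. ennreal (norm \<xi> powr (- a)) * indicator (ball (0::'a) N) \<xi>"
  let ?I = "\<integral>\<^sup>+\<xi>. ?f 1 \<xi> \<partial>lborel"
  \<comment> \<open>The added 1 makes \<kappa> positive without a lower bound on the
    integral.\<close>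
  define \<kappa> where "\<kappa> = enn2real ?I + 1"
  have fin: "?I < \<infinity>" using nn_integral_unit_ball_norm_powr_finite[OF a] .
  have "?I = ennreal (enn2real ?I)"
    using fin by (simp add: less_top)
  also have "\<dots> \<le> ennreal \<kappa>"
    by (intro ennreal_leI) (simp add: \<kappa>_def)
  finally have \<kappa>: "?I \<le> ennreal \<kappa>" .
  have \<kappa>0: "\<kappa> > 0"
    unfolding \<kappa>_def by (intro add_nonneg_pos) auto
  have "(\<integral>\<^sup>+\<xi>. ?f N \<xi> \<partial>lborel) \<le> ennreal (\<kappa> * N powr (real DIM('a) - a))" if N: "N > 0" for N
  proof -
    have eq: "?f N (0 + N *\<^sub>R \<xi>) = ennreal (N powr (- a)) * ?f 1 \<xi>" for \<xi>
      using N by (auto simp: indicator_def powr_mult ennreal_mult')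
    have "ennreal (N powr (- a)) * ?I = (\<integral>\<^sup>+\<xi>. ?f N (0 + N *\<^sub>R \<xi>) \<partial>lborel)"
      unfolding eq by (rule nn_integral_cmult[symmetric]) measurable
    also have "\<dots> = ennreal (1 / \<bar>N\<bar> ^ DIM('a)) * (\<integral>\<^sup>+\<xi>. ?f N \<xi> \<partial>lborel)"
      using N by (intro nn_integral_lborel_affine[where f="?f N"]) auto
    finally have "ennreal (N ^ DIM('a)) * (ennreal (N powr (- a)) * ?I)
        = ennreal (N ^ DIM('a)) * (ennreal (1 / N ^ DIM('a)) * (\<integral>\<^sup>+\<xi>. ?f N \<xi> \<partial>lborel))"
      using N by simp
    also have "\<dots> = (\<integral>\<^sup>+\<xi>. ?f N \<xi> \<partial>lborel)"
      using N by (simp add: mult.assoc[symmetric] ennreal_mult'[symmetric])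
    finally have "(\<integral>\<^sup>+\<xi>. ?f N \<xi> \<partial>lborel) = ennreal (N ^ DIM('a) * N powr (- a)) * ?I"
      using N by (simp add: mult.assoc[symmetric] ennreal_mult'[symmetric])
    also have "N ^ DIM('a) * N powr (- a) = N powr (real DIM('a) - a)"
      using N by (simp add: powr_diff powr_minus_divide powr_realpow)
    also have "ennreal (N powr (real DIM('a) - a)) * ?I \<le> ennreal (N powr (real DIM('a) - a)) * ennreal \<kappa>"
      using \<kappa> by (intro mult_left_mono) auto
    also have "\<dots> = ennreal (\<kappa> * N powr (real DIM('a) - a))"
      by (subst ennreal_mult'[symmetric]) (auto simp: mult.commute)
    finally show ?thesis .
  qed
  with \<kappa>0 show ?thesis
    by (intro exI[of _ \<kappa>] conjI allI impI)
qed

lemma nn_integral_powr_from_0: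
  fixes r b :: real
  assumes "r > 0" "b \<ge> 0"
  shows "(\<integral>\<^sup>+t. ennreal (r * t powr (r - 1)) * indicator {0..b} t \<partial>lborel) = ennreal (b powr r)"
proof -
  have "((\<lambda>t. r * t powr (r - 1)) has_integral r * (b powr (r - 1 + 1) / (r - 1 + 1))) {0..b}"
    using assms by (intro has_integral_mult_right has_integral_powr_from_0) auto
  then have "((\<lambda>t. if t \<in> {0..b} then r * t powr (r - 1) else 0) has_integral b powr r) UNIV"
    using assms by (subst has_integral_restrict_UNIV) auto
  then have I: "(\<integral>\<^sup>+t. ennreal (if t \<in> {0..b} then r * t powr (r - 1) else 0) \<partial>lborel) = ennreal (b powr r)"
    using assms by (intro nn_integral_has_integral_lborel) auto
  have eq: "ennreal (r * t powr (r - 1)) * indicator {0..b} t = ennreal (if t \<in> {0..b} then r * t powr (r - 1) else 0)" for t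
    by (simp add: indicator_def)
  show ?thesis unfolding eq by (rule I)
qed

section \<open>Duality estimates with split frequencies\<close>

abbreviation low_frequency_integral :: "real \<Rightarrow> (real^'n \<Rightarrow> complex) \<Rightarrow> ennreal" where
  "low_frequency_integral N g \<equiv> \<integral>\<^sup>+\<xi>\<in>ball 0 N. ennreal (cmod (g \<xi>)) \<partial>lborel"

abbreviation high_frequency_mass :: "real \<Rightarrow> (real^'n \<Rightarrow> complex) \<Rightarrow> real" where
  "high_frequency_mass N g \<equiv> \<integral>\<xi>. (cmod (indicator (- ball 0 N) \<xi> *\<^sub>R g \<xi>))\<^sup>2 \<partial>lborel"

text \<open>Parseval moves the pairing to the frequency side. Inside the ball the transform of
  \<phi> is bounded by the L^1 norm of \<phi>; outside, Cauchy--Schwarz and the Plancherel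
  inequality for \<phi> apply. This replaces an inversion formula for the low-frequency part of
  u.\<close>

lemma plancherel_transform_pairing_le:
  fixes u g \<phi> :: "real^'n \<Rightarrow> complex"
  assumes ug: "has_plancherel_transform u g"
    and cont: "continuous_on UNIV \<phi>" and M: "\<And>x. cmod (\<phi> x) \<le> M"
    and supp: "\<And>x. x \<notin> cball 0 R \<Longrightarrow> \<phi> x = 0"
    and A: "low_frequency_integral N g \<le> ennreal A" "0 \<le> A"
  shows "cmod (\<integral>x. u x * cnj (\<phi> x) \<partial>lborel)
    \<le> A / (2 * pi) powr (real CARD('n) / 2) * (\<integral>x. cmod (\<phi> x) \<partial>lborel)
      + sqrt (high_frequency_mass N g) * sqrt (L2_square \<phi>)"
proof -
  define c0 :: real where "c0 = (2 * pi) powr (real CARD('n) / 2)"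
  have c0: "c0 > 0" by (simp add: c0_def)
  have [measurable]: "g \<in> borel_measurable borel" and g2: "square_integrable g"
    using ug by (auto simp: has_plancherel_transform_def Lp_2_iff)
  have [measurable]: "\<phi> \<in> borel_measurable borel"
    using cont by (rule borel_measurable_continuous_onI)
  have \<phi>1: "integrable lborel \<phi>" and \<phi>2: "square_integrable \<phi>"
    by (rule integrable_bounded_support[OF _ M supp], measurable)
      (rule integrable_square_bounded_support[OF _ M supp], measurable)
  define F where "F = fourier_integral \<phi>"
  have F2: "square_integrable F"
    unfolding F_def by (rule integrable_fourier_integral_square[OF \<phi>1 \<phi>2])
  have [measurable]: "F \<in> borel_measurable borel"
    unfolding F_def by measurable
  have Fle: "cmod (F \<xi>) \<le> (\<integral>x. cmod (\<phi> x) \<partial>lborel) / c0" for \<xi>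
    unfolding F_def c0_def by (rule norm_fourier_integral_le)
  define gl where "gl \<xi> = indicator (ball 0 N) \<xi> *\<^sub>R g \<xi>" for \<xi>
  define gh where "gh \<xi> = indicator (- ball 0 N) \<xi> *\<^sub>R g \<xi>" for \<xi>
  have [measurable]: "gl \<in> borel_measurable borel" "gh \<in> borel_measurable borel"
    unfolding gl_def[abs_def] gh_def[abs_def] by measurable
  have gl2: "square_integrable gl"
    by (rule Bochner_Integration.integrable_bound[OF g2], measurable) (simp add: gl_def indicator_def)
  have gh2: "square_integrable gh"
    by (rule Bochner_Integration.integrable_bound[OF g2], measurable) (simp add: gh_def indicator_def)
  have split: "g \<xi> = gl \<xi> + gh \<xi>" for \<xi>
    by (auto simp: gl_def gh_def indicator_def)
  have "(\<integral>x. u x * cnj (\<phi> x) \<partial>lborel) = (\<integral>\<xi>. g \<xi> * cnj (F \<xi>) \<partial>lborel)"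
    unfolding F_def by (rule plancherel_transform_parseval[OF ug cont M supp, symmetric])
  also have "\<dots> = (\<integral>\<xi>. gl \<xi> * cnj (F \<xi>) + gh \<xi> * cnj (F \<xi>) \<partial>lborel)"
    by (simp only: split distrib_right)
  also have "\<dots> = (\<integral>\<xi>. gl \<xi> * cnj (F \<xi>) \<partial>lborel) + (\<integral>\<xi>. gh \<xi> * cnj (F \<xi>) \<partial>lborel)"
    by (intro Bochner_Integration.integral_add integrable_mult_of_squares gl2 gh2 F2) measurable
  finally have "cmod (\<integral>x. u x * cnj (\<phi> x) \<partial>lborel)
      \<le> cmod (\<integral>\<xi>. gl \<xi> * cnj (F \<xi>) \<partial>lborel) + cmod (\<integral>\<xi>. gh \<xi> * cnj (F \<xi>) \<partial>lborel)"
    by (simp add: norm_triangle_ineq)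
  moreover have "cmod (\<integral>\<xi>. gl \<xi> * cnj (F \<xi>) \<partial>lborel) \<le> A / c0 * (\<integral>x. cmod (\<phi> x) \<partial>lborel)"
  proof -
    let ?b = "(\<integral>x. cmod (\<phi> x) \<partial>lborel) / c0"
    have b: "0 \<le> ?b" using c0 by simp
    have "ennreal (cmod (\<integral>\<xi>. gl \<xi> * cnj (F \<xi>) \<partial>lborel)) \<le> (\<integral>\<^sup>+\<xi>. ennreal (cmod (gl \<xi> * cnj (F \<xi>))) \<partial>lborel)"
      by (intro integral_norm_bound_ennreal integrable_mult_of_squares gl2 F2) measurable
    also have "\<dots> \<le> (\<integral>\<^sup>+\<xi>. ennreal ?b * (ennreal (cmod (g \<xi>)) * indicator (ball 0 N) \<xi>) \<partial>lborel)"
    proof (rule nn_integral_mono)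
      fix \<xi>
      show "ennreal (cmod (gl \<xi> * cnj (F \<xi>))) \<le> ennreal ?b * (ennreal (cmod (g \<xi>)) * indicator (ball 0 N) \<xi>)"
      proof (cases "\<xi> \<in> ball 0 N")
        case True
        have "cmod (g \<xi>) * cmod (F \<xi>) \<le> cmod (g \<xi>) * ?b"
          by (intro mult_left_mono Fle) auto
        then have "ennreal (cmod (g \<xi>) * cmod (F \<xi>)) \<le> ennreal ?b * ennreal (cmod (g \<xi>))"
          using b by (subst ennreal_mult'[symmetric]) (auto simp: mult.commute intro: ennreal_leI)
        then show ?thesis
          using True by (simp add: gl_def norm_mult)
      qed (simp add: gl_def)
    qed
    also have "\<dots> = ennreal ?b * low_frequency_integral N g"
      by (rule nn_integral_cmult) measurable
    also have "\<dots> \<le> ennreal ?b * ennreal A"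
      by (intro mult_left_mono A) auto
    also have "\<dots> = ennreal (A / c0 * (\<integral>x. cmod (\<phi> x) \<partial>lborel))"
      using b A(2) by (subst ennreal_mult'[symmetric]) (auto simp: mult.commute)
    finally show ?thesis
      using c0 A(2) by (subst (asm) ennreal_le_iff) auto
  qed
  moreover have "cmod (\<integral>\<xi>. gh \<xi> * cnj (F \<xi>) \<partial>lborel)
      \<le> sqrt (L2_square gh) * sqrt (L2_square \<phi>)"
  proof -
    have "cmod (\<integral>\<xi>. gh \<xi> * cnj (F \<xi>) \<partial>lborel)
      \<le> sqrt (L2_square gh) * sqrt (L2_square F)"
      by (rule Cauchy_Schwarz_integral) (use gh2 F2 in auto)
    also have "\<dots> \<le> sqrt (L2_square gh) * sqrt (L2_square \<phi>)"
      using plancherel_le[OF \<phi>1 \<phi>2] by (intro mult_left_mono) (auto simp: F_def)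
    finally show ?thesis .
  qed
  ultimately show ?thesis
    unfolding c0_def[symmetric] gh_def by linarith
qed

text \<open>This is the pairing estimate with the phase of u on E as test object. That function is
  only measurable, so it is approximated almost everywhere by continuous functions, and all three
  integrals pass to the limit by dominated convergence.\<close>

lemma plancherel_transform_set_integral_le:
  fixes u g :: "real^'n \<Rightarrow> complex"
  assumes ug: "has_plancherel_transform u g"
    and E [measurable]: "E \<in> sets borel" and ER: "E \<subseteq> cball 0 R"
    and A: "low_frequency_integral N g \<le> ennreal A" "0 \<le> A"
  shows "(\<integral>x. indicator E x * cmod (u x) \<partial>lborel)
    \<le> A / (2 * pi) powr (real CARD('n) / 2) * measure lborel E
      + sqrt (high_frequency_mass N g) * sqrt (measure lborel E)"
proof -
  have u: "u \<in> Lp 2"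
    using ug by (auto simp: has_plancherel_transform_def)
  then have [measurable]: "u \<in> borel_measurable borel"
    by (auto simp: Lp_2_iff)
  define \<psi> where "\<psi> x = indicator E x *\<^sub>R sgn (u x)" for x
  have "\<psi> \<in> borel_measurable lborel"
    unfolding \<psi>_def sgn_div_norm by measurable
  then have "\<psi> \<in> borel_measurable lebesgue"
    by (rule measurable_completion)
  then have "\<psi> measurable_on UNIV"
    by (intro lebesgue_measurable_imp_measurable_on) auto
  then obtain Z h where Z: "negligible Z" and h: "\<And>n. continuous_on UNIV (h n)"
    and lim: "\<And>x. x \<notin> Z \<Longrightarrow> (\<lambda>n. h n x) \<longlonglongrightarrow> \<psi> x"
    unfolding measurable_on_def by auto
  have AEZ: "AE x in lborel. x \<notin> Z"
  proof -
    have "Z \<in> null_sets lebesgue"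
      using Z by (simp only: negligible_iff_null_sets)
    then have "AE x in lebesgue. x \<notin> Z"
      by (rule AE_not_in)
    then show ?thesis
      by (simp only: AE_completion_iff)
  qed
  \<comment> \<open>\<open>cl\<close> retracts the plane radially onto the closed unit disc;
    \<open>ct\<close> is 1 on \<open>cball 0 R\<close> and 0 outside \<open>cball 0 (R + 1)\<close>.
    Neither changes \<psi>, so the limit survives, while the approximants become bounded with a
    common compact support.\<close>
  define cl :: "complex \<Rightarrow> complex" where "cl z = z /\<^sub>R max 1 (cmod z)" for z
  define ct :: "real^'n \<Rightarrow> real" where "ct x = max 0 (min 1 (R + 1 - norm x))" for x
  define \<phi> where "\<phi> n x = ct x *\<^sub>R cl (h n x)" for n x
  have cl: "cmod (cl z) \<le> 1" for z
  proof (cases "cmod z \<le> 1")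
    case False
    then have "cmod z \<noteq> 0" by auto
    with False show ?thesis by (simp add: cl_def max_absorb2)
  qed (simp add: cl_def max_absorb1)
  have clc: "continuous_on UNIV cl"
    unfolding cl_def by (intro continuous_intros) (auto simp: max_def)
  have ct: "0 \<le> ct x" "ct x \<le> 1" for x
    by (auto simp: ct_def)
  have "continuous_on UNIV (\<lambda>x. cl (h n x))" for n
    by (rule continuous_on_compose2[OF clc h[of n]]) simp
  then have cont: "continuous_on UNIV (\<phi> n)" for n
    unfolding \<phi>_def ct_def by (intro continuous_intros)
  have [measurable]: "\<phi> n \<in> borel_measurable borel" for n
    using cont by (rule borel_measurable_continuous_onI)
  have [measurable]: "\<psi> \<in> borel_measurable borel"
    using \<open>\<psi> \<in> borel_measurable lborel\<close> by simp
  have bd: "cmod (\<phi> n x) \<le> 1" for n x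
    using ct[of x] cl[of "h n x"] by (auto simp: \<phi>_def mult_le_one)
  have supp: "\<phi> n x = 0" if "x \<notin> cball 0 (R + 1)" for n x
    using that by (auto simp: \<phi>_def ct_def)
  have bd': "cmod (\<phi> n x) \<le> indicator (cball 0 (R + 1)) x" for n x
    using bd[of n x] supp[of x n] by (cases "x \<in> cball 0 (R + 1)") simp_all
  have \<psi>1: "cmod (\<psi> x) \<le> indicator E x" for x
    by (auto simp: \<psi>_def indicator_def norm_sgn)
  have lim\<phi>: "(\<lambda>n. \<phi> n x) \<longlonglongrightarrow> \<psi> x" if "x \<notin> Z" for x
  proof -
    have "(\<lambda>n. \<phi> n x) \<longlonglongrightarrow> ct x *\<^sub>R cl (\<psi> x)"
    proof -
      have "isCont cl (\<psi> x)"
        using clc by (simp add: continuous_on_eq_continuous_at)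
      then show ?thesis
        unfolding \<phi>_def by (rule tendsto_scaleR[OF tendsto_const isCont_tendsto_compose[OF _ lim[OF that]]])
    qed
    moreover have "cl (\<psi> x) = \<psi> x"
    proof -
      have "cmod (\<psi> x) \<le> 1"
        by (rule order_trans[OF \<psi>1]) (simp add: indicator_def)
      then show ?thesis by (simp add: cl_def max_absorb1)
    qed
    moreover have "ct x *\<^sub>R \<psi> x = \<psi> x"
      using ER by (cases "x \<in> E") (auto simp: \<psi>_def ct_def)
    ultimately show ?thesis by simp
  qed
  have iB: "integrable lborel (\<lambda>x. indicat_real (cball (0::real^'n) (R + 1)) x)"
    by (intro integrable_real_indicator) (use emeasure_lborel_cball_finite[of "0::real^'n" "R + 1"] in auto)
  have iu: "integrable lborel (\<lambda>x. cmod (indicator (cball 0 (R + 1)) x *\<^sub>R u x))"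
    by (intro integrable_norm integrable_truncation u)
  have Efin: "emeasure lborel E < \<infinity>"
    using emeasure_mono[OF ER, of lborel] emeasure_lborel_cball_finite[of "0::real^'n" R] by (auto intro: le_less_trans)
  have iE: "integrable lborel (\<lambda>x. indicat_real E x)"
    by (intro integrable_real_indicator) (use Efin in auto)
  let ?T = "sqrt (high_frequency_mass N g)"
  let ?a = "A / (2 * pi) powr (real CARD('n) / 2)"
  have 1: "(\<lambda>n. \<integral>x. u x * cnj (\<phi> n x) \<partial>lborel) \<longlonglongrightarrow> (\<integral>x. u x * cnj (\<psi> x) \<partial>lborel)"
  proof (rule integral_dominated_convergence[OF _ _ iu])
    show "AE x in lborel. (\<lambda>n. u x * cnj (\<phi> n x)) \<longlonglongrightarrow> u x * cnj (\<psi> x)"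
      using AEZ by eventually_elim (rule tendsto_mult[OF tendsto_const tendsto_cnj[OF lim\<phi>]])
    show "AE x in lborel. norm (u x * cnj (\<phi> n x)) \<le> cmod (indicator (cball 0 (R + 1)) x *\<^sub>R u x)" for n
    proof (rule AE_I2)
      fix x
      show "norm (u x * cnj (\<phi> n x)) \<le> cmod (indicator (cball 0 (R + 1)) x *\<^sub>R u x)"
        using mult_left_mono[OF bd'[of n x], of "cmod (u x)"] by (simp add: norm_mult mult.commute)
    qed
  qed measurable
  have 2: "(\<lambda>n. \<integral>x. cmod (\<phi> n x) \<partial>lborel) \<longlonglongrightarrow> (\<integral>x. cmod (\<psi> x) \<partial>lborel)"
  proof (rule integral_dominated_convergence[OF _ _ iB])
    show "AE x in lborel. (\<lambda>n. cmod (\<phi> n x)) \<longlonglongrightarrow> cmod (\<psi> x)"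
      using AEZ by eventually_elim (rule tendsto_norm[OF lim\<phi>])
    show "AE x in lborel. norm (cmod (\<phi> n x)) \<le> indicator (cball 0 (R + 1)) x" for n
      by (rule AE_I2) (simp only: real_norm_def abs_norm_cancel bd')
  qed measurable
  have 3: "(\<lambda>n. \<integral>x. (cmod (\<phi> n x))\<^sup>2 \<partial>lborel) \<longlonglongrightarrow> (L2_square \<psi>)"
  proof (rule integral_dominated_convergence[OF _ _ iB])
    show "AE x in lborel. (\<lambda>n. (cmod (\<phi> n x))\<^sup>2) \<longlonglongrightarrow> (cmod (\<psi> x))\<^sup>2"
      using AEZ by eventually_elim (rule tendsto_power[OF tendsto_norm[OF lim\<phi>]])
    have "(cmod (\<phi> n x))\<^sup>2 \<le> indicator (cball 0 (R + 1)) x" for n x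
      using bd[of n x] supp[of x n] by (cases "x \<in> cball 0 (R + 1)") (simp_all add: power_le_one)
    then show "AE x in lborel. norm ((cmod (\<phi> n x))\<^sup>2) \<le> indicator (cball 0 (R + 1)) x" for n
      by (intro AE_I2) (simp only: real_norm_def abs_power2)
  qed measurable
  have "cmod (\<integral>x. u x * cnj (\<psi> x) \<partial>lborel)
      \<le> ?a * (\<integral>x. cmod (\<psi> x) \<partial>lborel) + ?T * sqrt (L2_square \<psi>)"
  proof (rule LIMSEQ_le)
    show "(\<lambda>n. cmod (\<integral>x. u x * cnj (\<phi> n x) \<partial>lborel)) \<longlonglongrightarrow> cmod (\<integral>x. u x * cnj (\<psi> x) \<partial>lborel)"
      by (rule tendsto_norm[OF 1])
    show "(\<lambda>n. ?a * (\<integral>x. cmod (\<phi> n x) \<partial>lborel) + ?T * sqrt (\<integral>x. (cmod (\<phi> n x))\<^sup>2 \<partial>lborel))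
        \<longlonglongrightarrow> ?a * (\<integral>x. cmod (\<psi> x) \<partial>lborel) + ?T * sqrt (L2_square \<psi>)"
      by (intro tendsto_add tendsto_mult tendsto_const tendsto_real_sqrt 2 3)
    show "\<exists>K. \<forall>n\<ge>K. cmod (\<integral>x. u x * cnj (\<phi> n x) \<partial>lborel)
        \<le> ?a * (\<integral>x. cmod (\<phi> n x) \<partial>lborel) + ?T * sqrt (\<integral>x. (cmod (\<phi> n x))\<^sup>2 \<partial>lborel)"
      by (intro exI allI impI plancherel_transform_pairing_le[OF ug cont bd supp A])
  qed
  also have "\<dots> \<le> ?a * measure lborel E + ?T * sqrt (measure lborel E)"
  proof (intro add_mono mult_left_mono)
    have "(\<integral>x. cmod (\<psi> x) \<partial>lborel) \<le> (\<integral>x. indicat_real E x \<partial>lborel)"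
      by (rule integral_mono_AE') (use iE \<psi>1 in auto)
    then show "(\<integral>x. cmod (\<psi> x) \<partial>lborel) \<le> measure lborel E"
      by simp
    have "(cmod (\<psi> x))\<^sup>2 \<le> indicat_real E x" for x
      using \<psi>1[of x] by (auto simp: indicator_def power_le_one split: if_splits)
    then have "(L2_square \<psi>) \<le> (\<integral>x. indicat_real E x \<partial>lborel)"
      by (intro integral_mono_AE') (use iE in auto)
    then show "sqrt (L2_square \<psi>) \<le> sqrt (measure lborel E)"
      by simp
    show "0 \<le> ?a" using A(2) by simp
    show "0 \<le> ?T" by simp
  qed
  also have "(\<integral>x. u x * cnj (\<psi> x) \<partial>lborel) = complex_of_real (\<integral>x. indicator E x * cmod (u x) \<partial>lborel)"
  proof -
    have "u x * cnj (\<psi> x) = complex_of_real (indicator E x * cmod (u x))" for x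
    proof (cases "u x = 0")
      case False
      have a: "u x * cnj (u x) = of_real ((cmod (u x))\<^sup>2)"
        by (simp only: complex_norm_square)
      have r: "inverse (cmod (u x)) * (cmod (u x))\<^sup>2 = cmod (u x)"
        using False by (simp add: power2_eq_square)
      have "cnj (\<psi> x) = indicator E x *\<^sub>R (inverse (cmod (u x)) *\<^sub>R cnj (u x))"
        by (simp add: \<psi>_def sgn_div_norm)
      then have "u x * cnj (\<psi> x) = indicator E x *\<^sub>R (inverse (cmod (u x)) *\<^sub>R (u x * cnj (u x)))"
        by (simp only: mult_scaleR_right)
      also have "\<dots> = complex_of_real (indicator E x * (inverse (cmod (u x)) * (cmod (u x))\<^sup>2))"
        by (simp only: a scaleR_conv_of_real of_real_mult)
      finally show ?thesis by (simp only: r)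
    qed (simp add: \<psi>_def)
    then show ?thesis
      by (simp only: integral_complex_of_real)
  qed
  finally show ?thesis by simp
qed

text \<open>A Chebyshev inequality by duality: if m is the measure of the superlevel set in a ball,
  then l m is at most the integral of |u| over that set. The level is large enough for the low
  frequencies to account for at most half of l m, so the high-frequency mass has to account for the
  rest.\<close>

lemma emeasure_superlevel_le:
  fixes u g :: "real^'n \<Rightarrow> complex"
  assumes ug: "has_plancherel_transform u g" and l: "l > 0"
    and A: "low_frequency_integral N g \<le> ennreal A" "0 \<le> A"
    and lA: "2 * A / (2 * pi) powr (real CARD('n) / 2) \<le> l"
  shows "emeasure lborel {x. l \<le> cmod (u x)}
    \<le> ennreal (4 / l\<^sup>2) * (\<integral>\<^sup>+\<xi>. ennreal ((cmod (g \<xi>))\<^sup>2) * indicator (- ball 0 N) \<xi> \<partial>lborel)"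
proof -
  have [measurable]: "u \<in> borel_measurable borel" "g \<in> borel_measurable borel"
    and g2: "square_integrable g" and u: "u \<in> Lp 2"
    using ug by (auto simp: has_plancherel_transform_def Lp_2_iff)
  define T where "T = (high_frequency_mass N g)"
  have T: "T \<ge> 0" by (simp add: T_def)
  have gh2: "integrable lborel (\<lambda>\<xi>. (cmod (indicator (- ball 0 N) \<xi> *\<^sub>R g \<xi>))\<^sup>2)"
  proof (rule Bochner_Integration.integrable_bound[OF g2])
    show "(\<lambda>\<xi>. (cmod (indicator (- ball 0 N) \<xi> *\<^sub>R g \<xi>))\<^sup>2) \<in> borel_measurable lborel"
      by measurable
  qed (auto simp: indicator_def)
  have Teq: "(\<integral>\<^sup>+\<xi>. ennreal ((cmod (g \<xi>))\<^sup>2) * indicator (- ball 0 N) \<xi> \<partial>lborel) = ennreal T"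
  proof -
    have "ennreal T = (\<integral>\<^sup>+\<xi>. ennreal ((cmod (indicator (- ball 0 N) \<xi> *\<^sub>R g \<xi>))\<^sup>2) \<partial>lborel)"
      unfolding T_def by (rule nn_integral_eq_integral[OF gh2, symmetric]) simp
    also have "\<dots> = (\<integral>\<^sup>+\<xi>. ennreal ((cmod (g \<xi>))\<^sup>2) * indicator (- ball 0 N) \<xi> \<partial>lborel)"
      by (intro nn_integral_cong) (simp add: indicator_def)
    finally show ?thesis ..
  qed
  \<comment> \<open>The balls make the measure \<open>m\<close> below finite, so that terms can be
    absorbed and sqrt m cancelled.\<close>
  define E where "E k = cball 0 (real k) \<inter> {x. l \<le> cmod (u x)}" for k :: nat
  have [measurable]: "E k \<in> sets borel" for k
    unfolding E_def by measurable
  have bound: "emeasure lborel (E k) \<le> ennreal (4 / l\<^sup>2) * ennreal T" for k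
  proof -
    define m where "m = measure lborel (E k)"
    have m0: "m \<ge> 0" by (simp add: m_def)
    have fin: "emeasure lborel (E k) < \<infinity>"
      using emeasure_mono[of "E k" "cball 0 (real k)" lborel] emeasure_lborel_cball_finite[of "0::real^'n" "real k"]
      by (auto simp: E_def intro: le_less_trans)
    have "l * m = (\<integral>x. l * indicator (E k) x \<partial>lborel)"
      by (simp add: m_def)
    also have "\<dots> \<le> (\<integral>x. indicator (E k) x * cmod (u x) \<partial>lborel)"
    proof (rule integral_mono)
      show "integrable lborel (\<lambda>x. l * indicat_real (E k) x)"
        by (intro integrable_mult_right integrable_real_indicator) (use fin in auto)
      show "integrable lborel (\<lambda>x. indicat_real (E k) x * cmod (u x))"
        by (rule Bochner_Integration.integrable_bound[OF integrable_norm[OF integrable_truncation(1)[OF u, of "real k"]]])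
          (auto simp: E_def indicator_def)
    qed (auto simp: E_def indicator_def)
    also have "\<dots> \<le> A / (2 * pi) powr (real CARD('n) / 2) * m + sqrt T * sqrt m"
      unfolding m_def T_def by (rule plancherel_transform_set_integral_le[OF ug _ _ A, of _ "real k"]) (auto simp: E_def)
    finally have "l * m \<le> A / (2 * pi) powr (real CARD('n) / 2) * m + sqrt T * sqrt m" .
    \<comment> \<open>Absorbs the low-frequency term into half of \<open>l * m\<close>.\<close>
    moreover have "A / (2 * pi) powr (real CARD('n) / 2) * m \<le> l / 2 * m"
    proof (rule mult_right_mono[OF _ m0])
      have "A / (2 * pi) powr (real CARD('n) / 2) = (2 * A / (2 * pi) powr (real CARD('n) / 2)) / 2"
        by simp
      with lA show "A / (2 * pi) powr (real CARD('n) / 2) \<le> l / 2"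
        by linarith
    qed
    moreover have "l / 2 * m = l * m - l / 2 * m"
      by simp
    ultimately have "l / 2 * m \<le> sqrt T * sqrt m"
      by linarith
    then have *: "l / 2 * (sqrt m * sqrt m) \<le> sqrt T * sqrt m"
      using m0 by simp
    have "l / 2 * sqrt m \<le> sqrt T"
    proof (cases "m = 0")
      case False
      then have "sqrt m > 0" using m0 by simp
      then show ?thesis
        by (rule mult_right_le_imp_le[rotated]) (use * in \<open>simp only: mult.assoc\<close>)
    qed (simp add: T)
    then have "(l / 2 * sqrt m)\<^sup>2 \<le> (sqrt T)\<^sup>2"
      using l m0 by (intro power_mono) auto
    then have "m * (l / 2)\<^sup>2 \<le> T"
      using m0 T by (simp only: power_mult_distrib real_sqrt_pow2 mult.commute)
    then have "m \<le> T / (l / 2)\<^sup>2"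
      using l by (subst pos_le_divide_eq) auto
    then have "m \<le> 4 / l\<^sup>2 * T"
      by (simp add: power_divide mult.commute)
    then have "emeasure lborel (E k) \<le> ennreal (4 / l\<^sup>2 * T)"
      using fin unfolding m_def by (subst emeasure_eq_ennreal_measure) (auto intro: ennreal_leI)
    also have "\<dots> = ennreal (4 / l\<^sup>2) * ennreal T"
      by (rule ennreal_mult') simp
    finally show ?thesis .
  qed
  have "{x. l \<le> cmod (u x)} = (\<Union>k. E k)"
  proof (intro equalityI subsetI)
    fix x assume "x \<in> {x. l \<le> cmod (u x)}"
    moreover obtain k where "norm x \<le> real k"
      using real_arch_simple[of "norm x"] ..
    ultimately show "x \<in> (\<Union>k. E k)"
      by (intro UN_I[of k]) (simp_all only: E_def UNIV_I Int_iff mem_cball dist_0_norm)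
  qed (simp add: E_def)
  moreover have "incseq E"
    unfolding incseq_def E_def by (intro allI impI Int_mono subset_cball) auto
  then have "(SUP k. emeasure lborel (E k)) = emeasure lborel (\<Union>k. E k)"
    by (intro SUP_emeasure_incseq) auto
  ultimately have "emeasure lborel {x. l \<le> cmod (u x)} = (SUP k. emeasure lborel (E k))"
    by (simp only:)
  also have "\<dots> \<le> ennreal (4 / l\<^sup>2) * ennreal T"
    by (intro SUP_least bound)
  finally show ?thesis by (simp only: Teq)
qed

section \<open>From level sets to L^q bounds\<close>

abbreviation nn_Lp_power :: "real \<Rightarrow> (real^'n \<Rightarrow> complex) \<Rightarrow> ennreal" where
  "nn_Lp_power r u \<equiv> \<integral>\<^sup>+x. ennreal (cmod (u x) powr r) \<partial>lborel"

abbreviation nn_weighted :: "real \<Rightarrow> (real^'n \<Rightarrow> complex) \<Rightarrow> ennreal" where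
  "nn_weighted a g \<equiv> \<integral>\<^sup>+\<xi>. ennreal (norm \<xi> powr a) * ennreal ((cmod (g \<xi>))\<^sup>2) \<partial>lborel"

lemma ennreal_power2_le_imp_le:
  fixes x :: ennreal
  assumes "x\<^sup>2 \<le> (ennreal r)\<^sup>2"
  shows "x \<le> ennreal r"
proof (cases "0 \<le> r")
  case True
  show ?thesis
  proof (cases x)
    case (real t)
    then have "t\<^sup>2 \<le> r\<^sup>2"
      using assms True by (simp add: ennreal_power)
    then have "t \<le> r"
      using True by (rule power2_le_imp_le)
    then show ?thesis using real by (simp add: ennreal_leI)
  next
    case top
    then show ?thesis using assms True by (simp add: ennreal_power top_unique)
  qed
next
  case False
  then show ?thesis using assms by (simp add: ennreal_neg)
qed

text \<open>Cauchy--Schwarz after multiplying and dividing by the s-th power of the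
  frequency.\<close>

lemma nn_integral_ball_le_weighted:
  fixes g :: "real^'n \<Rightarrow> complex"
  assumes [measurable]: "g \<in> borel_measurable borel"
    and W: "nn_weighted (2 * s) g \<le> ennreal H" "0 \<le> H"
    and K: "(\<integral>\<^sup>+\<xi>\<in>ball (0::real^'n) N. ennreal (norm \<xi> powr (- (2 * s))) \<partial>lborel) \<le> ennreal K" "0 \<le> K"
  shows "low_frequency_integral N g \<le> ennreal (sqrt (K * H))"
proof -
  let ?a = "\<lambda>\<xi>::real^'n. ennreal (norm \<xi> powr (- s)) * indicator (ball 0 N) \<xi>"
  let ?b = "\<lambda>\<xi>::real^'n. ennreal (norm \<xi> powr s * cmod (g \<xi>))"
  let ?W = "\<integral>\<^sup>+\<xi>. ennreal (norm \<xi> powr (2 * s)) * ennreal ((cmod (g \<xi>))\<^sup>2) \<partial>lborel"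
  let ?K = "\<integral>\<^sup>+\<xi>\<in>ball (0::real^'n) N. ennreal (norm \<xi> powr (- (2 * s))) \<partial>lborel"
  \<comment> \<open>At the origin the two weights multiply to 0 rather than 1, so the factorization
    holds only almost everywhere.\<close>
  have ae: "AE \<xi> in lborel. \<xi> \<noteq> (0::real^'n)"
    by (rule AE_lborel_singleton)
  have "low_frequency_integral N g = (\<integral>\<^sup>+\<xi>. ?a \<xi> * ?b \<xi> \<partial>lborel)"
  proof (rule nn_integral_cong_AE)
    show "AE \<xi> in lborel. ennreal (cmod (g \<xi>)) * indicator (ball 0 N) \<xi> = ?a \<xi> * ?b \<xi>"
      using ae
    proof eventually_elim
      fix \<xi> :: "real^'n" assume "\<xi> \<noteq> 0"
      then have "norm \<xi> powr (- s) * (norm \<xi> powr s * cmod (g \<xi>)) = cmod (g \<xi>)"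
        by (simp add: powr_minus mult.assoc[symmetric])
      then have "ennreal (norm \<xi> powr (- s)) * ennreal (norm \<xi> powr s * cmod (g \<xi>)) = ennreal (cmod (g \<xi>))"
        by (subst ennreal_mult'[symmetric]) auto
      then show "ennreal (cmod (g \<xi>)) * indicator (ball 0 N) \<xi> = ?a \<xi> * ?b \<xi>"
        by (simp add: indicator_def)
    qed
  qed
  then have "(low_frequency_integral N g)\<^sup>2 \<le> (\<integral>\<^sup>+\<xi>. (?a \<xi>)\<^sup>2 \<partial>lborel) * (\<integral>\<^sup>+\<xi>. (?b \<xi>)\<^sup>2 \<partial>lborel)"
    by (simp only:) (rule Cauchy_Schwarz_nn_integral; measurable)
  also have "(\<integral>\<^sup>+\<xi>. (?a \<xi>)\<^sup>2 \<partial>lborel) = ?K"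
  proof (rule nn_integral_cong)
    fix \<xi> :: "real^'n"
    have "(norm \<xi> powr (- s))\<^sup>2 = norm \<xi> powr (- (2 * s))"
      by (simp add: power2_eq_square powr_add[symmetric])
    then have "(ennreal (norm \<xi> powr (- s)))\<^sup>2 = ennreal (norm \<xi> powr (- (2 * s)))"
      by (simp add: ennreal_power)
    then show "(?a \<xi>)\<^sup>2 = ennreal (norm \<xi> powr (- (2 * s))) * indicator (ball 0 N) \<xi>"
      by (simp add: indicator_def)
  qed
  also have "(\<integral>\<^sup>+\<xi>. (?b \<xi>)\<^sup>2 \<partial>lborel) = ?W"
  proof (rule nn_integral_cong)
    fix \<xi> :: "real^'n"
    have "(norm \<xi> powr s * cmod (g \<xi>))\<^sup>2 = norm \<xi> powr (2 * s) * (cmod (g \<xi>))\<^sup>2"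
      by (simp add: power2_eq_square powr_add[symmetric] mult_ac)
    then show "(?b \<xi>)\<^sup>2 = ennreal (norm \<xi> powr (2 * s)) * ennreal ((cmod (g \<xi>))\<^sup>2)"
      by (simp add: ennreal_power ennreal_mult'[symmetric])
  qed
  also have "?K
      * ?W \<le> ennreal K * ennreal H"
    by (intro mult_mono W K) auto
  also have "\<dots> = (ennreal (sqrt (K * H)))\<^sup>2"
    using W(2) K(2) by (simp add: ennreal_power ennreal_mult'[symmetric])
  finally show ?thesis
    by (rule ennreal_power2_le_imp_le)
qed

text \<open>Tonelli, after |u(x)|^q is written as the integral of q l^(q-1) over l from 0 to
  |u(x)|.\<close>

lemma nn_integral_powr_layer_cake:
  fixes u :: "real^'n \<Rightarrow> complex"
  assumes [measurable]: "u \<in> borel_measurable borel" and q: "q > 0"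
  shows "nn_Lp_power q u
    = (\<integral>\<^sup>+l. ennreal (q * l powr (q - 1)) * indicator {0..} l * emeasure lborel {x. l \<le> cmod (u x)} \<partial>lborel)"
proof -
  let ?w = "\<lambda>l. ennreal (q * l powr (q - 1)) * indicator {0..} l"
  have "nn_Lp_power q u
      = (\<integral>\<^sup>+x. \<integral>\<^sup>+l. ennreal (q * l powr (q - 1)) * indicator {0..cmod (u x)} l \<partial>lborel \<partial>lborel)"
    using q by (simp add: nn_integral_powr_from_0)
  also have "\<dots> = (\<integral>\<^sup>+x. \<integral>\<^sup>+l. ?w l * indicator {x. l \<le> cmod (u x)} x \<partial>lborel \<partial>lborel)"
    by (intro nn_integral_cong) (auto simp: indicator_def)
  also have "\<dots> = (\<integral>\<^sup>+l. \<integral>\<^sup>+x. ?w l * indicator {x. l \<le> cmod (u x)} x \<partial>lborel \<partial>lborel)"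
  proof (rule lborel_pair.Fubini'[symmetric])
    have "(\<lambda>(x, l). ?w l * (if l \<le> cmod (u x) then 1 else 0))
        \<in> borel_measurable (lborel \<Otimes>\<^sub>M lborel)"
      by measurable
    then show "(\<lambda>(x, l). ?w l * indicator {x. l \<le> cmod (u x)} x)
        \<in> borel_measurable (lborel \<Otimes>\<^sub>M lborel)"
      by (simp add: indicator_def of_bool_def)
  qed
  also have "\<dots> = (\<integral>\<^sup>+l. ?w l * emeasure lborel {x. l \<le> cmod (u x)} \<partial>lborel)"
    by (intro nn_integral_cong) (subst nn_integral_cmult, auto)
  finally show ?thesis .
qed

text \<open>
  Following Chemin and Xu, the frequencies are split at a radius that depends on the level \<open>l\<close>.
\<close>

lemma plancherel_transform_sobolev:
  fixes q :: real
  assumes q: "q > 2"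
  shows "\<exists>K>0. \<forall>(u :: real^'n \<Rightarrow> complex) g H. has_plancherel_transform u g \<longrightarrow> H > 0 \<longrightarrow>
    (\<integral>\<^sup>+\<xi>. ennreal (norm \<xi> powr (real CARD('n) - 2 * real CARD('n) / q)) * ennreal ((cmod (g \<xi>))\<^sup>2) \<partial>lborel) \<le> ennreal H \<longrightarrow>
    nn_Lp_power q u \<le> ennreal (K * H powr (q / 2))"
proof -
  define d where "d = real CARD('n)"
  have d: "d \<ge> 1" unfolding d_def using one_le_card_finite by simp
  define s where "s = d / 2 - d / q"
  have s: "0 < 2 * s" "2 * s < d"
    using q d by (auto simp: s_def field_simps)
  have ds: "d - 2 * s = 2 * (d / q)" by (simp add: s_def)
  define c0 :: real where "c0 = (2 * pi) powr (d / 2)"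
  have c0: "c0 > 0" by (simp add: c0_def)
  obtain \<kappa> where \<kappa>: "\<kappa> > 0"
    and \<kappa>_le: "\<And>N. N > 0 \<Longrightarrow> (\<integral>\<^sup>+\<xi>\<in>ball (0::real^'n) N. ennreal (norm \<xi> powr (- (2 * s))) \<partial>lborel) \<le> ennreal (\<kappa> * N powr (2 * (d / q)))"
    using nn_integral_ball_norm_powr_le[where 'a="real^'n" and a="2 * s"] s ds by (auto simp: d_def)
  define K where "K = 4 * q / (q - 2) * (2 * sqrt \<kappa> / c0) powr (q - 2)"
  have K: "K > 0" using q \<kappa> c0 by (simp add: K_def)
  have "nn_Lp_power q u \<le> ennreal (K * H powr (q / 2))"
    if ug: "has_plancherel_transform u g" and H: "H > 0"
      and W: "nn_weighted (2 * s) g \<le> ennreal H"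
    for u g :: "real^'n \<Rightarrow> complex" and H
  proof -
    have [measurable]: "u \<in> borel_measurable borel" "g \<in> borel_measurable borel"
      using ug by (auto simp: has_plancherel_transform_def Lp_2_iff)
    \<comment> \<open>The low-frequency integral up to radius N is at most sqrt(\<kappa> H) N^(d/q).
      With this \<open>L\<close> the level condition of \<open>emeasure_superlevel_le\<close> reads
      L N^(d/q) \<le> l; the radius \<open>N\<close> below is the one that gives equality.\<close>
    define L where "L = 2 * sqrt (\<kappa> * H) / c0"
    let ?g = "\<lambda>\<xi>. ennreal ((cmod (g \<xi>))\<^sup>2)"
    let ?i = "\<lambda>\<xi>::real^'n. indicator {0..L * norm \<xi> powr (d / q)} :: real \<Rightarrow> ennreal"
    let ?p = "\<lambda>l. ennreal ((q - 2) * l powr ((q - 2) - 1))"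
    let ?c = "4 * q / (q - 2)"
    let ?w = "\<lambda>l. ennreal (q * l powr (q - 1)) * indicator {0..} l"
    let ?E = "\<lambda>l. emeasure lborel {x. l \<le> cmod (u x)}"
    have L: "L > 0" using \<kappa> H c0 by (simp add: L_def)
    have level: "?E l
        \<le> ennreal (4 / l\<^sup>2) * (\<integral>\<^sup>+\<xi>. ?g \<xi> * ?i \<xi> l \<partial>lborel)"
      if l: "l > 0" for l
    proof -
      define N where "N = (l / L) powr (q / d)"
      have N: "N > 0" using l L by (simp add: N_def)
      have LN: "L * N powr (d / q) = l"
        using l L d q by (simp add: N_def powr_powr)
      have "sqrt (\<kappa> * N powr (2 * (d / q)) * H) = sqrt (\<kappa> * H) * N powr (d / q)"
      proof -
        have "N powr (2 * (d / q)) = (N powr (d / q))\<^sup>2"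
          by (simp add: power2_eq_square powr_add[symmetric])
        then show ?thesis
          by (simp add: real_sqrt_mult mult_ac)
      qed
      then have A: "low_frequency_integral N g \<le> ennreal (sqrt (\<kappa> * H) * N powr (d / q))"
        using nn_integral_ball_le_weighted[OF _ W _ \<kappa>_le[OF N]] H \<kappa> by simp
      have "?E l
          \<le> ennreal (4 / l\<^sup>2) * (\<integral>\<^sup>+\<xi>. ?g \<xi> * indicator (- ball 0 N) \<xi> \<partial>lborel)"
      proof (rule emeasure_superlevel_le[OF ug l A])
        show "0 \<le> sqrt (\<kappa> * H) * N powr (d / q)" using \<kappa> H by simp
        show "2 * (sqrt (\<kappa> * H) * N powr (d / q)) / (2 * pi) powr (real CARD('n) / 2) \<le> l"
          using LN by (simp add: L_def c0_def d_def mult_ac)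
      qed
      \<comment> \<open>The condition that the frequency has norm at least \<open>N\<close> becomes
        an upper bound on \<open>l\<close> for a fixed frequency, which prepares the integration
        over \<open>l\<close> first.\<close>
      also have "\<dots> \<le> ennreal (4 / l\<^sup>2) * (\<integral>\<^sup>+\<xi>. ?g \<xi> * ?i \<xi> l \<partial>lborel)"
      proof (intro mult_left_mono nn_integral_mono)
        fix \<xi> :: "real^'n"
        show "indicator (- ball 0 N) \<xi> \<le> ?i \<xi> l"
        proof (cases "\<xi> \<in> ball 0 N")
          case False
          then have "N \<le> norm \<xi>" by simp
          then have "L * N powr (d / q) \<le> L * norm \<xi> powr (d / q)"
            using N L d q by (intro mult_left_mono powr_mono2) auto
          then show ?thesis using LN l by (simp add: indicator_def)
        qed simp
      qed auto
      finally show ?thesis .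
    qed
    have "nn_Lp_power q u
        = (\<integral>\<^sup>+l. ?w l * ?E l \<partial>lborel)"
      using q by (intro nn_integral_powr_layer_cake) auto
    also have "\<dots> \<le> (\<integral>\<^sup>+l. \<integral>\<^sup>+\<xi>. ennreal (?c) * ?g \<xi>
        * (?p l * ?i \<xi> l) \<partial>lborel \<partial>lborel)"
    proof (rule nn_integral_mono)
      fix l :: real
      show "?w l * ?E l
        \<le> (\<integral>\<^sup>+\<xi>. ennreal (?c) * ?g \<xi>
        * (?p l * ?i \<xi> l) \<partial>lborel)"
      proof (cases "l > 0")
        case True
        \<comment> \<open>The factor 4/l^2 lowers the exponent of l to q - 3, which is still
          integrable at 0 because q > 2.\<close>
        have e: "q * l powr (q - 1) * (4 / l\<^sup>2) = ?c * ((q - 2) * l powr ((q - 2) - 1))"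
        proof -
          have "l powr (q - 1) = l powr ((q - 2) - 1) * l\<^sup>2"
          proof -
            have "l\<^sup>2 = l powr 2" using True by simp
            then have "l powr ((q - 2) - 1) * l\<^sup>2 = l powr (((q - 2) - 1) + 2)"
              by (simp only: powr_add)
            then show ?thesis by simp
          qed
          then show ?thesis using True q by simp
        qed
        have "?w l * ?E l
            \<le> ennreal (q * l powr (q - 1)) * (ennreal (4 / l\<^sup>2)
              * (\<integral>\<^sup>+\<xi>. ?g \<xi> * ?i \<xi> l \<partial>lborel))"
          using True by (simp add: mult_left_mono level)
        also have "\<dots> = ennreal (q * l powr (q - 1) * (4 / l\<^sup>2))
              * (\<integral>\<^sup>+\<xi>. ?g \<xi> * ?i \<xi> l \<partial>lborel)"
        proof -
          have "ennreal (q * l powr (q - 1) * (4 / l\<^sup>2)) = ennreal (q * l powr (q - 1)) * ennreal (4 / l\<^sup>2)"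
            by (rule ennreal_mult'') simp
          then show ?thesis by (simp only: mult.assoc)
        qed
        also have "\<dots> = (\<integral>\<^sup>+\<xi>. ennreal (q * l powr (q - 1) * (4 / l\<^sup>2))
              * (?g \<xi> * ?i \<xi> l) \<partial>lborel)"
        proof (rule nn_integral_cmult[symmetric])
          have "(\<lambda>\<xi>. ?g \<xi> * (if 0 \<le> l \<and> l \<le> L * norm \<xi> powr (d / q) then 1 else 0)) \<in> borel_measurable lborel"
            by measurable
          then show "(\<lambda>\<xi>. ?g \<xi> * ?i \<xi> l) \<in> borel_measurable lborel"
            by (simp add: indicator_def of_bool_def)
        qed
        also have "\<dots> = (\<integral>\<^sup>+\<xi>. ennreal (?c) * ?g \<xi>
            * (?p l * ?i \<xi> l) \<partial>lborel)"
        proof (rule nn_integral_cong)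
          fix \<xi> :: "real^'n"
          have "ennreal (q * l powr (q - 1) * (4 / l\<^sup>2)) = ennreal (?c) * ?p l"
            unfolding e using q by (intro ennreal_mult') auto
          then show "ennreal (q * l powr (q - 1) * (4 / l\<^sup>2)) * (?g \<xi> * ?i \<xi> l)
            = ennreal (?c) * ?g \<xi>
            * (?p l * ?i \<xi> l)"
            by (simp only: mult_ac)
        qed
        finally show ?thesis .
      next
        case False
        then have "?w l = 0"
          by (cases "l = 0") auto
        then show ?thesis by (simp only: mult_zero_left zero_le)
      qed
    qed
    also have "\<dots> = (\<integral>\<^sup>+\<xi>. \<integral>\<^sup>+l. ennreal (?c) * ?g \<xi>
        * (?p l * ?i \<xi> l) \<partial>lborel \<partial>lborel)"
    proof (rule lborel_pair.Fubini')
      have "(\<lambda>(\<xi>, l). ennreal (?c) * ?g \<xi>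
        * (?p l * (if 0 \<le> l \<and> l \<le> L * norm \<xi> powr (d / q) then 1 else 0)))
        \<in> borel_measurable (lborel \<Otimes>\<^sub>M lborel)"
        by measurable
      then show "(\<lambda>(\<xi>, l). ennreal (?c) * ?g \<xi>
        * (?p l * ?i \<xi> l))
        \<in> borel_measurable (lborel \<Otimes>\<^sub>M lborel)"
        by (simp add: indicator_def of_bool_def)
    qed
    also have "\<dots> = (\<integral>\<^sup>+\<xi>. ennreal (?c) * ?g \<xi> * ennreal ((L * norm \<xi> powr (d / q)) powr (q - 2)) \<partial>lborel)"
    proof (rule nn_integral_cong)
      fix \<xi> :: "real^'n"
      show "(\<integral>\<^sup>+l. ennreal (?c) * ?g \<xi>
        * (?p l * ?i \<xi> l) \<partial>lborel)
        = ennreal (?c) * ?g \<xi> * ennreal ((L * norm \<xi> powr (d / q)) powr (q - 2))"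
        by (subst nn_integral_cmult, measurable, subst nn_integral_powr_from_0) (use q L in auto)
    qed
    also have "\<dots> = (\<integral>\<^sup>+\<xi>. ennreal (?c * L powr (q - 2)) * (ennreal (norm \<xi> powr (2 * s)) * ?g \<xi>) \<partial>lborel)"
    proof (rule nn_integral_cong)
      fix \<xi> :: "real^'n"
      \<comment> \<open>Thus integration over \<open>l\<close> produces exactly the weight of the
        hypothesis.\<close>
      have "(d / q) * (q - 2) = 2 * s"
        using q by (simp add: s_def field_simps)
      then have "(L * norm \<xi> powr (d / q)) powr (q - 2) = L powr (q - 2) * norm \<xi> powr (2 * s)"
        using L by (simp add: powr_mult powr_powr)
      then show "ennreal (?c) * ?g \<xi> * ennreal ((L * norm \<xi> powr (d / q)) powr (q - 2))
        = ennreal (?c * L powr (q - 2)) * (ennreal (norm \<xi> powr (2 * s)) * ?g \<xi>)"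
        using q by (simp only: ennreal_mult'[OF powr_ge_zero] ennreal_mult''[OF powr_ge_zero] mult_ac)
    qed
    also have "\<dots> = ennreal (?c * L powr (q - 2)) * nn_weighted (2 * s) g"
      by (rule nn_integral_cmult) measurable
    also have "\<dots> \<le> ennreal (?c * L powr (q - 2)) * ennreal H"
      by (intro mult_left_mono W) auto
    also have "\<dots> = ennreal (?c * L powr (q - 2) * H)"
      using q H by (intro ennreal_mult''[symmetric]) auto
    also have "?c * L powr (q - 2) * H = K * H powr (q / 2)"
    proof -
      have "L = 2 * sqrt \<kappa> / c0 * H powr (1/2)"
        using H by (simp add: L_def real_sqrt_mult powr_half_sqrt)
      moreover have "(2 * sqrt \<kappa> / c0 * H powr (1/2)) powr (q - 2)
          = (2 * sqrt \<kappa> / c0) powr (q - 2) * (H powr (1/2)) powr (q - 2)"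
        by (rule powr_mult)
      ultimately have "L powr (q - 2) = (2 * sqrt \<kappa> / c0) powr (q - 2) * H powr ((q - 2) / 2)"
        by (simp only: powr_powr) simp
      moreover have "H powr ((q - 2) / 2) * H = H powr (q / 2)"
        using H powr_add[of H "(q - 2) / 2" 1] by (simp add: diff_divide_distrib)
      ultimately show ?thesis
        by (simp add: K_def mult.assoc)
    qed
    finally show ?thesis .
  qed
  moreover have "real CARD('n) - 2 * real CARD('n) / q = 2 * s"
    by (simp add: s_def d_def)
  ultimately show ?thesis
    using K by (intro exI[of _ K]) auto
qed

section \<open>Test functions and weak gradients\<close>

definition pdv :: "'n \<Rightarrow> (real^'n \<Rightarrow> real) \<Rightarrow> real^'n \<Rightarrow> real" where
  "pdv i f x = frechet_derivative f (at x) (axis i 1)"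

lemma C_k_Suc_pdv: "C_k (Suc k) f \<longleftrightarrow> f differentiable_on UNIV \<and> (\<forall>i. C_k k (pdv i f))"
  by (simp add: pdv_def[abs_def])

lemma pdv_eqI: "(f has_derivative f') (at x) \<Longrightarrow> pdv i f x = f' (axis i 1)"
  using frechet_derivative_at[of f f' x] by (simp add: pdv_def)

lemma differentiable_on_has_derivative:
  "f differentiable_on UNIV \<Longrightarrow> (f has_derivative frechet_derivative f (at x)) (at x)"
  by (simp add: differentiable_on_def frechet_derivative_works[symmetric])

lemma C_k_SucD: "C_k (Suc k) f \<Longrightarrow> C_k k f"
proof (induction k arbitrary: f)
  case 0
  then show ?case by (simp add: C_k_Suc_pdv differentiable_imp_continuous_on)
next
  case (Suc k)
  then show ?case using C_k_Suc_pdv by blast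
qed

lemma C_k_const: "C_k k (\<lambda>x::real^'n. c)"
proof (induction k arbitrary: c)
  case (Suc k)
  have "pdv i (\<lambda>x::real^'n. c) = (\<lambda>x. 0)" for i
    by (rule ext) (simp add: pdv_eqI[OF has_derivative_const])
  then show ?case using Suc by (simp add: C_k_Suc_pdv del: C_k.simps)
qed simp

lemma C_k_add: "C_k k f \<Longrightarrow> C_k k g \<Longrightarrow> C_k k (\<lambda>x. f x + g x)"
proof (induction k arbitrary: f g)
  case 0
  then show ?case by (simp add: continuous_on_add)
next
  case (Suc k)
  then have d: "f differentiable_on UNIV" "g differentiable_on UNIV"
    by (auto simp: C_k_Suc_pdv simp del: C_k.simps)
  have "pdv i (\<lambda>x. f x + g x) = (\<lambda>x. pdv i f x + pdv i g x)" for i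
    by (rule ext, subst pdv_eqI[OF has_derivative_add[OF d[THEN differentiable_on_has_derivative]]])
      (simp add: pdv_def)
  then show ?case using Suc d by (simp add: C_k_Suc_pdv del: C_k.simps)
qed

lemma pdv_mult:
  assumes "f differentiable_on UNIV" "g differentiable_on UNIV"
  shows "pdv i (\<lambda>x. f x * g x) x = pdv i f x * g x + f x * pdv i g x"
  by (subst pdv_eqI[OF has_derivative_mult[OF assms[THEN differentiable_on_has_derivative]]])
    (simp add: pdv_def)

lemma C_k_mult: "C_k k f \<Longrightarrow> C_k k g \<Longrightarrow> C_k k (\<lambda>x. f x * g x)"
proof (induction k arbitrary: f g)
  case 0
  then show ?case by (simp add: continuous_on_mult)
next
  case (Suc k)
  then have d: "f differentiable_on UNIV" "g differentiable_on UNIV"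
    by (auto simp: C_k_Suc_pdv simp del: C_k.simps)
  have "pdv i (\<lambda>x. f x * g x) = (\<lambda>x. pdv i f x * g x + f x * pdv i g x)" for i
    by (rule ext, rule pdv_mult[OF d])
  moreover have "C_k k (\<lambda>x. pdv i f x * g x + f x * pdv i g x)" for i
    using Suc.prems C_k_SucD[of k f] C_k_SucD[of k g] unfolding C_k_Suc_pdv
    by (intro C_k_add Suc.IH) (auto simp: C_k_Suc_pdv simp del: C_k.simps)
  ultimately show ?case using d by (simp add: C_k_Suc_pdv differentiable_on_mult del: C_k.simps)
qed

lemma C_k_coord: "C_k k (\<lambda>x. x $ j)"
proof (cases k)
  case (Suc k')
  have "pdv i (\<lambda>x. x $ j) = (\<lambda>x. axis i 1 $ j)" for i
    by (rule ext) (rule pdv_eqI[OF bounded_linear_imp_has_derivative[OF bounded_linear_vec_nth]])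
  moreover have "(\<lambda>x. x $ j) differentiable_on UNIV"
    using bounded_linear_imp_has_derivative[OF bounded_linear_vec_nth]
    by (auto simp: differentiable_on_def differentiable_def)
  ultimately show ?thesis using Suc by (simp add: C_k_Suc_pdv C_k_const del: C_k.simps)
qed (simp add: continuous_intros)

lemma C_k_sum: "(\<And>i. i \<in> A \<Longrightarrow> C_k k (f i)) \<Longrightarrow> C_k k (\<lambda>x. \<Sum>i\<in>A. f i x)"
  by (induction A rule: infinite_finite_induct) (auto simp: C_k_const C_k_add)

lemma pdv_compose:
  assumes D: "\<And>t. (h has_real_derivative h' t) (at t)" and g: "g differentiable_on UNIV"
  shows "pdv i (\<lambda>x. h (g x)) x = h' (g x) * pdv i g x"
proof -
  have "((\<lambda>x. h (g x)) has_derivative (\<lambda>y. h' (g x) * frechet_derivative g (at x) y)) (at x)"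
    using has_derivative_compose[OF differentiable_on_has_derivative[OF g, of x] D[of "g x", unfolded has_field_derivative_def]] .
  then show ?thesis by (subst pdv_eqI) (auto simp: pdv_def)
qed

text \<open>The outer function comes with the sequence \<open>D\<close> of all its derivatives. The
  chain rule moves from \<open>D n\<close> to \<open>D (Suc n)\<close>, so the induction on k has to
  cover every n at once.\<close>

lemma C_k_compose:
  fixes D :: "nat \<Rightarrow> real \<Rightarrow> real"
  assumes D: "\<And>n t. (D n has_real_derivative D (Suc n) t) (at t)" and g: "\<And>k. C_k k g"
  shows "C_k k (\<lambda>x. D n (g x))"
proof (induction k arbitrary: n)
  case 0
  have "continuous_on UNIV (D n)"
    by (rule DERIV_continuous_on) (use D in \<open>auto intro: has_field_derivative_at_within\<close>)
  then show ?case using g[of 0] by (auto intro: continuous_on_compose2)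
next
  case (Suc k)
  have d: "g differentiable_on UNIV" using g[of 1] by simp
  have "pdv i (\<lambda>x. D n (g x)) = (\<lambda>x. D (Suc n) (g x) * pdv i g x)" for i
    by (rule ext, rule pdv_compose[OF D d])
  moreover have "C_k k (\<lambda>x. D (Suc n) (g x) * pdv i g x)" for i
    using g[of "Suc k"] by (intro C_k_mult Suc) (simp add: C_k_Suc_pdv del: C_k.simps)
  moreover have "(\<lambda>x. D n (g x)) differentiable_on UNIV"
    unfolding differentiable_on_def differentiable_def
    using has_derivative_compose[OF differentiable_on_has_derivative[OF d] D[unfolded has_field_derivative_def]] by blast
  ultimately show ?case by (simp add: C_k_Suc_pdv del: C_k.simps)
qed

lemma pdv_scaleR:
  assumes "f differentiable_on UNIV"
  shows "pdv i (\<lambda>x. f (c *\<^sub>R x)) x = c * pdv i f (c *\<^sub>R x)"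
proof -
  have "((\<lambda>x. f (c *\<^sub>R x)) has_derivative (\<lambda>y. frechet_derivative f (at (c *\<^sub>R x)) (c *\<^sub>R y))) (at x)"
    by (rule has_derivative_compose[OF has_derivative_scaleR_right[OF has_derivative_ident] differentiable_on_has_derivative[OF assms]])
  moreover have "linear (frechet_derivative f (at (c *\<^sub>R x)))"
    using assms by (intro linear_frechet_derivative) (simp add: differentiable_on_def)
  ultimately show ?thesis
    by (subst pdv_eqI) (auto simp: pdv_def linear_scale)
qed

lemma C_k_scaleR: "C_k k f \<Longrightarrow> C_k k (\<lambda>x. f (c *\<^sub>R x))"
proof (induction k arbitrary: f)
  case 0
  then show ?case by (auto intro!: continuous_on_compose2[of UNIV f] continuous_intros)
next
  case (Suc k)
  then have d: "f differentiable_on UNIV"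
    by (auto simp: C_k_Suc_pdv simp del: C_k.simps)
  have "pdv i (\<lambda>x. f (c *\<^sub>R x)) = (\<lambda>x. c * pdv i f (c *\<^sub>R x))" for i
    by (rule ext, rule pdv_scaleR[OF d])
  moreover have "C_k k (\<lambda>x. c * pdv i f (c *\<^sub>R x))" for i
    using Suc by (intro C_k_mult C_k_const Suc.IH) (auto simp: C_k_Suc_pdv simp del: C_k.simps)
  moreover have "(\<lambda>x. f (c *\<^sub>R x)) differentiable_on UNIV"
    unfolding differentiable_on_def differentiable_def
    using has_derivative_compose[OF has_derivative_scaleR_right[OF has_derivative_ident] differentiable_on_has_derivative[OF d]] by blast
  ultimately show ?case by (simp add: C_k_Suc_pdv del: C_k.simps)
qed

section \<open>Smooth functions of compact support\<close>

definition flat_exp :: "real poly \<Rightarrow> real \<Rightarrow> real" where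
  "flat_exp P t = (if t > 0 then poly P (1 / t) * exp (- (1 / t)) else 0)"

lemma tendsto_poly_mult_exp_neg: "((\<lambda>s::real. poly P s * exp (- s)) \<longlongrightarrow> 0) at_top"
proof -
  have "((\<lambda>s::real. \<Sum>i\<le>degree P. coeff P i * (s ^ i / exp s)) \<longlongrightarrow> (\<Sum>i\<le>degree P. coeff P i * 0)) at_top"
    by (intro tendsto_sum tendsto_mult tendsto_const tendsto_power_div_exp_0)
  then show ?thesis
    by (simp add: poly_altdef sum_distrib_right exp_minus divide_inverse mult.assoc)
qed

text \<open>The family is closed under differentiation: for t > 0 the chain rule gives (P - P')(1/t)
  exp(-1/t) / t^2, and \<open>[:0, 0, 1:]\<close> supplies the square of 1/t. At 0 the right-hand
  difference quotient is again a polynomial in 1/t times exp(-1/t), hence tends to 0.\<close>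

lemma flat_exp_has_derivative:
  "(flat_exp P has_real_derivative flat_exp ([:0, 0, 1:] * (P - pderiv P)) t) (at t)"
proof -
  consider "t > 0" | "t < 0" | "t = 0" by linarith
  then show ?thesis
  proof cases
    case 1
    have "((\<lambda>t. poly P (1 / t) * exp (- (1 / t))) has_real_derivative
        flat_exp ([:0, 0, 1:] * (P - pderiv P)) t) (at t)"
      using 1 by (auto intro!: derivative_eq_intros DERIV_chain2[OF poly_DERIV]
          simp: flat_exp_def power2_eq_square divide_simps) (simp add: algebra_simps)
    then show ?thesis
      by (rule has_field_derivative_transform_within_open[of _ _ _ "{0<..}"]) (use 1 in \<open>auto simp: flat_exp_def\<close>)
  next
    case 2
    have "((\<lambda>t. 0) has_real_derivative flat_exp ([:0, 0, 1:] * (P - pderiv P)) t) (at t)"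
      using 2 by (simp add: flat_exp_def)
    then show ?thesis
      by (rule has_field_derivative_transform_within_open[of _ _ _ "{..<0}"]) (use 2 in \<open>auto simp: flat_exp_def\<close>)
  next
    case 3
    have "((\<lambda>h. flat_exp P h / h) \<longlongrightarrow> 0) (at_left 0)"
    proof (rule tendsto_eventually)
      show "\<forall>\<^sub>F h in at_left 0. flat_exp P h / h = 0"
        by (auto simp: eventually_at_left_field flat_exp_def intro!: exI[of _ "-1"])
    qed
    moreover have "((\<lambda>h. flat_exp P h / h) \<longlongrightarrow> 0) (at_right 0)"
    proof -
      have "((\<lambda>h::real. poly ([:0, 1:] * P) (inverse h) * exp (- inverse h)) \<longlongrightarrow> 0) (at_right 0)"
        by (rule filterlim_compose[OF tendsto_poly_mult_exp_neg filterlim_inverse_at_top_right])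
      moreover have "\<forall>\<^sub>F h in at_right 0. poly ([:0, 1:] * P) (inverse h) * exp (- inverse h) = flat_exp P h / h"
        by (auto simp: eventually_at_right_field flat_exp_def inverse_eq_divide intro!: exI[of _ 1])
      ultimately show ?thesis
        by (rule Lim_transform_eventually)
    qed
    ultimately have "((\<lambda>h. flat_exp P h / h) \<longlongrightarrow> 0) (at 0)"
      by (rule filterlim_split_at)
    then show ?thesis
      using 3 by (simp add: has_field_derivative_iff flat_exp_def)
  qed
qed

text \<open>The standard bump exp(-1/(1 - |x|^2)) on the unit ball. Its value at the origin is
  exp(-1), not 1.\<close>

definition cutoff :: "real^'n \<Rightarrow> real" where
  "cutoff x = flat_exp 1 (1 - (norm x)\<^sup>2)"

lemma C_k_cutoff: "C_k k (cutoff :: real^'n \<Rightarrow> real)"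
proof -
  define D where "D n = flat_exp (((\<lambda>P. [:0, 0, 1:] * (P - pderiv P)) ^^ n) 1)" for n
  have D: "(D n has_real_derivative D (Suc n) t) (at t)" for n t
    unfolding D_def using flat_exp_has_derivative by simp
  have "C_k k (\<lambda>x::real^'n. 1 + (- 1) * (\<Sum>i\<in>UNIV. x $ i * x $ i))" for k
    by (intro C_k_add C_k_const C_k_mult C_k_sum C_k_coord)
  moreover have "1 + (- 1) * (\<Sum>i\<in>UNIV. x $ i * x $ i) = 1 - (norm x)\<^sup>2" for x :: "real^'n"
    by (simp add: norm_vec_def L2_set_def sum_nonneg power2_eq_square)
  ultimately have g: "C_k k (\<lambda>x::real^'n. 1 - (norm x)\<^sup>2)" for k
    by simp
  have "C_k k (\<lambda>x::real^'n. D 0 (1 - (norm x)\<^sup>2))"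
    by (rule C_k_compose[where D=D and g="\<lambda>x. 1 - (norm x)\<^sup>2", OF D g])
  then show ?thesis by (simp add: D_def cutoff_def[abs_def])
qed

lemma cutoff_nonneg: "0 \<le> cutoff x"
  and cutoff_le_1: "cutoff x \<le> 1"
  and cutoff_eq_0: "x \<notin> ball 0 1 \<Longrightarrow> cutoff x = 0"
  and cutoff_pos: "x \<in> ball 0 1 \<Longrightarrow> cutoff x > 0"
  by (auto simp: cutoff_def flat_exp_def power_le_one_iff abs_square_less_1 power2_less_1_iff)

text \<open>Differentiating cosine adds pi/2 to its phase, so a single family of shifted cosines
  contains all derivatives of both functions; sine starts at phase -pi/2.\<close>

lemma C_k_trig:
  shows C_k_cos: "C_k k (\<lambda>x::real^'n. cos (\<xi> \<bullet> x))" and C_k_sin: "C_k k (\<lambda>x::real^'n. sin (\<xi> \<bullet> x))"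
proof -
  define D :: "real \<Rightarrow> nat \<Rightarrow> real \<Rightarrow> real" where "D c n t = cos (t + c + real n * (pi / 2))" for c n t
  have D: "(D c n has_real_derivative D c (Suc n) t) (at t)" for c n t
  proof -
    have "D c (Suc n) t = - sin (t + c + real n * (pi / 2))"
    proof -
      have "t + c + real (Suc n) * (pi / 2) = (t + c + real n * (pi / 2)) + pi / 2"
        by (simp add: distrib_right)
      then show ?thesis
        by (simp only: D_def cos_add cos_pi_half sin_pi_half mult_zero_right mult_1_right diff_0)
    qed
    moreover have "(D c n has_real_derivative - sin (t + c + real n * (pi / 2))) (at t)"
      unfolding D_def by (auto intro!: derivative_eq_intros)
    ultimately show ?thesis by simp
  qed
  have "C_k k (\<lambda>x::real^'n. \<Sum>i\<in>UNIV. \<xi> $ i * x $ i)" for k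
    by (intro C_k_sum C_k_mult C_k_const C_k_coord)
  then have g: "C_k k (\<lambda>x::real^'n. \<xi> \<bullet> x)" for k
    by (simp add: inner_vec_def)
  show "C_k k (\<lambda>x::real^'n. cos (\<xi> \<bullet> x))"
    using C_k_compose[where D="D 0" and g="\<lambda>x. \<xi> \<bullet> x" and k=k and n=0, OF D g] by (simp add: D_def)
  show "C_k k (\<lambda>x::real^'n. sin (\<xi> \<bullet> x))"
    using C_k_compose[where D="D (- (pi / 2))" and g="\<lambda>x. \<xi> \<bullet> x" and k=k and n=0, OF D g] by (simp add: D_def cos_diff)
qed

lemma test_functions_mult:
  assumes "\<psi> \<in> test_functions" "\<And>k. C_k k f"
  shows "(\<lambda>x. \<psi> x * f x) \<in> test_functions"
proof -
  have "bounded {x. \<psi> x \<noteq> 0}"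
    using assms(1) by (auto simp: test_functions_def intro: bounded_subset[OF compact_imp_bounded closure_subset])
  then have "bounded {x. \<psi> x * f x \<noteq> 0}"
    by (rule bounded_subset) auto
  then show ?thesis
    using assms by (simp add: test_functions_def C_k_mult compact_closure)
qed

lemma test_functions_scaleR:
  assumes "\<phi> \<in> test_functions" "c \<noteq> 0"
  shows "(\<lambda>x. \<phi> (c *\<^sub>R x)) \<in> test_functions"
proof -
  have b: "bounded {x. \<phi> x \<noteq> 0}"
    using assms(1) by (auto simp: test_functions_def intro: bounded_subset[OF compact_imp_bounded closure_subset])
  have "{x. \<phi> (c *\<^sub>R x) \<noteq> 0} \<subseteq> (\<lambda>x. (1 / c) *\<^sub>R x) ` {x. \<phi> x \<noteq> 0}"
    using assms(2) by (auto intro!: image_eqI[of _ _ "c *\<^sub>R _"])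
  then have "bounded {x. \<phi> (c *\<^sub>R x) \<noteq> 0}"
    by (rule bounded_subset[OF bounded_scaling[OF b]])
  then show ?thesis
    using assms(1) by (auto simp: test_functions_def C_k_scaleR compact_closure)
qed

lemma cutoff_in_test_functions: "(cutoff :: real^'n \<Rightarrow> real) \<in> test_functions"
proof -
  have "{x. cutoff x \<noteq> 0} \<subseteq> ball (0::real^'n) 1"
    using cutoff_eq_0 by blast
  then have "bounded {x::real^'n. cutoff x \<noteq> 0}"
    by (rule bounded_subset[OF bounded_ball])
  then show ?thesis
    by (simp add: test_functions_def C_k_cutoff compact_closure)
qed

lemma test_function_bounds:
  fixes \<phi> :: "real^'n \<Rightarrow> real"
  assumes \<phi>: "\<phi> \<in> test_functions"
  obtains M R where "R > 0" "\<And>x. \<bar>\<phi> x\<bar> \<le> M" "\<And>x. \<bar>pdv i \<phi> x\<bar> \<le> M"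
    "\<And>x. x \<notin> cball 0 R \<Longrightarrow> \<phi> x = 0" "\<And>x. x \<notin> cball 0 R \<Longrightarrow> pdv i \<phi> x = 0"
    "continuous_on UNIV \<phi>" "continuous_on UNIV (pdv i \<phi>)" "\<phi> differentiable_on UNIV"
proof -
  have C: "C_k k \<phi>" for k using \<phi> by (simp add: test_functions_def)
  have c0: "continuous_on UNIV \<phi>" using C[of 0] by simp
  have d: "\<phi> differentiable_on UNIV" using C[of 1] by simp
  have c1: "continuous_on UNIV (pdv i \<phi>)"
    using C[of "Suc 0"] unfolding C_k_Suc_pdv by simp
  have K: "compact (closure {x. \<phi> x \<noteq> 0})" using \<phi> by (simp add: test_functions_def)
  then obtain R where R: "R > 0" "closure {x. \<phi> x \<noteq> 0} \<subseteq> cball 0 R"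
    using compact_imp_bounded[OF K] unfolding bounded_pos by (auto simp: subset_eq)
  have z0: "\<phi> x = 0" if "x \<notin> cball 0 R" for x
    using that R(2) closure_subset[of "{x. \<phi> x \<noteq> 0}"] by blast
  have z1: "pdv i \<phi> x = 0" if "x \<notin> cball 0 R" for x
  proof -
    have "(\<phi> has_derivative (\<lambda>_. 0)) (at x)"
      by (rule has_derivative_transform_within_open[OF has_derivative_const, of "- cball 0 R"])
        (use that z0 in auto)
    then show ?thesis by (rule pdv_eqI)
  qed
  have "bounded (\<phi> ` cball 0 R)"
    by (intro compact_imp_bounded compact_continuous_image compact_cball continuous_on_subset[OF c0]) simp
  then obtain M0 where M0: "\<And>x. x \<in> cball 0 R \<Longrightarrow> \<bar>\<phi> x\<bar> \<le> M0"
    unfolding bounded_iff by (metis imageI real_norm_def)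
  have "bounded ((pdv i \<phi>) ` cball 0 R)"
    by (intro compact_imp_bounded compact_continuous_image compact_cball continuous_on_subset[OF c1]) simp
  then obtain M1 where M1: "\<And>x. x \<in> cball 0 R \<Longrightarrow> \<bar>pdv i \<phi> x\<bar> \<le> M1"
    unfolding bounded_iff by (metis imageI real_norm_def)
  have "\<bar>\<phi> x\<bar> \<le> max (max M0 M1) 0" "\<bar>pdv i \<phi> x\<bar> \<le> max (max M0 M1) 0" for x
    using M0[of x] M1[of x] z0[of x] z1[of x] by (cases "x \<in> cball 0 R"; simp)+
  then show thesis
    using that R(1) z0 z1 c0 c1 d by blast
qed

section \<open>Square-integrable functions multiplied by test functions\<close>

lemma Lp_2_nth:
  fixes G :: "real^'n \<Rightarrow> complex^'n"
  assumes "G \<in> Lp 2"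
  shows "(\<lambda>x. G x $ i) \<in> Lp 2"
proof -
  have [measurable]: "G \<in> borel_measurable borel" and G2: "integrable lborel (\<lambda>x. (norm (G x))\<^sup>2)"
    using assms by (auto simp: Lp_2_iff)
  have m: "(\<lambda>x. G x $ i) \<in> borel_measurable borel"
    by (rule borel_measurable_continuous_on[OF linear_continuous_on[OF bounded_linear_vec_nth]]) measurable
  have "integrable lborel (\<lambda>x. (cmod (G x $ i))\<^sup>2)"
    by (rule Bochner_Integration.integrable_bound[OF G2])
      (use m in \<open>auto intro!: power_mono Finite_Cartesian_Product.norm_nth_le\<close>)
  then show ?thesis using m by (simp add: Lp_2_iff)
qed

lemma
  fixes u :: "real^'n \<Rightarrow> complex" and b :: "real^'n \<Rightarrow> real"
  assumes u: "u \<in> Lp 2" and b [measurable]: "b \<in> borel_measurable borel"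
    and M: "\<And>x. \<bar>b x\<bar> \<le> M" and supp: "\<And>x. x \<notin> cball 0 R \<Longrightarrow> b x = 0"
  shows integrable_bounded_support_scaleR: "integrable lborel (\<lambda>x. b x *\<^sub>R u x)"
    and Lp_2_bounded_support_scaleR: "(\<lambda>x. b x *\<^sub>R u x) \<in> Lp 2"
proof -
  have [measurable]: "u \<in> borel_measurable borel"
    using u by (auto simp: Lp_2_iff)
  have le: "\<bar>b x\<bar> * cmod (u x) \<le> M * cmod (indicator (cball 0 R) x *\<^sub>R u x)" for x
    using M[of x] supp[of x] by (cases "x \<in> cball 0 R") (auto intro: mult_right_mono)
  have M0: "0 \<le> M" using M[of 0] by linarith
  show "integrable lborel (\<lambda>x. b x *\<^sub>R u x)"
    by (rule Bochner_Integration.integrable_bound[OF integrable_mult_right[OF integrable_norm[OF integrable_truncation(1)[OF u, of R]], of M]])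
      (use le M0 in \<open>auto simp: abs_mult\<close>)
  have "integrable lborel (\<lambda>x. (cmod (b x *\<^sub>R u x))\<^sup>2)"
  proof (rule Bochner_Integration.integrable_bound[OF integrable_mult_right[OF integrable_truncation(2)[OF u, of R], of "M\<^sup>2"]])
    show "AE x in lborel. norm ((cmod (b x *\<^sub>R u x))\<^sup>2) \<le> norm (M\<^sup>2 * (cmod (indicator (cball 0 R) x *\<^sub>R u x))\<^sup>2)"
    proof (rule AE_I2)
      fix x
      have "(\<bar>b x\<bar> * cmod (u x))\<^sup>2 \<le> (M * cmod (indicator (cball 0 R) x *\<^sub>R u x))\<^sup>2"
        by (intro power_mono le) auto
      then show "norm ((cmod (b x *\<^sub>R u x))\<^sup>2) \<le> norm (M\<^sup>2 * (cmod (indicator (cball 0 R) x *\<^sub>R u x))\<^sup>2)"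
        by (simp add: power_mult_distrib)
    qed
  qed measurable
  then show "(\<lambda>x. b x *\<^sub>R u x) \<in> Lp 2"
    by (simp add: Lp_2_iff)
qed

lemma
  fixes u :: "real^'n \<Rightarrow> complex"
  assumes \<phi>: "\<phi> \<in> test_functions" and u: "u \<in> Lp 2"
  shows integrable_test_function_scaleR: "integrable lborel (\<lambda>x. \<phi> x *\<^sub>R u x)"
    and integrable_pdv_test_function_scaleR: "integrable lborel (\<lambda>x. pdv i \<phi> x *\<^sub>R u x)"
    and Lp_2_test_function_scaleR: "(\<lambda>x. \<phi> x *\<^sub>R u x) \<in> Lp 2"
proof -
  obtain M R where b: "\<And>x. \<bar>\<phi> x\<bar> \<le> M" "\<And>x. \<bar>pdv i \<phi> x\<bar> \<le> M"
    "\<And>x. x \<notin> cball 0 R \<Longrightarrow> \<phi> x = 0" "\<And>x. x \<notin> cball 0 R \<Longrightarrow> pdv i \<phi> x = 0"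
    "continuous_on UNIV \<phi>" "continuous_on UNIV (pdv i \<phi>)"
    by (rule test_function_bounds[OF \<phi>, where i=i]) blast
  note m = borel_measurable_continuous_onI[OF b(5)] borel_measurable_continuous_onI[OF b(6)]
  show "integrable lborel (\<lambda>x. \<phi> x *\<^sub>R u x)"
    by (rule integrable_bounded_support_scaleR[OF u m(1) b(1,3)])
  show "integrable lborel (\<lambda>x. pdv i \<phi> x *\<^sub>R u x)"
    by (rule integrable_bounded_support_scaleR[OF u m(2) b(2,4)])
  show "(\<lambda>x. \<phi> x *\<^sub>R u x) \<in> Lp 2"
    by (rule Lp_2_bounded_support_scaleR[OF u m(1) b(1,3)])
qed

lemma test_function_support:
  assumes "(\<phi> :: real^'n \<Rightarrow> real) \<in> test_functions"
  obtains R where "\<And>x. x \<notin> cball 0 R \<Longrightarrow> \<phi> x = 0"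
  by (rule test_function_bounds[OF assms]) blast

lemma test_function_differentiable: "\<phi> \<in> test_functions \<Longrightarrow> \<phi> differentiable_on UNIV"
  using C_k_Suc_pdv by (auto simp: test_functions_def simp del: C_k.simps)

section \<open>Fourier transform and uniqueness of weak gradients\<close>

lemma pdv_inner: "pdv i (\<lambda>x. \<xi> \<bullet> x) x = \<xi> $ i"
  by (subst pdv_eqI[OF bounded_linear_imp_has_derivative[OF bounded_linear_inner_right]]) (simp add: inner_axis)

lemma has_weak_gradientD:
  "has_weak_gradient u G \<Longrightarrow> \<phi> \<in> test_functions \<Longrightarrow>
    (\<integral>x. pdv i \<phi> x *\<^sub>R u x \<partial>lborel) = - (\<integral>x. \<phi> x *\<^sub>R (G x $ i) \<partial>lborel)"
  by (simp add: has_weak_gradient_def pdv_def)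

text \<open>Test functions are real and compactly supported, so the character is split into cosine
  and sine and each is multiplied by \<psi>. Recombining the two weak derivative identities gives
  the usual symbol; the cutoff costs the term with \<open>pdv i \<psi>\<close>.\<close>

lemma has_weak_gradient_fourier:
  fixes u :: "real^'n \<Rightarrow> complex" and G :: "real^'n \<Rightarrow> complex^'n"
  assumes u: "u \<in> Lp 2" and G: "G \<in> Lp 2" and uG: "has_weak_gradient u G" and \<psi>: "\<psi> \<in> test_functions"
  shows "\<i> * of_real (\<xi> $ i) * fourier_integral (\<lambda>x. \<psi> x *\<^sub>R u x) \<xi>
    = fourier_integral (\<lambda>x. \<psi> x *\<^sub>R (G x $ i) + pdv i \<psi> x *\<^sub>R u x) \<xi>"
proof -
  have \<psi>d: "\<psi> differentiable_on UNIV"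
    using \<psi> by (rule test_function_differentiable)
  have Gi: "(\<lambda>x. G x $ i) \<in> Lp 2" by (rule Lp_2_nth[OF G])
  define w where "w x = cis (- (\<xi> \<bullet> x))" for x
  note wint = integrable_cis_mult(2)[of _ \<xi>, folded w_def]
  have i1: "integrable lborel (\<lambda>x. w x * (\<psi> x *\<^sub>R u x))"
    by (intro wint integrable_test_function_scaleR \<psi> u)
  have i2: "integrable lborel (\<lambda>x. w x * (pdv i \<psi> x *\<^sub>R u x))"
    by (intro wint integrable_pdv_test_function_scaleR \<psi> u)
  have i3: "integrable lborel (\<lambda>x. w x * (\<psi> x *\<^sub>R (G x $ i)))"
    by (intro wint integrable_test_function_scaleR \<psi> Gi)
  define fc where "fc x = \<psi> x * cos (\<xi> \<bullet> x)" for x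
  define fs where "fs x = \<psi> x * sin (\<xi> \<bullet> x)" for x
  have fc: "fc \<in> test_functions" and fs: "fs \<in> test_functions"
    unfolding fc_def fs_def by (intro test_functions_mult \<psi> C_k_cos C_k_sin)+
  have din: "(\<lambda>x. \<xi> \<bullet> x) differentiable_on UNIV"
    by (rule bounded_linear_imp_differentiable_on[OF bounded_linear_inner_right])
  have dcos: "(\<lambda>x. cos (\<xi> \<bullet> x)) differentiable_on UNIV" and dsin: "(\<lambda>x. sin (\<xi> \<bullet> x)) differentiable_on UNIV"
    using C_k_cos[of "Suc 0" \<xi>] C_k_sin[of "Suc 0" \<xi>] unfolding C_k_Suc_pdv by blast+
  have pc: "pdv i fc x = pdv i \<psi> x * cos (\<xi> \<bullet> x) - \<xi> $ i * \<psi> x * sin (\<xi> \<bullet> x)" for x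
    unfolding fc_def using pdv_compose[where h=cos and h'="\<lambda>t. - sin t", OF _ din, of i x]
    by (simp add: pdv_mult[OF \<psi>d dcos] pdv_inner DERIV_cos)
  have ps: "pdv i fs x = pdv i \<psi> x * sin (\<xi> \<bullet> x) + \<xi> $ i * \<psi> x * cos (\<xi> \<bullet> x)" for x
    unfolding fs_def using pdv_compose[where h=sin and h'=cos, OF _ din, of i x]
    by (simp add: pdv_mult[OF \<psi>d dsin] pdv_inner DERIV_sin)
  note ic = integrable_test_function_scaleR[OF fc Gi] integrable_pdv_test_function_scaleR[OF fc u]
  note isn = integrable_test_function_scaleR[OF fs Gi] integrable_pdv_test_function_scaleR[OF fs u]
  have lin: "(\<integral>x. A x - c * B x \<partial>lborel) = (\<integral>x. A x \<partial>lborel) - c * (\<integral>x. B x \<partial>lborel)"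
    if "integrable lborel A" "integrable lborel B" for A B :: "real^'n \<Rightarrow> complex" and c
    using that by simp
  have "(\<integral>x. pdv i fc x *\<^sub>R u x - \<i> * (pdv i fs x *\<^sub>R u x) \<partial>lborel)
      = - (\<integral>x. fc x *\<^sub>R (G x $ i) - \<i> * (fs x *\<^sub>R (G x $ i)) \<partial>lborel)"
    unfolding lin[OF ic(2) isn(2)] lin[OF ic(1) isn(1)] has_weak_gradientD[OF uG fc] has_weak_gradientD[OF uG fs]
    by simp
  moreover have "pdv i fc x *\<^sub>R u x - \<i> * (pdv i fs x *\<^sub>R u x)
      = w x * (pdv i \<psi> x *\<^sub>R u x) - \<i> * \<xi> $ i * (w x * (\<psi> x *\<^sub>R u x))" for x
    by (simp add: pc ps w_def cis.code Complex_eq scaleR_conv_of_real algebra_simps)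
  moreover have "fc x *\<^sub>R (G x $ i) - \<i> * (fs x *\<^sub>R (G x $ i)) = w x * (\<psi> x *\<^sub>R (G x $ i))" for x
    by (simp add: fc_def fs_def w_def cis.code Complex_eq scaleR_conv_of_real algebra_simps)
  ultimately have "(\<integral>x. w x * (pdv i \<psi> x *\<^sub>R u x) \<partial>lborel) - \<i> * \<xi> $ i * (\<integral>x. w x * (\<psi> x *\<^sub>R u x) \<partial>lborel)
      = - (\<integral>x. w x * (\<psi> x *\<^sub>R (G x $ i)) \<partial>lborel)"
    by (simp only: lin[OF i2 i1])
  then have "\<i> * \<xi> $ i * (\<integral>x. w x * (\<psi> x *\<^sub>R u x) \<partial>lborel)
      = (\<integral>x. w x * (\<psi> x *\<^sub>R (G x $ i)) \<partial>lborel) + (\<integral>x. w x * (pdv i \<psi> x *\<^sub>R u x) \<partial>lborel)"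
    by (simp only: diff_eq_eq) simp
  also have "\<dots> = (\<integral>x. w x * (\<psi> x *\<^sub>R (G x $ i) + pdv i \<psi> x *\<^sub>R u x) \<partial>lborel)"
    using i2 i3 by (simp add: distrib_left)
  finally show ?thesis
    by (simp add: fourier_integral_def w_def)
qed

lemma has_plancherel_transform_bounded_support:
  fixes v :: "real^'n \<Rightarrow> complex"
  assumes v: "v \<in> Lp 2" and supp: "\<And>x. x \<notin> cball 0 R \<Longrightarrow> v x = 0"
  shows "integrable lborel v" and "has_plancherel_transform v (fourier_integral v)"
proof -
  have [measurable]: "v \<in> borel_measurable borel" and v2: "square_integrable v"
    using v by (auto simp: Lp_2_iff)
  have eq: "(\<lambda>x. indicator (cball 0 S) x *\<^sub>R v x) = v" if "S \<ge> R" for S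
    using supp that by (force simp: indicator_def)
  show v1: "integrable lborel v"
    using integrable_truncation(1)[OF v, of R] by (simp add: eq)
  have "fourier_integral v \<in> Lp 2"
    using integrable_fourier_integral_square[OF v1 v2] by (simp add: Lp_2_iff)
  moreover have "((\<lambda>S. \<integral>\<^sup>+\<xi>. ennreal ((cmod (fourier_integral (\<lambda>x. indicator (cball 0 S) x *\<^sub>R v x) \<xi>
      - fourier_integral v \<xi>))\<^sup>2) \<partial>lborel) \<longlongrightarrow> 0) at_top"
    by (rule tendsto_eventually) (use eq in \<open>auto simp: eventually_at_top_linorder intro!: exI[of _ R]\<close>)
  ultimately show "has_plancherel_transform v (fourier_integral v)"
    using v by (simp add: has_plancherel_transform_def)
qed

text \<open>Injectivity from the Sobolev bound: if the transform vanishes, the bound holds with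
  every H > 0, so the L^q integral of v vanishes. The value q = 3 is one convenient choice above
  2.\<close>

lemma fourier_integral_eq_0_imp_AE_eq_0:
  fixes v :: "real^'n \<Rightarrow> complex"
  assumes v: "v \<in> Lp 2" and supp: "\<And>x. x \<notin> cball 0 R \<Longrightarrow> v x = 0"
    and F: "\<And>\<xi>. fourier_integral v \<xi> = 0"
  shows "AE x in lborel. v x = 0"
proof -
  have [measurable]: "v \<in> borel_measurable borel" using v by (auto simp: Lp_2_iff)
  have "has_plancherel_transform v (fourier_integral v)"
    by (rule has_plancherel_transform_bounded_support(2)[OF v supp])
  obtain K where K: "K > 0"
    and *: "\<And>(u :: real^'n \<Rightarrow> complex) g H. has_plancherel_transform u g \<Longrightarrow> H > 0 \<Longrightarrow>
    (\<integral>\<^sup>+\<xi>. ennreal (norm \<xi> powr (real CARD('n) - 2 * real CARD('n) / 3)) * ennreal ((cmod (g \<xi>))\<^sup>2) \<partial>lborel) \<le> ennreal H \<Longrightarrow>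
    nn_Lp_power 3 u \<le> ennreal (K * H powr (3 / 2))"
    using plancherel_transform_sobolev[of 3, where 'n='n] by auto
  have "nn_Lp_power 3 v \<le> 0"
  proof (rule ennreal_le_epsilon)
    fix e :: real assume e: "e > 0"
    have "nn_Lp_power 3 v \<le> ennreal (K * ((e / K) powr (2 / 3)) powr (3 / 2))"
      by (rule *[OF has_plancherel_transform_bounded_support(2)[OF v supp]]) (use e K F in auto)
    also have "K * ((e / K) powr (2 / 3)) powr (3 / 2) = e"
      using e K by (simp add: powr_powr)
    finally show "nn_Lp_power 3 v \<le> 0 + ennreal e"
      by simp
  qed
  then have "nn_Lp_power 3 v = 0"
    by simp
  then have "AE x in lborel. ennreal (cmod (v x) powr 3) = 0"
    by (subst (asm) nn_integral_0_iff_AE) auto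
  then show ?thesis
    by eventually_elim simp
qed

text \<open>After multiplication by a cutoff, \<open>has_weak_gradient_fourier\<close> gives both
  candidates the same Fourier integrals, because the left side there does not mention the gradient.
  The cutoffs are supported in balls of growing radius and positive inside, so every point is
  reached.\<close>

lemma has_weak_gradient_unique:
  fixes u :: "real^'n \<Rightarrow> complex" and G G' :: "real^'n \<Rightarrow> complex^'n"
  assumes u: "u \<in> Lp 2" and G: "G \<in> Lp 2" "G' \<in> Lp 2"
    and uG: "has_weak_gradient u G" "has_weak_gradient u G'"
  shows "AE x in lborel. G x = G' x"
proof -
  define \<psi> where "\<psi> k x = cutoff ((1 / real (Suc k)) *\<^sub>R x)" for k and x :: "real^'n"
  have "AE x in lborel. \<psi> k x *\<^sub>R (G x $ i - G' x $ i) = 0" for k i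
  proof -
    have \<psi>: "\<psi> k \<in> test_functions"
      unfolding \<psi>_def by (intro test_functions_scaleR cutoff_in_test_functions) simp
    obtain R where R: "\<And>x. x \<notin> cball 0 R \<Longrightarrow> \<psi> k x = 0"
      using test_function_support[OF \<psi>] by blast
    have Gi: "(\<lambda>x. G x $ i) \<in> Lp 2" "(\<lambda>x. G' x $ i) \<in> Lp 2" using G by (auto intro: Lp_2_nth)
    have D: "(\<lambda>x. G x $ i - G' x $ i) \<in> Lp 2"
      using Gi by (rule Lp_2_diff)
    have i1: "integrable lborel (\<lambda>x. \<psi> k x *\<^sub>R (G x $ i) + pdv i (\<psi> k) x *\<^sub>R u x)"
      by (intro Bochner_Integration.integrable_add integrable_test_function_scaleR[OF \<psi> Gi(1)] integrable_pdv_test_function_scaleR[OF \<psi> u])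
    have i2: "integrable lborel (\<lambda>x. \<psi> k x *\<^sub>R (G' x $ i) + pdv i (\<psi> k) x *\<^sub>R u x)"
      by (intro Bochner_Integration.integrable_add integrable_test_function_scaleR[OF \<psi> Gi(2)] integrable_pdv_test_function_scaleR[OF \<psi> u])
    show ?thesis
    proof (rule fourier_integral_eq_0_imp_AE_eq_0[of _ R])
      show "(\<lambda>x. \<psi> k x *\<^sub>R (G x $ i - G' x $ i)) \<in> Lp 2"
        by (rule Lp_2_test_function_scaleR[OF \<psi> D])
      show "\<psi> k x *\<^sub>R (G x $ i - G' x $ i) = 0" if "x \<notin> cball 0 R" for x
        using R[OF that] by simp
      fix \<xi>
      have "fourier_integral (\<lambda>x. \<psi> k x *\<^sub>R (G x $ i) + pdv i (\<psi> k) x *\<^sub>R u x) \<xi>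
          = fourier_integral (\<lambda>x. \<psi> k x *\<^sub>R (G' x $ i) + pdv i (\<psi> k) x *\<^sub>R u x) \<xi>"
        by (simp only: has_weak_gradient_fourier[OF u G(1) uG(1) \<psi>, symmetric]
            has_weak_gradient_fourier[OF u G(2) uG(2) \<psi>, symmetric])
      then show "fourier_integral (\<lambda>x. \<psi> k x *\<^sub>R (G x $ i - G' x $ i)) \<xi> = 0"
        using fourier_integral_diff[OF i1 i2, of \<xi>] by (simp add: scaleR_diff_right)
    qed
  qed
  then have "AE x in lborel. \<forall>k i. \<psi> k x *\<^sub>R (G x $ i - G' x $ i) = 0"
    unfolding AE_all_countable by (intro allI eventually_all_finite)
  then show ?thesis
  proof eventually_elim
    case (elim x)
    obtain k where "norm x < real k" using reals_Archimedean2 by blast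
    then have "(1 / real (Suc k)) *\<^sub>R x \<in> ball 0 1"
      by (simp add: divide_simps)
    then have "\<psi> k x \<noteq> 0"
      unfolding \<psi>_def using cutoff_pos by fastforce
    then show "G x = G' x"
      using elim by (auto simp: vec_eq_iff)
  qed
qed

section \<open>The Dirichlet integral and the Sobolev inequality on H1\<close>

abbreviation dirichlet :: "(real^'n \<Rightarrow> complex) \<Rightarrow> real" where
  "dirichlet u \<equiv> \<integral>x. (norm (weak_gradient u x))\<^sup>2 \<partial>lborel"

lemma
  fixes u :: "real^'n \<Rightarrow> complex" and G :: "real^'n \<Rightarrow> complex^'n"
  assumes u: "u \<in> Lp 2" and G: "G \<in> Lp 2" and uG: "has_weak_gradient u G"
  shows H1_I: "u \<in> H1"
    and integral_weak_gradient: "dirichlet u = (\<integral>x. (norm (G x))\<^sup>2 \<partial>lborel)"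
proof -
  show "u \<in> H1" using assms by (auto simp: H1_def)
  have w: "weak_gradient u \<in> Lp 2 \<and> has_weak_gradient u (weak_gradient u)"
    unfolding weak_gradient_def by (rule someI[of _ G]) (use G uG in auto)
  then have [measurable]: "weak_gradient u \<in> borel_measurable borel" by (simp add: Lp_2_iff)
  have [measurable]: "G \<in> borel_measurable borel" using G by (simp add: Lp_2_iff)
  have "AE x in lborel. weak_gradient u x = G x"
    by (rule has_weak_gradient_unique[OF u _ G _ uG]) (use w in auto)
  then have "AE x in lborel. (norm (weak_gradient u x))\<^sup>2 = (norm (G x))\<^sup>2"
    by eventually_elim simp
  then show "dirichlet u = (\<integral>x. (norm (G x))\<^sup>2 \<partial>lborel)"
    by (intro integral_cong_AE) measurable
qed

lemma H1_E:
  assumes "u \<in> H1"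
  obtains G where "u \<in> Lp 2" "G \<in> Lp 2" "has_weak_gradient u G"
    "dirichlet u = (\<integral>x. (norm (G x))\<^sup>2 \<partial>lborel)"
  using assms integral_weak_gradient unfolding H1_def by blast

lemma has_weak_gradient_scale:
  fixes u :: "real^'n \<Rightarrow> complex" and G :: "real^'n \<Rightarrow> complex^'n"
  assumes u: "u \<in> Lp 2" and G: "G \<in> Lp 2" and uG: "has_weak_gradient u G" and l: "l > 0"
  shows "has_weak_gradient (\<lambda>x. c *\<^sub>R u (l *\<^sub>R x)) (\<lambda>x. (c * l) *\<^sub>R G (l *\<^sub>R x))"
  unfolding has_weak_gradient_def pdv_def[symmetric]
proof (intro ballI allI)
  fix \<phi> :: "real^'n \<Rightarrow> real" and i assume \<phi>: "\<phi> \<in> test_functions"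
  let ?f = "\<lambda>x. \<phi> ((1 / l) *\<^sub>R x)"
  have f: "?f \<in> test_functions"
    by (rule test_functions_scaleR[OF \<phi>]) (use l in auto)
  have c: "continuous_on UNIV \<phi>" "continuous_on UNIV (pdv i \<phi>)"
    by (rule test_function_bounds[OF \<phi>, where i=i], blast)+
  have [measurable]: "\<phi> \<in> borel_measurable borel" "pdv i \<phi> \<in> borel_measurable borel"
    using c by (auto intro: borel_measurable_continuous_onI)
  have [measurable]: "u \<in> borel_measurable borel" "(\<lambda>x. G x $ i) \<in> borel_measurable borel"
    using u Lp_2_nth[OF G] by (auto simp: Lp_2_iff)
  have pf: "pdv i \<phi> ((1 / l) *\<^sub>R y) = l * pdv i ?f y" for y
    using l by (simp add: pdv_scaleR[OF test_function_differentiable[OF \<phi>]])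
  have "(\<integral>x. pdv i \<phi> x *\<^sub>R c *\<^sub>R u (l *\<^sub>R x) \<partial>lborel)
      = (\<integral>x. (\<lambda>y. pdv i \<phi> ((1 / l) *\<^sub>R y) *\<^sub>R c *\<^sub>R u y) (0 + l *\<^sub>R x) \<partial>lborel)"
    using l by simp
  also have "\<dots> = (1 / \<bar>l\<bar> ^ DIM(real^'n)) *\<^sub>R (\<integral>y. pdv i \<phi> ((1 / l) *\<^sub>R y) *\<^sub>R c *\<^sub>R u y \<partial>lborel)"
    using l by (intro integral_lborel_affine) auto
  also have "(\<integral>y. pdv i \<phi> ((1 / l) *\<^sub>R y) *\<^sub>R c *\<^sub>R u y \<partial>lborel) = (\<integral>y. (c * l) *\<^sub>R (pdv i ?f y *\<^sub>R u y) \<partial>lborel)"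
    unfolding pf by (simp add: mult_ac)
  also have "\<dots> = - (\<integral>y. (c * l) *\<^sub>R (?f y *\<^sub>R (G y $ i)) \<partial>lborel)"
    by (simp only: integral_scaleR_right has_weak_gradientD[OF uG f] scaleR_minus_right)
  also have "(1 / \<bar>l\<bar> ^ DIM(real^'n)) *\<^sub>R - (\<integral>y. (c * l) *\<^sub>R (?f y *\<^sub>R (G y $ i)) \<partial>lborel)
      = - ((1 / \<bar>l\<bar> ^ DIM(real^'n)) *\<^sub>R (\<integral>y. (c * l) *\<^sub>R (?f y *\<^sub>R (G y $ i)) \<partial>lborel))"
    by simp
  also have "(1 / \<bar>l\<bar> ^ DIM(real^'n)) *\<^sub>R (\<integral>y. (c * l) *\<^sub>R (?f y *\<^sub>R (G y $ i)) \<partial>lborel)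
      = (\<integral>x. (\<lambda>y. (c * l) *\<^sub>R (?f y *\<^sub>R (G y $ i))) (0 + l *\<^sub>R x) \<partial>lborel)"
    using l by (intro integral_lborel_affine[symmetric]) auto
  also have "\<dots> = (\<integral>x. \<phi> x *\<^sub>R (((c * l) *\<^sub>R G (l *\<^sub>R x)) $ i) \<partial>lborel)"
    using l by (intro Bochner_Integration.integral_cong) (auto simp: mult_ac)
  finally show "(\<integral>x. pdv i \<phi> x *\<^sub>R c *\<^sub>R u (l *\<^sub>R x) \<partial>lborel)
      = - (\<integral>x. \<phi> x *\<^sub>R (((c * l) *\<^sub>R G (l *\<^sub>R x)) $ i) \<partial>lborel)" .
qed

text \<open>Below the scale t the power is at most t^(2s), and above it the exponent 2s can be
  raised to 2. The free scale later balances mass against gradient.\<close>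

lemma powr_le_one_plus_square:
  fixes r t s :: real
  assumes "0 \<le> r" "0 < t" "0 \<le> s" "s \<le> 1"
  shows "r powr (2 * s) \<le> t powr (2 * s) * (1 + r\<^sup>2 / t\<^sup>2)"
proof -
  have "(r / t) powr (2 * s) \<le> 1 + (r / t)\<^sup>2"
  proof (cases "r / t \<le> 1")
    case True
    then have "(r / t) powr (2 * s) \<le> 1"
      using assms by (intro powr_le1) auto
    then show ?thesis using zero_le_power2[of "r / t"] by linarith
  next
    case False
    then have "(r / t) powr (2 * s) \<le> (r / t) powr 2"
      using assms by (intro powr_mono) auto
    also have "(r / t) powr 2 = (r / t)\<^sup>2"
      using False by (intro powr_numeral) linarith
    finally show ?thesis by linarith
  qed
  moreover have "r powr (2 * s) = t powr (2 * s) * (r / t) powr (2 * s)"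
    using assms by (subst powr_mult[symmetric]) simp
  ultimately show ?thesis
    using assms by (simp add: power_divide)
qed

lemma norm_vec_power2: "(norm (x :: 'a::real_normed_vector ^ 'n))\<^sup>2 = (\<Sum>i\<in>UNIV. (norm (x $ i))\<^sup>2)"
  by (simp add: norm_vec_def L2_set_def sum_nonneg)

lemma ennreal_mult_add_mult:
  "0 \<le> x \<Longrightarrow> 0 \<le> y \<Longrightarrow> 0 \<le> a \<Longrightarrow> 0 \<le> b \<Longrightarrow>
    ennreal (x * (a + y * b)) = ennreal x * (ennreal a + ennreal y * ennreal b)"
  by (simp only: ennreal_mult' ennreal_plus mult_nonneg_nonneg)

text \<open>For compactly supported square-integrable functions the Fourier integral is a Plancherel
  transform, so the fractional inequality is applied to u times a cutoff at radius k + 1. The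
  derivative of the cutoff is of order 1/k and its contribution disappears in the limit; Fatou then
  passes to u.\<close>

lemma H1_sobolev:
  fixes q s :: real
  assumes q: "q > 2" and s: "2 * s = real CARD('n) - 2 * real CARD('n) / q" "s \<le> 1"
  shows "\<exists>K>0. \<forall>(u :: real^'n \<Rightarrow> complex) t. u \<in> H1 \<longrightarrow> t > 0 \<longrightarrow> mass u > 0 \<longrightarrow>
    nn_Lp_power q u \<le> ennreal (K * (t powr (2 * s) * (mass u + dirichlet u / t\<^sup>2)) powr (q / 2))"
proof -
  have s0: "0 \<le> s"
  proof -
    have "2 * real CARD('n) / q \<le> real CARD('n)" using q by (simp add: field_simps)
    then show ?thesis using s(1) by linarith
  qed
  obtain K0 where K0: "K0 > 0"
    and sob: "\<And>(u :: real^'n \<Rightarrow> complex) g H. has_plancherel_transform u g \<Longrightarrow> H > 0 \<Longrightarrow>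
    nn_weighted (2 * s) g \<le> ennreal H \<Longrightarrow>
    nn_Lp_power q u \<le> ennreal (K0 * H powr (q / 2))"
    using plancherel_transform_sobolev[OF q, where 'n='n] unfolding s(1)[symmetric] by auto
  \<comment> \<open>The dilated cutoffs tend pointwise to their value at the origin, which is
    exp(-1). Fatou therefore yields a bound for c u, and dividing by c^q enlarges
    \<open>K\<close>.\<close>
  define c where "c = cutoff (0 :: real^'n)"
  have c: "c > 0" unfolding c_def by (rule cutoff_pos) simp
  define K where "K = K0 * 2 powr (q / 2) / c powr q"
  have K: "K > 0" using K0 c by (simp add: K_def)
  have "\<exists>B. \<forall>x. \<bar>pdv i (cutoff :: real^'n \<Rightarrow> real) x\<bar> \<le> B" for i
    by (rule test_function_bounds[OF cutoff_in_test_functions, where i=i]) blast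
  then obtain B where B: "\<And>i x. \<bar>pdv i (cutoff :: real^'n \<Rightarrow> real) x\<bar> \<le> B i"
    by metis
  define C where "C = (\<Sum>i\<in>UNIV. \<bar>B i\<bar>)"
  have C: "\<bar>pdv i (cutoff :: real^'n \<Rightarrow> real) x\<bar> \<le> C" for i x
  proof -
    have "\<bar>B i\<bar> \<le> C" unfolding C_def by (rule member_le_sum) auto
    then show ?thesis using B[of i x] by linarith
  qed
  have "nn_Lp_power q u \<le> ennreal (K * (t powr (2 * s) * (mass u + dirichlet u / t\<^sup>2)) powr (q / 2))"
    if uH: "u \<in> H1" and t: "t > 0" and m: "mass u > 0" for u :: "real^'n \<Rightarrow> complex" and t
  proof -
    obtain G where u: "u \<in> Lp 2" and G: "G \<in> Lp 2" and uG: "has_weak_gradient u G"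
      and wG: "dirichlet u = (\<integral>x. (norm (G x))\<^sup>2 \<partial>lborel)"
      by (rule H1_E[OF uH])
    define a where "a = dirichlet u"
    have a0: "a \<ge> 0" by (simp add: a_def)
    have [measurable]: "u \<in> borel_measurable borel" and u2: "square_integrable u"
      using u by (auto simp: Lp_2_iff)
    have Gi: "(\<lambda>x. G x $ i) \<in> Lp 2" for i by (rule Lp_2_nth[OF G])
    then have [measurable]: "(\<lambda>x. G x $ i) \<in> borel_measurable borel" and Gi2: "integrable lborel (\<lambda>x. (cmod (G x $ i))\<^sup>2)" for i
      by (auto simp: Lp_2_iff)
    have asum: "a = (\<Sum>i\<in>UNIV. \<integral>x. (cmod (G x $ i))\<^sup>2 \<partial>lborel)"
      unfolding a_def wG unfolding norm_vec_power2 by (rule Bochner_Integration.integral_sum) (rule Gi2)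
    define w where "w k x = cutoff ((1 / real (Suc k)) *\<^sub>R x)" for k and x :: "real^'n"
    define v where "v k x = w k x *\<^sub>R u x" for k x
    \<comment> \<open>Bounds twice the squared L^2 norm of u times a partial derivative of the
      cutoff; the factor 2 comes from (x + y)^2 \<le> 2 x^2 + 2 y^2.\<close>
    define e where "e k = 2 * (C / real (Suc k))\<^sup>2 * mass u" for k
    define H where "H k = t powr (2 * s) * (mass u + (2 * a + real CARD('n) * e k) / t\<^sup>2)" for k
    have e0: "e k \<ge> 0" for k using m by (simp add: e_def)
    have H0: "H k > 0" for k
      unfolding H_def using t m a0 e0[of k] by (intro mult_pos_pos add_pos_nonneg) auto
    have [measurable]: "w k \<in> borel_measurable borel" for k
    proof -
      have "continuous_on UNIV (w k)"
        using C_k_scaleR[OF C_k_cutoff[of 0], of "1 / real (Suc k)"] by (simp add: w_def[abs_def])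
      then show ?thesis by (rule borel_measurable_continuous_onI)
    qed
    have [measurable]: "v k \<in> borel_measurable borel" for k
      unfolding v_def[abs_def] by measurable
    let ?a = "\<lambda>i. \<integral>x. (cmod (G x $ i))\<^sup>2 \<partial>lborel"
    let ?C = "\<lambda>k. C / real (Suc k)" and ?d = "real CARD('n)" and ?t = "t powr (2 * s)"
    let ?P = "(?t * (mass u + a / t\<^sup>2)) powr (q / 2)"
    have w01: "0 \<le> w k x" "w k x \<le> 1" for k x
      by (auto simp: w_def cutoff_nonneg cutoff_le_1)
    have est: "(\<integral>\<^sup>+x. ennreal (cmod (v k x) powr q) \<partial>lborel) \<le> ennreal (K0 * H k powr (q / 2))" for k
    proof -
      have wt: "w k \<in> test_functions"
        unfolding w_def by (intro test_functions_scaleR cutoff_in_test_functions) simp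
      obtain R where R: "\<And>x. x \<notin> cball 0 R \<Longrightarrow> w k x = 0"
        using test_function_support[OF wt] by blast
      have v: "v k \<in> Lp 2"
        unfolding v_def by (rule Lp_2_test_function_scaleR[OF wt u])
      have vR: "v k x = 0" if "x \<notin> cball 0 R" for x
        using R[OF that] by (simp add: v_def)
      note v1 = has_plancherel_transform_bounded_support(1)[OF v vR]
      define F where "F = fourier_integral (v k)"
      have [measurable]: "F \<in> borel_measurable borel" unfolding F_def by measurable
      let ?Fi = "\<lambda>\<xi> i. (\<xi> $ i)\<^sup>2 * (cmod (F \<xi>))\<^sup>2"
      have F2: "nn_L2_square F \<le> ennreal (mass u)"
      proof -
        have "nn_L2_square F \<le> (\<integral>\<^sup>+x. ennreal ((cmod (v k x))\<^sup>2) \<partial>lborel)"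
          unfolding F_def by (rule nn_integral_plancherel_le[OF v1])
        also have "\<dots> \<le> nn_L2_square u"
          using w01 by (intro nn_integral_mono ennreal_leI power_mono) (auto simp: v_def mult_left_le_one_le)
        also have "\<dots> = ennreal (mass u)"
          unfolding mass_def by (rule nn_integral_eq_integral[OF u2]) simp
        finally show ?thesis .
      qed
      \<comment> \<open>Up to the factor \<i>, a coordinate times \<open>F\<close> is the transform
        of the product-rule expression \<open>?w\<close>, to which the Plancherel inequality
        applies.\<close>
      have Fi: "(\<integral>\<^sup>+\<xi>. ennreal (?Fi \<xi> i) \<partial>lborel)
          \<le> ennreal (2 * ?a i + e k)" for i
      proof -
        let ?w = "\<lambda>x. w k x *\<^sub>R (G x $ i) + pdv i (w k) x *\<^sub>R u x"
        have pw: "\<bar>pdv i (w k) x\<bar> \<le> ?C k" for x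
        proof -
          have "cutoff differentiable_on (UNIV :: (real^'n) set)"
            by (rule test_function_differentiable[OF cutoff_in_test_functions])
          then have "pdv i (w k) x = (1 / real (Suc k)) * pdv i cutoff ((1 / real (Suc k)) *\<^sub>R x)"
            unfolding w_def by (rule pdv_scaleR)
          then have "\<bar>pdv i (w k) x\<bar> = \<bar>pdv i cutoff ((1 / real (Suc k)) *\<^sub>R x)\<bar> / real (Suc k)"
            by (simp add: abs_mult)
          also have "\<dots> \<le> ?C k"
            by (intro divide_right_mono C) simp
          finally show ?thesis .
        qed
        have i1: "integrable lborel ?w"
          by (intro Bochner_Integration.integrable_add integrable_test_function_scaleR[OF wt Gi]
              integrable_pdv_test_function_scaleR[OF wt u])
        have "(\<integral>\<^sup>+\<xi>. ennreal (?Fi \<xi> i) \<partial>lborel)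
            = (\<integral>\<^sup>+\<xi>. ennreal ((cmod (fourier_integral ?w \<xi>))\<^sup>2) \<partial>lborel)"
        proof (rule nn_integral_cong)
          fix \<xi> :: "real^'n"
          have "fourier_integral ?w \<xi> = \<i> * of_real (\<xi> $ i) * F \<xi>"
            unfolding F_def v_def by (rule has_weak_gradient_fourier[OF u G uG wt, symmetric])
          then show "ennreal (?Fi \<xi> i) = ennreal ((cmod (fourier_integral ?w \<xi>))\<^sup>2)"
            by (simp add: norm_mult power_mult_distrib)
        qed
        also have "\<dots> \<le> (\<integral>\<^sup>+x. ennreal ((cmod (?w x))\<^sup>2) \<partial>lborel)"
          by (rule nn_integral_plancherel_le[OF i1])
        also have "\<dots> \<le> (\<integral>\<^sup>+x. ennreal (2 * (cmod (G x $ i))\<^sup>2 + 2 * (?C k)\<^sup>2 * (cmod (u x))\<^sup>2) \<partial>lborel)"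
        proof (intro nn_integral_mono ennreal_leI)
          fix x
          have 1: "w k x * cmod (G x $ i) \<le> cmod (G x $ i)"
            using w01 by (simp add: mult_left_le_one_le)
          have 2: "\<bar>pdv i (w k) x\<bar> * cmod (u x) \<le> ?C k * cmod (u x)"
            by (intro mult_right_mono pw) simp
          have "cmod (?w x) \<le> w k x * cmod (G x $ i) + \<bar>pdv i (w k) x\<bar> * cmod (u x)"
            using norm_triangle_ineq[of "w k x *\<^sub>R (G x $ i)" "pdv i (w k) x *\<^sub>R u x"] w01[of k x] by simp
          then have "cmod (?w x) \<le> cmod (G x $ i) + ?C k * cmod (u x)"
            using 1 2 by linarith
          then have "(cmod (?w x))\<^sup>2 \<le> (cmod (G x $ i) + ?C k * cmod (u x))\<^sup>2"
            by (intro power_mono) auto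
          also have "\<dots> \<le> 2 * (cmod (G x $ i))\<^sup>2 + 2 * (?C k * cmod (u x))\<^sup>2"
            using sum_squares_bound[of "cmod (G x $ i)" "?C k * cmod (u x)"]
            unfolding power2_sum by linarith
          finally show "(cmod (?w x))\<^sup>2 \<le> 2 * (cmod (G x $ i))\<^sup>2 + 2 * (?C k)\<^sup>2 * (cmod (u x))\<^sup>2"
            by (simp only: power_mult_distrib mult.assoc)
        qed
        also have "\<dots> = ennreal (\<integral>x. 2 * (cmod (G x $ i))\<^sup>2 + 2 * (?C k)\<^sup>2 * (cmod (u x))\<^sup>2 \<partial>lborel)"
          by (rule nn_integral_eq_integral) (use Gi2[of i] u2 in auto)
        also have "(\<integral>x. 2 * (cmod (G x $ i))\<^sup>2 + 2 * (?C k)\<^sup>2 * (cmod (u x))\<^sup>2 \<partial>lborel)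
            = 2 * ?a i + e k"
          using Gi2[of i] u2 by (simp add: e_def mass_def)
        finally show ?thesis .
      qed
      have "nn_weighted (2 * s) F
          \<le> (\<integral>\<^sup>+\<xi>. ennreal (?t) * (ennreal ((cmod (F \<xi>))\<^sup>2)
              + ennreal (1 / t\<^sup>2) * (\<Sum>i\<in>UNIV. ennreal (?Fi \<xi> i))) \<partial>lborel)"
      proof (rule nn_integral_mono)
        fix \<xi> :: "real^'n"
        have "norm \<xi> powr (2 * s) * (cmod (F \<xi>))\<^sup>2 \<le> ?t * (1 + (norm \<xi>)\<^sup>2 / t\<^sup>2) * (cmod (F \<xi>))\<^sup>2"
          using t s0 s(2) by (intro mult_right_mono powr_le_one_plus_square) auto
        also have "\<dots> = ?t * ((cmod (F \<xi>))\<^sup>2 + 1 / t\<^sup>2 * ((norm \<xi>)\<^sup>2 * (cmod (F \<xi>))\<^sup>2))"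
          by (simp add: algebra_simps)
        also have "(norm \<xi>)\<^sup>2 * (cmod (F \<xi>))\<^sup>2 = (\<Sum>i\<in>UNIV. ?Fi \<xi> i)"
          unfolding norm_vec_power2 sum_distrib_right by simp
        finally have "ennreal (norm \<xi> powr (2 * s) * (cmod (F \<xi>))\<^sup>2)
          \<le> ennreal (?t * ((cmod (F \<xi>))\<^sup>2 + 1 / t\<^sup>2 * (\<Sum>i\<in>UNIV. ?Fi \<xi> i)))"
          by (rule ennreal_leI)
        also have "\<dots> = ennreal (?t) * (ennreal ((cmod (F \<xi>))\<^sup>2)
              + ennreal (1 / t\<^sup>2) * (\<Sum>i\<in>UNIV. ennreal (?Fi \<xi> i)))"
          by (subst ennreal_mult_add_mult, simp, simp, simp, simp add: sum_nonneg, subst sum_ennreal) simp_all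
        finally show "ennreal (norm \<xi> powr (2 * s)) * ennreal ((cmod (F \<xi>))\<^sup>2)
          \<le> ennreal (?t) * (ennreal ((cmod (F \<xi>))\<^sup>2)
              + ennreal (1 / t\<^sup>2) * (\<Sum>i\<in>UNIV. ennreal (?Fi \<xi> i)))"
          by (simp only: ennreal_mult'[OF powr_ge_zero])
      qed
      also have "\<dots> = ennreal (?t) * (nn_L2_square F
              + ennreal (1 / t\<^sup>2) * (\<Sum>i\<in>UNIV. \<integral>\<^sup>+\<xi>. ennreal (?Fi \<xi> i) \<partial>lborel))"
        by (subst nn_integral_cmult, measurable, subst nn_integral_add, measurable, subst nn_integral_cmult, measurable,
            subst nn_integral_sum, measurable)
      also have "\<dots> \<le> ennreal (?t) * (ennreal (mass u)
              + ennreal (1 / t\<^sup>2) * (\<Sum>i\<in>UNIV. ennreal (2 * ?a i + e k)))"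
        by (intro mult_left_mono add_mono sum_mono F2 Fi) auto
      also have "(\<Sum>i\<in>UNIV. ennreal (2 * ?a i + e k))
          = ennreal (\<Sum>i\<in>UNIV. 2 * ?a i + e k)"
        by (rule sum_ennreal) (use e0 in auto)
      also have "(\<Sum>i\<in>UNIV. 2 * ?a i + e k) = 2 * a + ?d * e k"
        by (simp add: asum sum.distrib sum_distrib_left)
      also have "ennreal (?t) * (ennreal (mass u) + ennreal (1 / t\<^sup>2) * ennreal (2 * a + ?d * e k)) = ennreal (H k)"
      proof -
        have "0 \<le> 2 * a + ?d * e k" using a0 e0[of k] by simp
        then show ?thesis
          using m by (subst ennreal_mult_add_mult[symmetric]) (auto simp: H_def)
      qed
      finally have W: "nn_weighted (2 * s) F \<le> ennreal (H k)" .
      show ?thesis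
        by (rule sob[OF has_plancherel_transform_bounded_support(2)[OF v vR, folded F_def] H0 W])
    qed
    let ?Hl = "?t * (mass u + 2 * a / t\<^sup>2)"
    have "(\<integral>\<^sup>+x. ennreal ((c * cmod (u x)) powr q) \<partial>lborel) \<le> ennreal (K0 * ?Hl powr (q / 2))"
    proof (rule nn_integral_le_of_tendsto[OF _ _ est])
      show "(\<lambda>x. ennreal (cmod (v k x) powr q)) \<in> borel_measurable lborel" for k
        by measurable
      have inv0: "(\<lambda>k. 1 / real (Suc k)) \<longlonglongrightarrow> 0"
        by (intro LIMSEQ_Suc lim_1_over_n)
      show "AE x in lborel. (\<lambda>k. ennreal (cmod (v k x) powr q)) \<longlonglongrightarrow> ennreal ((c * cmod (u x)) powr q)"
      proof (rule AE_I2)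
        fix x :: "real^'n"
        have "isCont (cutoff :: real^'n \<Rightarrow> real) 0"
          using C_k_cutoff[of 0, where 'n='n] by (simp add: continuous_on_eq_continuous_at)
        moreover have "(\<lambda>k. (1 / real (Suc k)) *\<^sub>R x) \<longlonglongrightarrow> 0"
          using tendsto_scaleR[OF inv0 tendsto_const[of x]] by simp
        ultimately have "(\<lambda>k. w k x) \<longlonglongrightarrow> c"
          unfolding w_def c_def by (rule isCont_tendsto_compose)
        then have "(\<lambda>k. w k x * cmod (u x)) \<longlonglongrightarrow> c * cmod (u x)"
          by (rule tendsto_mult_right)
        moreover have "cmod (v k x) = w k x * cmod (u x)" for k
          using w01[of k x] by (simp add: v_def)
        ultimately have "(\<lambda>k. cmod (v k x)) \<longlonglongrightarrow> c * cmod (u x)"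
          by simp
        then have "(\<lambda>k. cmod (v k x) powr q) \<longlonglongrightarrow> (c * cmod (u x)) powr q"
          by (rule tendsto_powr2[OF _ tendsto_const]) (use q in auto)
        then show "(\<lambda>k. ennreal (cmod (v k x) powr q)) \<longlonglongrightarrow> ennreal ((c * cmod (u x)) powr q)"
          by (rule tendsto_ennrealI)
      qed
      have "e = (\<lambda>k. 2 * (C * (1 / real (Suc k)))\<^sup>2 * mass u)"
        by (simp add: e_def fun_eq_iff)
      then have "e \<longlonglongrightarrow> 2 * (C * 0)\<^sup>2 * mass u"
        by (simp only:) (intro tendsto_mult tendsto_power tendsto_const inv0)
      then have "(\<lambda>k. H k) \<longlonglongrightarrow> ?t * (mass u + (2 * a + real CARD('n) * 0) / t\<^sup>2)"
        unfolding H_def using t by (intro tendsto_intros) auto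
      then have "(\<lambda>k. H k) \<longlonglongrightarrow> ?Hl" by simp
      moreover have "?Hl > 0"
        using t m a0 by (intro mult_pos_pos add_pos_nonneg) auto
      ultimately show "(\<lambda>k. ennreal (K0 * H k powr (q / 2))) \<longlonglongrightarrow> ennreal (K0 * ?Hl powr (q / 2))"
        by (intro tendsto_ennrealI tendsto_mult tendsto_const tendsto_powr) auto
    qed
    also have "(\<integral>\<^sup>+x. ennreal ((c * cmod (u x)) powr q) \<partial>lborel) = ennreal (c powr q) * nn_Lp_power q u"
      by (subst nn_integral_cmult[symmetric]) (auto simp: powr_mult ennreal_mult')
    finally have 1: "ennreal (c powr q) * nn_Lp_power q u \<le> ennreal (K0 * ?Hl powr (q / 2))" .
    \<comment> \<open>The doubled Dirichlet integral costs only the factor 2^(q/2), and division by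
      c^q the remaining one; both are built into \<open>K\<close>.\<close>
    have 2: "K0 * ?Hl powr (q / 2) \<le> c powr q * (K * ?P)"
    proof -
      have "?Hl \<le> 2 * (?t * (mass u + a / t\<^sup>2))"
        using m by (simp add: algebra_simps)
      then have "?Hl powr (q / 2) \<le> (2 * (?t * (mass u + a / t\<^sup>2))) powr (q / 2)"
        using q m a0 t by (intro powr_mono2) auto
      also have "\<dots> = 2 powr (q / 2) * ?P"
        by (rule powr_mult)
      finally have "K0 * ?Hl powr (q / 2) \<le> K0 * (2 powr (q / 2) * ?P)"
        using K0 by (intro mult_left_mono) auto
      then show ?thesis using c by (simp add: K_def)
    qed
    have "nn_Lp_power q u
        = ennreal (1 / c powr q) * (ennreal (c powr q) * nn_Lp_power q u)"
      using c by (simp add: mult.assoc[symmetric] ennreal_mult'[symmetric])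
    also have "\<dots> \<le> ennreal (1 / c powr q) * ennreal (c powr q * (K * ?P))"
      using 1 ennreal_leI[OF 2] by (intro mult_left_mono) (auto intro: order_trans)
    also have "\<dots> = ennreal (1 / c powr q * (c powr q * (K * ?P)))"
      by (rule ennreal_mult'[symmetric]) simp
    also have "1 / c powr q * (c powr q * (K * ?P))
        = K * ?P"
      using c by simp
    finally show ?thesis unfolding a_def .
  qed
  then show ?thesis
    using K by (intro exI[of _ K]) blast
qed

abbreviation Lp_power :: "real \<Rightarrow> (real^'n \<Rightarrow> complex) \<Rightarrow> real" where
  "Lp_power r u \<equiv> \<integral>x. cmod (u x) powr r \<partial>lborel"

section \<open>Mass, energy and virial\<close>

lemma Lp_iff_nn_integral:
  fixes u :: "real^'n \<Rightarrow> complex"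
  assumes "u \<in> borel_measurable borel"
  shows "u \<in> Lp q \<longleftrightarrow> nn_Lp_power q u < \<infinity>"
  using assms by (simp add: Lp_def integrable_iff_bounded)

lemma mass_conv_powr: "mass u = (\<integral>x. cmod (u x) powr 2 \<partial>lborel)"
  by (simp add: mass_def)

text \<open>Values up to the threshold \<nu> are compared with the power a, larger ones with the
  power c. Keeping \<nu> free allows the coefficient of the c-term to be prescribed later.\<close>

lemma powr_le_interpolate:
  fixes x \<nu> :: real
  assumes "0 \<le> x" "0 < \<nu>" "0 < a" "a \<le> b" "b \<le> c"
  shows "x powr b \<le> \<nu> powr (b - a) * x powr a + \<nu> powr (b - c) * x powr c"
proof (cases "x = 0")
  case False
  then have x: "x > 0" using assms by simp
  show ?thesis
  proof (cases "x \<le> \<nu>")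
    case True
    have "x powr b = x powr (b - a) * x powr a"
      by (simp add: powr_add[symmetric])
    also have "\<dots> \<le> \<nu> powr (b - a) * x powr a"
      using True x assms by (intro mult_right_mono powr_mono2) auto
    finally show ?thesis by (simp add: add_increasing2)
  next
    case False
    have "x powr b = x powr (b - c) * x powr c"
      by (simp add: powr_add[symmetric])
    also have "\<dots> \<le> \<nu> powr (b - c) * x powr c"
      using False x assms by (intro mult_right_mono powr_mono2') auto
    finally show ?thesis by (simp add: add_increasing)
  qed
qed (use assms in auto)

lemma
  fixes u :: "real^'n \<Rightarrow> complex"
  assumes u: "u \<in> Lp a" "u \<in> Lp c" and abc: "0 < a" "a \<le> b" "b \<le> c"
  shows Lp_interpolate: "u \<in> Lp b"
    and integral_powr_le_interpolate: "\<nu> > 0 \<Longrightarrow> Lp_power b u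
      \<le> \<nu> powr (b - a) * Lp_power a u + \<nu> powr (b - c) * Lp_power c u"
proof -
  have [measurable]: "u \<in> borel_measurable borel" and ia: "integrable lborel (\<lambda>x. cmod (u x) powr a)"
    and ic: "integrable lborel (\<lambda>x. cmod (u x) powr c)"
    using u by (auto simp: Lp_def)
  have ib: "integrable lborel (\<lambda>x. cmod (u x) powr b)"
  proof (rule Bochner_Integration.integrable_bound[OF Bochner_Integration.integrable_add[OF ia ic]])
    show "AE x in lborel. norm (cmod (u x) powr b) \<le> norm (cmod (u x) powr a + cmod (u x) powr c)"
    proof (rule AE_I2)
      fix x
      show "norm (cmod (u x) powr b) \<le> norm (cmod (u x) powr a + cmod (u x) powr c)"
        using powr_le_interpolate[OF norm_ge_zero[of "u x"] zero_less_one abc] by simp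
    qed
  qed measurable
  then show "u \<in> Lp b" by (simp add: Lp_def)
  show "Lp_power b u
      \<le> \<nu> powr (b - a) * Lp_power a u + \<nu> powr (b - c) * Lp_power c u"
    if "\<nu> > 0"
  proof -
    have "Lp_power b u \<le> (\<integral>x. \<nu> powr (b - a) * cmod (u x) powr a + \<nu> powr (b - c) * cmod (u x) powr c \<partial>lborel)"
      by (rule integral_mono) (use ia ib ic powr_le_interpolate[OF norm_ge_zero that abc] in auto)
    then show ?thesis using ia ic by simp
  qed
qed

text \<open>Amplitude and length are scaled independently. The Dirichlet integral is read off from
  an explicit weak gradient, which is legitimate by uniqueness.\<close>

lemma scale_in_H1_Lp:
  fixes u :: "real^'n \<Rightarrow> complex"
  assumes u: "u \<in> H1" "u \<in> Lp (p0 + 2)" and l: "l > 0" and c: "c > 0" and p: "0 < p1" "p1 < p0"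
  defines "v \<equiv> \<lambda>x. c *\<^sub>R u (l *\<^sub>R x)"
  shows "v \<in> H1" "v \<in> Lp (p0 + 2)" "mass v = c\<^sup>2 / l ^ CARD('n) * mass u"
    and "energy p0 p1 v = c\<^sup>2 / l ^ CARD('n) * (l\<^sup>2 * dirichlet u
      - 2 / (p1 + 2) * c powr p1 * Lp_power (p1 + 2) u
      + 2 / (p0 + 2) * c powr p0 * Lp_power (p0 + 2) u)"
proof -
  obtain G where u2: "u \<in> Lp 2" and G: "G \<in> Lp 2" and uG: "has_weak_gradient u G"
    and wG: "dirichlet u = (\<integral>x. (norm (G x))\<^sup>2 \<partial>lborel)"
    by (rule H1_E[OF u(1)])
  have [measurable]: "u \<in> borel_measurable borel" "G \<in> borel_measurable borel"
    using u2 G by (auto simp: Lp_2_iff)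
  define L where "L = l ^ CARD('n)"
  have L: "L > 0" using l by (simp add: L_def)
  have int: "integrable lborel (\<lambda>x. f (l *\<^sub>R x))" if "integrable lborel f" for f :: "real^'n \<Rightarrow> real"
    using integrable_lborel_affine[OF that, of l 0] l by simp
  have sub: "(\<integral>x. f (l *\<^sub>R x) \<partial>lborel) = (\<integral>x. f x \<partial>lborel) / L" if "f \<in> borel_measurable borel" for f :: "real^'n \<Rightarrow> real"
    using integral_lborel_affine[OF that, of l 0] l by (simp add: L_def)
  have vLp: "v \<in> Lp r" if "u \<in> Lp r" for r
  proof -
    have "integrable lborel (\<lambda>x. c powr r * cmod (u (l *\<^sub>R x)) powr r)"
      using that by (intro integrable_mult_right int[of "\<lambda>x. cmod (u x) powr r"]) (simp add: Lp_def)
    then show ?thesis using c by (simp add: Lp_def v_def powr_mult)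
  qed
  have v2: "v \<in> Lp 2" by (rule vLp[OF u2])
  show "v \<in> Lp (p0 + 2)" by (rule vLp[OF u(2)])
  have vG: "has_weak_gradient v (\<lambda>x. (c * l) *\<^sub>R G (l *\<^sub>R x))"
    unfolding v_def by (rule has_weak_gradient_scale[OF u2 G uG l])
  have G': "(\<lambda>x. (c * l) *\<^sub>R G (l *\<^sub>R x)) \<in> Lp 2"
  proof -
    have "integrable lborel (\<lambda>x. (c * l)\<^sup>2 * (norm (G (l *\<^sub>R x)))\<^sup>2)"
      using G by (intro integrable_mult_right int[of "\<lambda>x. (norm (G x))\<^sup>2"]) (simp add: Lp_2_iff)
    then show ?thesis by (simp add: Lp_2_iff power_mult_distrib)
  qed
  show "v \<in> H1" by (rule H1_I[OF v2 G' vG])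
  have vp: "Lp_power r v = c powr r / L * Lp_power r u" for r
    using c sub[of "\<lambda>x. cmod (u x) powr r"] by (simp add: v_def powr_mult)
  show "mass v = c\<^sup>2 / l ^ CARD('n) * mass u"
    unfolding mass_conv_powr vp L_def using c by simp
  have grad: "dirichlet v = c\<^sup>2 / L * (l\<^sup>2 * dirichlet u)"
  proof -
    have "dirichlet v = (\<integral>x. (norm ((c * l) *\<^sub>R G (l *\<^sub>R x)))\<^sup>2 \<partial>lborel)"
      by (rule integral_weak_gradient[OF v2 G' vG])
    also have "\<dots> = (\<integral>x. (c * l)\<^sup>2 * (norm (G (l *\<^sub>R x)))\<^sup>2 \<partial>lborel)"
      by (simp add: power_mult_distrib)
    also have "\<dots> = (c * l)\<^sup>2 * ((\<integral>x. (norm (G x))\<^sup>2 \<partial>lborel) / L)"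
      by (simp add: sub[of "\<lambda>x. (norm (G x))\<^sup>2"])
    finally show ?thesis unfolding wG by (simp add: power_mult_distrib)
  qed
  have cp: "c powr (p + 2) = c\<^sup>2 * c powr p" for p
    using c by (simp add: powr_add)
  show "energy p0 p1 v = c\<^sup>2 / l ^ CARD('n) * (l\<^sup>2 * dirichlet u
      - 2 / (p1 + 2) * c powr p1 * Lp_power (p1 + 2) u
      + 2 / (p0 + 2) * c powr p0 * Lp_power (p0 + 2) u)"
    unfolding energy_def grad vp cp L_def[symmetric]
    by (simp add: right_diff_distrib distrib_left mult_ac)
qed

text \<open>
  The energy is nonnegative at the critical mass; applied to all \<open>x \<mapsto> c u(l x)\<close> of that mass this is a
  Gagliardo--Nirenberg inequality whose constant is expressed by the critical mass.
\<close>

lemma critical_mass_inequality: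
  fixes u :: "real^'n \<Rightarrow> complex"
  assumes mc: "is_critical_mass TYPE('n) p0 p1 mc" and p: "0 < p1" "p1 < p0"
    and u: "u \<in> H1" "u \<in> Lp (p0 + 2)" and m: "mass u > 0" and c: "c > 0"
  shows "2 / (p1 + 2) * c powr p1 * Lp_power (p1 + 2) u
    \<le> (mass u / mc) powr (2 / real CARD('n)) * c powr (4 / real CARD('n)) * dirichlet u
      + 2 / (p0 + 2) * c powr p0 * Lp_power (p0 + 2) u"
proof -
  have mc0: "mc > 0" and I: "min_energy TYPE('n) p0 p1 mc = 0"
    using mc by (auto simp: is_critical_mass_def)
  define d where "d = real CARD('n)"
  have d: "d > 0" by (simp add: d_def)
  \<comment> \<open>Solves c^2 / l^d times \<open>mass u\<close> equals \<open>mc\<close>: the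
    rescaled function gets exactly the critical mass while c stays free.\<close>
  define l where "l = (c\<^sup>2 * (mass u / mc)) powr (1 / d)"
  have l: "l > 0" using c m mc0 by (simp add: l_def)
  have ld: "l ^ CARD('n) = c\<^sup>2 * (mass u / mc)"
  proof -
    have "l ^ CARD('n) = l powr d" using l by (simp add: powr_realpow d_def)
    also have "\<dots> = c\<^sup>2 * (mass u / mc)" using d c m mc0 by (simp add: l_def powr_powr)
    finally show ?thesis .
  qed
  have l2: "l\<^sup>2 = (mass u / mc) powr (2 / d) * c powr (4 / d)"
  proof -
    have "l\<^sup>2 = l powr 2" using l by simp
    also have "\<dots> = (c\<^sup>2 * (mass u / mc)) powr (2 / d)" by (simp add: l_def powr_powr)
    also have "\<dots> = (c\<^sup>2) powr (2 / d) * (mass u / mc) powr (2 / d)" by (rule powr_mult)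
    also have "c\<^sup>2 = c powr 2" using c by simp
    also have "(c powr 2) powr (2 / d) = c powr (4 / d)" by (simp add: powr_powr)
    finally show ?thesis by (simp only: mult.commute)
  qed
  define v where "v = (\<lambda>x. c *\<^sub>R u (l *\<^sub>R x))"
  note sc = scale_in_H1_Lp[OF u l c p, folded v_def]
  have "mass v = mc"
    unfolding sc(3) ld using c m mc0 by simp
  then have "min_energy TYPE('n) p0 p1 mc \<le> ereal (energy p0 p1 v)"
    unfolding min_energy_def using sc(1,2) by (intro INF_lower) auto
  then have "0 \<le> energy p0 p1 v" by (simp add: I)
  moreover have "c\<^sup>2 / l ^ CARD('n) > 0" using c l by simp
  ultimately have "0 \<le> l\<^sup>2 * dirichlet u
      - 2 / (p1 + 2) * c powr p1 * Lp_power (p1 + 2) u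
      + 2 / (p0 + 2) * c powr p0 * Lp_power (p0 + 2) u"
    unfolding sc(4) by (simp only: zero_le_mult_iff) linarith
  then show ?thesis unfolding l2 d_def[symmetric] by linarith
qed

text \<open>The embedding into L^(p+2) needs order s = d/2 - d/(p+2). If s \<le> 1, then H1
  suffices. Otherwise d p > 2 (p + 2), and since s0 - s = (d p - 2 (p + 2)) / (p (p + 2)), the order
  s0 = d/2 - 2/p is at least s.\<close>

lemma Hs_H1_imp_Lp:
  fixes u :: "real^'n \<Rightarrow> complex"
  assumes p: "0 < p" and u: "u \<in> Hs (real CARD('n) / 2 - 2 / p)" "u \<in> H1" and m: "mass u > 0"
  shows "u \<in> Lp (p + 2)"
proof -
  define d where "d = real CARD('n)"
  have d: "d > 0" by (simp add: d_def)
  define s where "s = d / 2 - d / (p + 2)"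
  have s2: "2 * s = real CARD('n) - 2 * real CARD('n) / (p + 2)" by (simp add: s_def d_def)
  have p2: "p + 2 > 2" using p by simp
  have um: "u \<in> borel_measurable borel" using u(2) by (auto simp: H1_def Lp_2_iff)
  have s_eq: "s = d * p / (2 * (p + 2))" using p by (simp add: s_def field_simps)
  have "nn_Lp_power (p + 2) u < \<infinity>"
  proof (cases "s \<le> 1")
    case True
    obtain C where "nn_Lp_power (p + 2) u \<le> ennreal C"
      using H1_sobolev[OF p2 s2 True] u(2) m zero_less_one by blast
    then show ?thesis
      by (rule le_less_trans) simp
  next
    case False
    define s0 where "s0 = d / 2 - 2 / p"
    have "2 * (p + 2) < d * p" using False p by (simp add: s_eq field_simps)
    then have ss0: "s \<le> s0" using p by (simp add: s_def s0_def field_simps)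
    obtain g where ug: "has_plancherel_transform u g"
      and gi: "integrable lborel (\<lambda>\<xi>. (1 + (norm \<xi>)\<^sup>2) powr s0 * (cmod (g \<xi>))\<^sup>2)"
      using u(1) by (auto simp: Hs_def s0_def d_def)
    let ?h = "\<lambda>\<xi>. (1 + (norm \<xi>)\<^sup>2) powr s0 * (cmod (g \<xi>))\<^sup>2"
    define H where "H = (\<integral>\<xi>. ?h \<xi> \<partial>lborel) + 1"
    have H: "H > 0" unfolding H_def by (intro add_nonneg_pos) auto
    have "nn_weighted (2 * s) g
        \<le> (\<integral>\<^sup>+\<xi>. ennreal (?h \<xi>) \<partial>lborel)"
    proof (rule nn_integral_mono)
      fix \<xi> :: "real^'n"
      have "norm \<xi> powr (2 * s) \<le> (1 + (norm \<xi>)\<^sup>2) powr s0"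
      proof (cases "\<xi> = 0")
        case False
        then have "norm \<xi> powr (2 * s) = ((norm \<xi>)\<^sup>2) powr s"
          by (simp add: powr_powr[symmetric])
        also have "\<dots> \<le> (1 + (norm \<xi>)\<^sup>2) powr s"
          using \<open>\<not> s \<le> 1\<close> by (intro powr_mono2) auto
        also have "\<dots> \<le> (1 + (norm \<xi>)\<^sup>2) powr s0"
          using ss0 by (intro powr_mono) auto
        finally show ?thesis .
      qed simp
      then have "norm \<xi> powr (2 * s) * (cmod (g \<xi>))\<^sup>2 \<le> ?h \<xi>"
        by (rule mult_right_mono) simp
      then show "ennreal (norm \<xi> powr (2 * s)) * ennreal ((cmod (g \<xi>))\<^sup>2) \<le> ennreal (?h \<xi>)"
        by (simp only: ennreal_mult'[OF powr_ge_zero, symmetric] ennreal_leI)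
    qed
    also have "\<dots> = ennreal (\<integral>\<xi>. ?h \<xi> \<partial>lborel)"
      by (rule nn_integral_eq_integral[OF gi]) simp
    also have "\<dots> \<le> ennreal H" by (intro ennreal_leI) (simp add: H_def)
    finally have W: "nn_weighted (2 * s) g \<le> ennreal H" .
    obtain C where "nn_Lp_power (p + 2) u \<le> ennreal C"
      using plancherel_transform_sobolev[OF p2, where 'n='n] ug H W unfolding s2[symmetric] by blast
    then show ?thesis
      by (rule le_less_trans) simp
  qed
  then show ?thesis using Lp_iff_nn_integral[OF um] by simp
qed

text \<open>Optimizing the scale in \<open>H1_sobolev\<close>. The bound is in terms of a positive
  majorant \<open>a\<close> of the Dirichlet integral, so it also applies before that integral is
  known to be positive.\<close>

lemma H1_gagliardo_nirenberg:
  fixes q M :: real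
  assumes q: "q > 2" "q * (real CARD('n) - 2) \<le> 2 * real CARD('n)" and M: "M > 0"
  shows "\<exists>K>0. \<forall>(u :: real^'n \<Rightarrow> complex) a. u \<in> H1 \<longrightarrow> 0 < mass u \<longrightarrow> mass u \<le> M \<longrightarrow> 0 < a \<longrightarrow>
    dirichlet u \<le> a \<longrightarrow>
    nn_Lp_power q u \<le> ennreal (K * a powr (real CARD('n) * (q - 2) / 4))"
proof -
  define d where "d = real CARD('n)"
  have d: "d > 0" by (simp add: d_def)
  define s where "s = d / 2 - d / q"
  have s2: "2 * s = real CARD('n) - 2 * real CARD('n) / q" by (simp add: s_def d_def)
  have s1: "s \<le> 1" using q d by (simp add: s_def d_def field_simps)
  have sq: "s * (q / 2) = d * (q - 2) / 4" using q by (simp add: s_def field_simps)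
  obtain K where K: "K > 0" and sob: "\<And>(u :: real^'n \<Rightarrow> complex) t. u \<in> H1 \<Longrightarrow> t > 0 \<Longrightarrow> mass u > 0 \<Longrightarrow>
      nn_Lp_power q u \<le> ennreal (K * (t powr (2 * s) * (mass u + dirichlet u / t\<^sup>2)) powr (q / 2))"
    using H1_sobolev[OF q(1) s2 s1] by blast
  define K' where "K' = K * (2 * M powr (1 - s)) powr (q / 2)"
  have K': "K' > 0" using K M by (simp add: K'_def)
  have "nn_Lp_power q u \<le> ennreal (K' * a powr (d * (q - 2) / 4))"
    if u: "u \<in> H1" and m: "0 < mass u" "mass u \<le> M" and a: "0 < a" "dirichlet u \<le> a"
    for u :: "real^'n \<Rightarrow> complex" and a
  proof -
    \<comment> \<open>At this scale the gradient term is at most the mass term.\<close>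
    define t where "t = sqrt (a / mass u)"
    have t: "t > 0" "t\<^sup>2 = a / mass u" using a m by (auto simp: t_def)
    have "t powr (2 * s) * (mass u + dirichlet u / t\<^sup>2) \<le> t powr (2 * s) * (2 * mass u)"
    proof (rule mult_left_mono)
      have "dirichlet u / t\<^sup>2 \<le> a / t\<^sup>2"
        using a(2) by (intro divide_right_mono) auto
      also have "a / t\<^sup>2 = mass u" using a m by (simp add: t)
      finally show "mass u + dirichlet u / t\<^sup>2 \<le> 2 * mass u" by simp
    qed simp
    also have "\<dots> = 2 * mass u powr (1 - s) * a powr s"
    proof -
      have "t powr (2 * s) = (a / mass u) powr s"
        using t(1) by (simp add: powr_powr[symmetric] t(2))
      then show ?thesis
        using m by (simp add: powr_divide powr_diff)
    qed
    also have "\<dots> \<le> 2 * M powr (1 - s) * a powr s"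
      using m s1 by (intro mult_right_mono mult_left_mono powr_mono2) auto
    finally have "(t powr (2 * s) * (mass u + dirichlet u / t\<^sup>2)) powr (q / 2)
        \<le> (2 * M powr (1 - s) * a powr s) powr (q / 2)"
      using q m by (intro powr_mono2) auto
    also have "\<dots> = (2 * M powr (1 - s)) powr (q / 2) * a powr (d * (q - 2) / 4)"
      by (simp only: powr_mult powr_powr sq)
    finally have "K * (t powr (2 * s) * (mass u + dirichlet u / t\<^sup>2)) powr (q / 2)
        \<le> K * ((2 * M powr (1 - s)) powr (q / 2) * a powr (d * (q - 2) / 4))"
      using K by (intro mult_left_mono) auto
    then show ?thesis
      by (intro order_trans[OF sob[OF u t(1) m(1)]] ennreal_leI) (simp add: K'_def mult.assoc)
  qed
  then show ?thesis using K' unfolding d_def by (intro exI[of _ K']) blast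
qed

text \<open>If the gradient vanished, Gagliardo--Nirenberg would hold with every a > 0. The choice q
  = 2 + 4/d makes the power of a equal to 1, so a = e/K bounds the L^q integral by an arbitrary e >
  0 and u vanishes almost everywhere.\<close>

lemma weak_gradient_norm_pos:
  fixes u :: "real^'n \<Rightarrow> complex"
  assumes u: "u \<in> H1" and m: "mass u > 0"
  shows "dirichlet u > 0"
proof (rule ccontr)
  define d where "d = real CARD('n)"
  have d: "d \<ge> 1" unfolding d_def using one_le_card_finite by simp
  define q where "q = 2 + 4 / d"
  have q: "q > 2" using d by (simp add: q_def)
  have "q * (d - 2) = 2 * d - 8 / d" using d by (simp add: q_def field_simps)
  then have q': "q * (d - 2) \<le> 2 * d" using d by simp
  have e1: "d * (q - 2) / 4 = 1" using d by (simp add: q_def)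
  have [measurable]: "u \<in> borel_measurable borel" using u by (auto simp: H1_def Lp_2_iff)
  assume "\<not> dirichlet u > 0"
  then have z: "dirichlet u \<le> 0" by simp
  obtain K where K: "K > 0" and gn: "\<And>a. 0 < a \<Longrightarrow> dirichlet u \<le> a \<Longrightarrow>
      nn_Lp_power q u \<le> ennreal (K * a powr 1)"
    using H1_gagliardo_nirenberg[where 'n='n, OF q _ m] q' e1 u m unfolding d_def by force
  have "nn_Lp_power q u \<le> 0"
  proof (rule ennreal_le_epsilon)
    fix e :: real assume e: "e > 0"
    then show "nn_Lp_power q u \<le> 0 + ennreal e"
      using gn[of "e / K"] order_trans[OF z, of "e / K"] K by simp
  qed
  then have "nn_Lp_power q u = 0" by simp
  then have "AE x in lborel. ennreal (cmod (u x) powr q) = 0"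
    by (subst (asm) nn_integral_0_iff_AE) auto
  then have "AE x in lborel. (cmod (u x))\<^sup>2 = 0"
    by eventually_elim simp
  then have "mass u = 0"
    unfolding mass_def by (subst integral_cong_AE[where g="\<lambda>_. 0"]) auto
  then show False using m by simp
qed

text \<open>A nonpositive virial bounds the gradient term plus the p0-term by the p1-term.
  Interpolating the latter between q and p0 + 2 cancels the p0-term, and Gagliardo--Nirenberg at q
  leaves a \<le> const a^(1 + \<eta>) for the Dirichlet integral a. Since a > 0 and \<eta> > 0, a
  cannot be small.\<close>

lemma virial_nonpos_imp_gradient_ge:
  assumes p1: "4 / real CARD('n) < p1" and p0: "p1 < p0" and M: "M > 0"
  shows "\<exists>\<delta>>0. \<forall>u :: real^'n \<Rightarrow> complex. u \<in> H1 \<longrightarrow> u \<in> Lp (p0 + 2) \<longrightarrow> 0 < mass u \<longrightarrow> mass u \<le> M \<longrightarrow>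
    virial p0 p1 u \<le> 0 \<longrightarrow> \<delta> \<le> dirichlet u"
proof -
  define d where "d = real CARD('n)"
  have d: "d \<ge> 1" unfolding d_def using one_le_card_finite by simp
  have p1d: "4 / d < p1" using p1 by (simp add: d_def)
  have p1pos: "p1 > 0" using p1d d by (smt (verit) divide_nonneg_nonneg)
  \<comment> \<open>\<open>2 + 4 / d + 8 / d\<^sup>2\<close> is below the Sobolev exponent \<open>2 d / (d - 2) = 2 + 4 / d + 8 / (d (d - 2))\<close>.\<close>
  define q where "q = min (p1 + 2) (2 + 4 / d + 8 / d\<^sup>2)"
  have q4: "2 + 4 / d < q" using d p1d by (simp add: q_def)
  have q2: "q > 2" using q4 d by (smt (verit) divide_nonneg_nonneg)
  have qp: "q \<le> p1 + 2" by (simp add: q_def)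
  have q': "q * (d - 2) \<le> 2 * d"
  proof (cases "d \<le> 2")
    case True
    then have "q * (d - 2) \<le> 0" using q2 by (intro mult_nonneg_nonpos) auto
    then show ?thesis using d by linarith
  next
    case False
    have "q * (d - 2) \<le> (2 + 4 / d + 8 / d\<^sup>2) * (d - 2)"
      using False by (intro mult_right_mono) (auto simp: q_def)
    also have "\<dots> = 2 * d - 16 / d\<^sup>2"
      using d by (simp add: field_simps power2_eq_square)
    also have "\<dots> \<le> 2 * d" by simp
    finally show ?thesis .
  qed
  \<comment> \<open>The excess over 1 of the power of \<open>a\<close> in the Gagliardo--Nirenberg
    bound, positive because q > 2 + 4/d.\<close>
  define \<eta> where "\<eta> = d * (q - 2) / 4 - 1"
  have \<eta>: "\<eta> > 0" using q4 d by (simp add: \<eta>_def field_simps)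
  obtain K where K: "K > 0" and gn: "\<And>(u :: real^'n \<Rightarrow> complex) a. u \<in> H1 \<Longrightarrow> 0 < mass u \<Longrightarrow> mass u \<le> M \<Longrightarrow> 0 < a \<Longrightarrow>
      dirichlet u \<le> a \<Longrightarrow>
      nn_Lp_power q u \<le> ennreal (K * a powr (1 + \<eta>))"
    using H1_gagliardo_nirenberg[where 'n='n, OF q2 _ M] q' unfolding \<eta>_def d_def by auto
  \<comment> \<open>1/r is the ratio of the p0-coefficient of the virial to its p1-coefficient. The
    threshold \<nu> is chosen so that interpolation produces the p0-term with exactly this
    factor.\<close>
  define r where "r = p1 * (p0 + 2) / (p0 * (p1 + 2))"
  have r: "r > 0" using p1pos p0 by (simp add: r_def)
  define \<nu> where "\<nu> = r powr (1 / (p0 - p1))"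
  have \<nu>: "\<nu> > 0" using r by (simp add: \<nu>_def)
  have \<nu>r: "\<nu> powr (p1 - p0) = 1 / r"
  proof -
    have "1 / (p0 - p1) * (p1 - p0) = - 1" using p0 by (simp add: field_simps)
    then have "\<nu> powr (p1 - p0) = r powr (- 1)"
      unfolding \<nu>_def powr_powr by simp
    then show ?thesis using r by (simp add: powr_minus_divide)
  qed
  define K2 where "K2 = d * p1 / (2 * (p1 + 2)) * \<nu> powr (p1 + 2 - q)"
  have K2: "K2 > 0" using d p1pos \<nu> by (simp add: K2_def)
  \<comment> \<open>The solution of K2 K \<delta>^\<eta> = 1.\<close>
  define \<delta> where "\<delta> = (1 / (K2 * K)) powr (1 / \<eta>)"
  have \<delta>: "\<delta> > 0" using K K2 by (simp add: \<delta>_def)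
  have "\<delta> \<le> dirichlet u"
    if u: "u \<in> H1" "u \<in> Lp (p0 + 2)" and m: "0 < mass u" "mass u \<le> M" and vir: "virial p0 p1 u \<le> 0"
    for u :: "real^'n \<Rightarrow> complex"
  proof -
    define a where "a = dirichlet u"
    have a: "a > 0" unfolding a_def by (rule weak_gradient_norm_pos[OF u(1) m(1)])
    define X where "X = Lp_power q u"
    define B where "B = Lp_power (p1 + 2) u"
    define C where "C = Lp_power (p0 + 2) u"
    have u2: "u \<in> Lp 2" using u(1) by (simp add: H1_def)
    have uq: "u \<in> Lp q"
      by (rule Lp_interpolate[OF u2 u(2)]) (use q2 qp p0 in auto)
    have Xle: "X \<le> K * a powr (1 + \<eta>)"
    proof -
      have "ennreal X = nn_Lp_power q u"
        unfolding X_def by (rule nn_integral_eq_integral[symmetric]) (use uq in \<open>auto simp: Lp_def\<close>)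
      also have "\<dots> \<le> ennreal (K * a powr (1 + \<eta>))"
        by (rule gn[OF u(1) m a]) (simp add: a_def)
      finally show ?thesis using K by (subst (asm) ennreal_le_iff) auto
    qed
    have Ble: "B \<le> \<nu> powr (p1 + 2 - q) * X + \<nu> powr (p1 - p0) * C"
      using integral_powr_le_interpolate[OF uq u(2) _ qp _ \<nu>] q2 p0 by (simp add: B_def X_def C_def)
    have "d * p1 / (2 * (p1 + 2)) * B \<le> d * p1 / (2 * (p1 + 2)) * (\<nu> powr (p1 + 2 - q) * X + \<nu> powr (p1 - p0) * C)"
      using d p1pos by (intro mult_left_mono Ble) auto
    also have "\<dots> = K2 * X + d * p0 / (2 * (p0 + 2)) * C"
    proof -
      have "d * p1 / (2 * (p1 + 2)) * (1 / r) = d * p0 / (2 * (p0 + 2))"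
      proof -
        have "d * p1 / (2 * y1) * (1 / (p1 * y0 / (p0 * y1))) = d * p0 / (2 * y0)" if "y0 > 0" "y1 > 0" for y0 y1
          using p1pos p0 that by (simp add: field_simps)
        then show ?thesis
          unfolding r_def using p1pos p0 by (metis add_pos_pos less_trans zero_less_numeral)
      qed
      then have "d * p1 / (2 * (p1 + 2)) * (\<nu> powr (p1 - p0) * C) = d * p0 / (2 * (p0 + 2)) * C"
        unfolding \<nu>r by (simp only: mult.assoc[symmetric])
      then show ?thesis by (simp only: K2_def distrib_left mult.assoc)
    qed
    finally have "a \<le> K2 * X"
      using vir unfolding virial_def a_def[symmetric] B_def[symmetric] C_def[symmetric] d_def[symmetric] by linarith
    also have "\<dots> \<le> K2 * (K * a powr (1 + \<eta>))"
      using K2 by (intro mult_left_mono Xle) auto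
    also have "\<dots> = (K2 * K * a powr \<eta>) * a"
      using a by (simp add: powr_add)
    finally have "1 \<le> K2 * K * a powr \<eta>" using a by simp
    then have "1 / (K2 * K) \<le> a powr \<eta>" using K K2 by (simp add: divide_simps mult.commute)
    then have "\<delta> \<le> (a powr \<eta>) powr (1 / \<eta>)"
      unfolding \<delta>_def using K K2 \<eta> by (intro powr_mono2) auto
    also have "\<dots> = a" using a \<eta> by (simp add: powr_powr)
    finally show ?thesis by (simp add: a_def)
  qed
  then show ?thesis using \<delta> by blast
qed

text \<open>The scaling with c^(p0 - p1) = p0/p1 gives the two power terms in
  \<open>critical_mass_inequality\<close> the ratio they have in the virial; multiplication by d p1
  / 4 then produces the virial coefficients themselves. The gradient is left with the coefficient d
  p1 \<kappa> / (4 x), which is below 1 exactly for masses below the stated threshold.\<close>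

lemma virial_pos_below_critical_mass_tilde:
  fixes u :: "real^'n \<Rightarrow> complex"
  assumes p1: "4 / real CARD('n) < p1" and p0: "p1 < p0" and mc: "is_critical_mass TYPE('n) p0 p1 mc"
    and u: "u \<in> H1" "u \<in> Lp (p0 + 2)" and m: "0 < mass u" "mass u < critical_mass_tilde CARD('n) p0 p1 mc"
  shows "virial p0 p1 u > 0"
proof -
  define d where "d = real CARD('n)"
  have d: "d \<ge> 1" unfolding d_def using one_le_card_finite by simp
  have p1d: "4 / d < p1" using p1 by (simp add: d_def)
  have p1pos: "p1 > 0" using p1d d by (smt (verit) divide_nonneg_nonneg)
  have mc0: "mc > 0" using mc by (simp add: is_critical_mass_def)
  define a where "a = dirichlet u"
  have a: "a > 0" unfolding a_def by (rule weak_gradient_norm_pos[OF u(1) m(1)])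
  define B where "B = Lp_power (p1 + 2) u"
  define C where "C = Lp_power (p0 + 2) u"
  define \<kappa> where "\<kappa> = (mass u / mc) powr (2 / d)"
  define r where "r = p0 / p1"
  have r: "r > 0" using p1pos p0 by (simp add: r_def)
  define c where "c = r powr (1 / (p0 - p1))"
  have c: "c > 0" using r by (simp add: c_def)
  have c0: "c powr p0 = c powr p1 * r"
  proof -
    have "c powr (p0 - p1) = r" using p0 r by (simp add: c_def powr_powr)
    then show ?thesis by (metis powr_add add.commute diff_add_cancel mult.commute)
  qed
  \<comment> \<open>Equal to c^(p1 - 4/d), the factor by which this scaling lowers the gradient term
    relative to the p1-term.\<close>
  define x where "x = r powr ((p1 - 4 / d) / (p0 - p1))"
  have x: "x > 0" using r by (simp add: x_def)
  have c4: "c powr (4 / d) = c powr p1 / x"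
  proof -
    have "x = c powr (p1 - 4 / d)" by (simp add: x_def c_def powr_powr)
    then show ?thesis using c by (simp add: powr_diff)
  qed
  have k: "\<kappa> < x * (4 / (d * p1))"
  proof -
    have "mass u / mc < r powr ((p1 * d - 4) / (2 * (p0 - p1))) * (4 / (d * p1)) powr (d / 2)"
      using m(2) mc0 by (simp add: critical_mass_tilde_def r_def d_def divide_less_eq)
    then have "\<kappa> < (r powr ((p1 * d - 4) / (2 * (p0 - p1))) * (4 / (d * p1)) powr (d / 2)) powr (2 / d)"
      unfolding \<kappa>_def using m(1) mc0 d by (intro powr_less_mono2) auto
    also have "\<dots> = x * (4 / (d * p1))"
    proof -
      have "(p1 * d - 4) / (2 * (p0 - p1)) * (2 / d) = (p1 - 4 / d) / (p0 - p1)"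
      proof -
        have *: "(p1 * d - 4) / (2 * D) * (2 / d) = (p1 - 4 / d) / D" if "D > 0" for D
          using d that by (simp add: field_simps)
        show ?thesis by (rule *) (use p0 in simp)
      qed
      moreover have "d / 2 * (2 / d) = 1" using d by simp
      ultimately show ?thesis
        using powr_one[of "4 / (d * p1)"] d p1pos by (simp only: powr_mult powr_powr x_def) simp
    qed
    finally show ?thesis .
  qed
  have "2 / (p1 + 2) * c powr p1 * B \<le> \<kappa> * c powr (4 / d) * a + 2 / (p0 + 2) * c powr p0 * C"
    unfolding \<kappa>_def a_def B_def C_def d_def by (rule critical_mass_inequality[OF mc p1pos p0 u m(1) c])
  then have "c powr p1 * (2 / (p1 + 2) * B) \<le> c powr p1 * (\<kappa> / x * a + 2 / (p0 + 2) * r * C)"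
    unfolding c0 c4 by (simp add: algebra_simps)
  then have "2 / (p1 + 2) * B \<le> \<kappa> / x * a + 2 / (p0 + 2) * r * C"
    using c by (simp only: mult_le_cancel_left_pos powr_gt_zero)
  then have "d * p1 / 4 * (2 / (p1 + 2) * B) \<le> d * p1 / 4 * (\<kappa> / x * a + 2 / (p0 + 2) * r * C)"
    using d p1pos by (intro mult_left_mono) auto
  also have "\<dots> = (d * p1 / 4 * (\<kappa> / x)) * a + d * p0 / (2 * (p0 + 2)) * C"
  proof -
    have "d * p1 / 4 * (2 / y * r * C) = d * (p1 * r) / (2 * y) * C" for y
      by simp
    moreover have "p1 * r = p0" using p1pos by (simp add: r_def)
    ultimately show ?thesis by (simp only: distrib_left mult.assoc [of _ _ a])
  qed
  also have "(d * p1 / 4 * (\<kappa> / x)) * a < 1 * a"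
  proof (rule mult_strict_right_mono[OF _ a])
    have "\<kappa> / x < 4 / (d * p1)" using k x by (simp add: divide_less_eq mult.commute)
    then have "d * p1 / 4 * (\<kappa> / x) < d * p1 / 4 * (4 / (d * p1))"
      using d p1pos by (intro mult_strict_left_mono) auto
    then show "d * p1 / 4 * (\<kappa> / x) < 1" using d p1pos by simp
  qed
  also have "d * p1 / 4 * (2 / (p1 + 2) * B) = d * p1 / (2 * (p1 + 2)) * B"
    by (simp add: divide_simps)
  finally have "d * p1 / (2 * (p1 + 2)) * B < a + d * p0 / (2 * (p0 + 2)) * C"
    by (simp only: mult_1)
  then show ?thesis
    unfolding virial_def a_def[symmetric] B_def[symmetric] C_def[symmetric] d_def[symmetric] by linarith
qed

text \<open>With c = 1 the p0-term in \<open>critical_mass_inequality\<close> is that of the energy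
  and cancels.\<close>

lemma energy_ge_gradient:
  fixes u :: "real^'n \<Rightarrow> complex"
  assumes mc: "is_critical_mass TYPE('n) p0 p1 mc" and p: "0 < p1" "p1 < p0"
    and u: "u \<in> H1" "u \<in> Lp (p0 + 2)" and m: "mass u > 0"
  shows "(1 - (mass u / mc) powr (2 / real CARD('n))) * dirichlet u \<le> energy p0 p1 u"
  using critical_mass_inequality[OF mc p u m zero_less_one] unfolding energy_def
  by (simp add: left_diff_distrib)

theorem theorem1p1:
  fixes d :: nat and p0 p1 mc mct :: real
  assumes d: "d = CARD('n::finite)"
    and p1: "4 / real d < p1"
    and p0: "p1 < p0"
    and mc: "is_critical_mass TYPE('n) p0 p1 mc"
    and mct: "mct = critical_mass_tilde d p0 p1 mc"
  shows "\<exists>e :: real \<Rightarrow> ereal.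
    (\<forall>m\<in>{0..<mc}. 0 < e m) \<and>
    antimono_on {0..<mc} e \<and>
    (\<forall>m. 0 < m \<and> m < mct \<longrightarrow> e m = \<infinity>) \<and>
    (\<forall>m. mct \<le> m \<and> m < mc \<longrightarrow> 0 < e m \<and> e m < \<infinity>) \<and>
    (\<forall>u :: real^'n \<Rightarrow> complex. u \<in> region p0 p1 mc e \<longrightarrow> virial p0 p1 u > 0) \<and>
    (d \<in> {1, 2, 3, 4} \<or> p0 \<le> 4 / (real d - 2) \<longrightarrow> strict_antimono_on {mct..<mc} e)"
proof -
  have d0: "real d > 0" by (simp add: d)
  have p1pos: "p1 > 0" using p1 d0 by (smt (verit) divide_nonneg_nonneg)
  have mc0: "mc > 0" using mc by (simp add: is_critical_mass_def)
  have mct0: "mct > 0"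
    using d0 p1pos p0 mc0 by (simp add: mct critical_mass_tilde_def)
  have p1': "4 / real CARD('n) < p1" using p1 by (simp add: d)
  obtain \<delta> where \<delta>: "\<delta> > 0"
    and grad: "\<And>u :: real^'n \<Rightarrow> complex. u \<in> H1 \<Longrightarrow> u \<in> Lp (p0 + 2) \<Longrightarrow> 0 < mass u \<Longrightarrow> mass u \<le> mc \<Longrightarrow>
      virial p0 p1 u \<le> 0 \<Longrightarrow> \<delta> \<le> dirichlet u"
    using virial_nonpos_imp_gradient_ge[OF p1' p0 mc0] by blast
  \<comment> \<open>The factor from \<open>energy_ge_gradient\<close> times the least Dirichlet
    integral allowed for a nonpositive virial, hence a lower bound for the energy of every such
    function of mass \<open>m\<close>.\<close>
  define h where "h m = \<delta> * (1 - (m / mc) powr (2 / real d))" for m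
  have h_less: "h m' < h m" if "0 \<le> m" "m < m'" for m m'
    unfolding h_def using that \<delta> mc0 d0
    by (intro mult_strict_left_mono diff_strict_left_mono powr_less_mono2 divide_strict_right_mono) auto
  have "h mc = 0" using mc0 by (simp add: h_def)
  then have h_pos: "h m > 0" if "0 \<le> m" "m < mc" for m
    using h_less[OF that] by simp
  \<comment> \<open>The first case includes m = 0, where monotonicity forces \<infinity> because
    \<open>mct\<close> is positive.\<close>
  define e where "e m = (if m < mct then \<infinity> else ereal (h m))" for m
  have less: "e m' < e m" if "mct \<le> m" "m < m'" for m m'
    using h_less[of m m'] that mct0 by (simp add: e_def)
  have anti: "e m' \<le> e m" if "m \<le> m'" for m m'
    using less[of m m'] that by (cases "m < mct"; cases "m = m'") (auto simp: e_def)
  have "virial p0 p1 u > 0" if "u \<in> region p0 p1 mc e" for u :: "real^'n \<Rightarrow> complex"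
  proof (rule ccontr)
    assume "\<not> virial p0 p1 u > 0"
    then have vir: "virial p0 p1 u \<le> 0" by simp
    have us: "u \<in> Hs (real CARD('n) / 2 - 2 / p0)" and u: "u \<in> H1" and m: "0 < mass u" "mass u < mc"
      and E: "ereal (energy p0 p1 u) < e (mass u)"
      using that by (auto simp: region_def)
    have up: "u \<in> Lp (p0 + 2)"
      by (rule Hs_H1_imp_Lp[OF _ us u m(1)]) (use p1pos p0 in simp)
    have "\<not> mass u < mct"
      using virial_pos_below_critical_mass_tilde[OF p1' p0 mc u up m(1)] vir by (auto simp: mct d)
    then have "energy p0 p1 u < h (mass u)"
      using E by (simp add: e_def)
    also have "h (mass u) = (1 - (mass u / mc) powr (2 / real d)) * \<delta>"
      by (simp add: h_def)
    \<comment> \<open>The lower bound \<delta> can be inserted because the factor in front is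
      nonnegative for masses below \<open>mc\<close>.\<close>
    also have "\<dots> \<le> (1 - (mass u / mc) powr (2 / real d)) * dirichlet u"
    proof (rule mult_left_mono)
      show "\<delta> \<le> dirichlet u"
        by (rule grad[OF u up m(1) _ vir]) (use m in simp)
      show "0 \<le> 1 - (mass u / mc) powr (2 / real d)"
        using h_pos[of "mass u"] m \<delta> by (simp add: h_def zero_less_mult_iff)
    qed
    also have "\<dots> \<le> energy p0 p1 u"
      using energy_ge_gradient[OF mc p1pos p0 u up m(1)] by (simp add: d)
    finally show False by simp
  qed
  moreover have "0 < e m" if "0 \<le> m" "m < mc" for m
    using h_pos[OF that] by (simp add: e_def)
  moreover have "e m < \<infinity>" if "mct \<le> m" for m
    using that by (simp add: e_def)
  moreover have "e m = \<infinity>" if "m < mct" for m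
    using that by (simp add: e_def)
  ultimately show ?thesis
    using anti less mct0
    by (intro exI[of _ e]) (auto simp: monotone_on_def)
qed

end
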